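(* Let $\Omega=(0,1)\times(0,1)$, let $\mathcal T_h$ be the piecewise symmetric triangulation of $\Omega$ described in the context (with $h=1/(4J)$, $J$ a positive integer), let $\mathcal P_h'=\{z=(x_J,y_m)\in\mathcal P\}$ be the set of mesh vertices on the line $x=1/4$ lying in the square $\mathcal P$, and let $v_h=\sum_{z\in\mathcal P_h'}\Phi_z$, where $\Phi_z\in S_h$ is the nodal basis function of $S_h$ at $z$. Then for every $t>0$ there is a constant $c(t)>0$, independent of $h$, such that, for all $h$ sufficiently small, $$\|\tilde E_h(t)\tilde\Delta_hQ_hv_h\|\ge c(t)\,h^{3/2}\,\|v_h\|.$$
   Context: Triangulation: let $J$ be a positive integer, $N=7J$, $M=4J$, $h=1/(4J)$; let $x_j=jh$ for $0\le j\le J$, $x_j=\tfrac14+(j-J)h/2$ for $J<j\le N$, and $y_m=mh$ for $m=0,\dots,M$. Each rectangle $(x_j,x_{j+1})\times(y_m,y_{m+1})$ is split into two triangles by the diagonal connecting its upper left corner $(x_j,y_{m+1})$ with its lower right corner $(x_{j+1},y_m)$. This gives $\mathcal T_h$. The square $\mathcal P$: let $\phi_1(x,y)=2\sin(\pi x)\sin(\pi y)$ (the first Dirichlet eigenfunction of $-\Delta$ on $\Omega$). Since $\nabla\phi_1(1/4,1/4)\cdot(3,-1)=2\pi$, one can fix $0<d<1/4$ such that $\nabla\phi_1(z)\cdot(3,-1)\ge1$ for all $z\in\mathcal P:=[1/4-d,1/4+d]^2$. $(\cdot,\cdot)$ and $\|\cdot\|$ are the inner product and norm of $L_2(\Omega)$.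 $S_h$ is the space of continuous functions on $\overline\Omega$ that are linear on each $\tau\in\mathcal T_h$ and vanish on $\partial\Omega$. The nodal basis function $\Phi_z\in S_h$ equals $1$ at the vertex $z$ and $0$ at all other vertices. Control volumes: for each triangle $\tau$, connect its barycenter by line segments to the midpoints of its edges, which partitions $\tau$ into three quadrilaterals $\tau_z$, one for each vertex $z$ of $\tau$. For a vertex $z$ of $\mathcal T_h$, the control volume $V_z$ is the union of the $\tau_z$ over all triangles $\tau$ having $z$ as a vertex. Let $Z_h^0$ be the set of interior vertices and $J_h\chi=\sum_{z\in Z_h^0}\chi(z)\Psi_z$, where $\Psi_z$ is the characteristic function of $V_z$ (the operator $J_h$ is unrelated to the integer $J$). Then $\langle\chi,\psi\rangle=(\chi,J_h\psi)$ is an inner product on $S_h$. The operator $\tilde\Delta_h:S_h\to S_h$ is defined by $-\langle\tilde\Delta_h\psi,\chi\rangle=(\nabla\psi,\nabla\chi)$ for all $\psi,\chi\in S_h$, and $\tilde E_h(t)=e^{\tilde\Delta_ht}$. The operator $Q_h:S_h\to S_h$ is defined by $(\nabla Q_h\psi,\nabla\chi)=(\psi,J_h\chi)-(\psi,\chi)$ for all $\psi,\chi\in S_h$. *)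

theory Defs
  imports "HOL-Analysis.Analysis"
begin

definition Omega :: "(real \<times> real) set" where
  "Omega = {0<..<1} \<times> {0<..<1}"

definition l2_inner :: "(real \<times> real \<Rightarrow> real) \<Rightarrow> (real \<times> real \<Rightarrow> real) \<Rightarrow> real" where
  "l2_inner f g = (LINT z:Omega|lebesgue. f z * g z)"

definition l2_norm :: "(real \<times> real \<Rightarrow> real) \<Rightarrow> real" where
  "l2_norm f = sqrt (l2_inner f f)"

definition grad :: "(real \<times> real \<Rightarrow> real) \<Rightarrow> real \<times> real \<Rightarrow> real \<times> real" where
  "grad f z = (THE D. GDERIV f z :> D)"

text \<open>For a piecewise linear function the classical gradient exists off the edges of the
  triangulation, that is almost everywhere, and there it is the weak gradient.\<close>

definition grad_inner :: "(real \<times> real \<Rightarrow> real) \<Rightarrow> (real \<times> real \<Rightarrow> real) \<Rightarrow> real" where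
  "grad_inner f g = (LINT z:Omega|lebesgue. grad f z \<bullet> grad g z)"

definition phi1 :: "real \<times> real \<Rightarrow> real" where
  "phi1 = (\<lambda>(x, y). 2 * sin (pi * x) * sin (pi * y))"

definition square :: "real \<Rightarrow> (real \<times> real) set" where
  "square d = {1/4 - d..1/4 + d} \<times> {1/4 - d..1/4 + d}"

definition mesh_size :: "nat \<Rightarrow> real" where
  "mesh_size J = 1 / (4 * real J)"

definition mesh_x :: "nat \<Rightarrow> nat \<Rightarrow> real" where
  "mesh_x J j = (if j \<le> J then real j * mesh_size J
                 else 1/4 + (real j - real J) * mesh_size J / 2)"

definition mesh_y :: "nat \<Rightarrow> nat \<Rightarrow> real" where
  "mesh_y J m = real m * mesh_size J"

definition mesh_pt :: "nat \<Rightarrow> nat \<Rightarrow> nat \<Rightarrow> real \<times> real" where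
  "mesh_pt J j m = (mesh_x J j, mesh_y J m)"

definition vertices :: "nat \<Rightarrow> (real \<times> real) set" where
  "vertices J = {mesh_pt J j m |j m. j \<le> 7 * J \<and> m \<le> 4 * J}"

definition interior_vertices :: "nat \<Rightarrow> (real \<times> real) set" where
  "interior_vertices J = vertices J \<inter> Omega"

text \<open>A triangle is represented by the set \<open>T\<close> of its three vertices; the closed triangle
  is \<open>convex hull T\<close>.\<close>

definition triangulation :: "nat \<Rightarrow> (real \<times> real) set set" where
  "triangulation J =
     {{mesh_pt J j m, mesh_pt J (j + 1) m, mesh_pt J j (m + 1)} |j m. j < 7 * J \<and> m < 4 * J} \<union>
     {{mesh_pt J (j + 1) (m + 1), mesh_pt J (j + 1) m, mesh_pt J j (m + 1)} |j m.
        j < 7 * J \<and> m < 4 * J}"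

text \<open>Functions on the closure of \<open>Omega\<close> are represented by their extension by zero to the
  whole plane, so that equality of functions in the space is equality in HOL.\<close>

definition S_space :: "nat \<Rightarrow> (real \<times> real \<Rightarrow> real) set" where
  "S_space J = {\<eta>. continuous_on (closure Omega) \<eta> \<and>
     (\<forall>T\<in>triangulation J. \<exists>a b. \<forall>z\<in>convex hull T. \<eta> z = a + b \<bullet> z) \<and>
     (\<forall>z\<in>frontier Omega. \<eta> z = 0) \<and>
     (\<forall>z. z \<notin> closure Omega \<longrightarrow> \<eta> z = 0)}"

definition nodal_basis :: "nat \<Rightarrow> real \<times> real \<Rightarrow> (real \<times> real \<Rightarrow> real)" where
  "nodal_basis J z =
     (THE \<eta>. \<eta> \<in> S_space J \<and> \<eta> z = 1 \<and> (\<forall>w\<in>vertices J - {z}. \<eta> w = 0))"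

definition barycenter :: "(real \<times> real) set \<Rightarrow> real \<times> real" where
  "barycenter T = (1/3) *\<^sub>R (\<Sum>w\<in>T. w)"

text \<open>The (convex) quadrilateral of the triangle \<open>T\<close> belonging to its vertex \<open>z\<close>. Its corners
  are the barycenter, the midpoints of the two edges at \<open>z\<close>, and \<open>z = midpoint z z\<close>.\<close>

definition quadrilateral :: "(real \<times> real) set \<Rightarrow> real \<times> real \<Rightarrow> (real \<times> real) set" where
  "quadrilateral T z = convex hull (insert (barycenter T) (midpoint z ` T))"

definition control_volume :: "nat \<Rightarrow> real \<times> real \<Rightarrow> (real \<times> real) set" where
  "control_volume J z = (\<Union>T\<in>{T \<in> triangulation J. z \<in> T}. quadrilateral T z)"

definition J_op :: "nat \<Rightarrow> (real \<times> real \<Rightarrow> real) \<Rightarrow> (real \<times> real \<Rightarrow> real)" where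
  "J_op J \<eta> = (\<lambda>p. \<Sum>z\<in>interior_vertices J. \<eta> z * indicator (control_volume J z) p)"

definition lumped_inner ::
    "nat \<Rightarrow> (real \<times> real \<Rightarrow> real) \<Rightarrow> (real \<times> real \<Rightarrow> real) \<Rightarrow> real" where
  "lumped_inner J \<eta> \<psi> = l2_inner \<eta> (J_op J \<psi>)"

text \<open>The operators below are meant on \<open>S_space J\<close> only. Existence and uniqueness of the described
  elements follow from \<open>lumped_inner J\<close> and \<open>grad_inner\<close> being inner products on this
  finite-dimensional space.\<close>

definition Delta_op :: "nat \<Rightarrow> (real \<times> real \<Rightarrow> real) \<Rightarrow> (real \<times> real \<Rightarrow> real)" where
  "Delta_op J \<psi> =
     (THE \<phi>. \<phi> \<in> S_space J \<and> (\<forall>\<eta>\<in>S_space J. - lumped_inner J \<phi> \<eta> = grad_inner \<psi> \<eta>))"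

definition Q_op :: "nat \<Rightarrow> (real \<times> real \<Rightarrow> real) \<Rightarrow> (real \<times> real \<Rightarrow> real)" where
  "Q_op J \<psi> =
     (THE \<phi>. \<phi> \<in> S_space J \<and>
        (\<forall>\<eta>\<in>S_space J. grad_inner \<phi> \<eta> = l2_inner \<psi> (J_op J \<eta>) - l2_inner \<psi> \<eta>))"

text \<open>The exponential series of \<open>t A\<close>, applied to \<open>\<psi>\<close> and summed pointwise; on a
  finite-dimensional space of functions this is convergence in any norm.\<close>

definition op_exp :: "(('a \<Rightarrow> real) \<Rightarrow> ('a \<Rightarrow> real)) \<Rightarrow> real \<Rightarrow> ('a \<Rightarrow> real) \<Rightarrow> ('a \<Rightarrow> real)" where
  "op_exp A t \<psi> = (\<lambda>p. \<Sum>n. t ^ n / fact n * (A ^^ n) \<psi> p)"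

definition E_op :: "nat \<Rightarrow> real \<Rightarrow> (real \<times> real \<Rightarrow> real) \<Rightarrow> (real \<times> real \<Rightarrow> real)" where
  "E_op J t = op_exp (Delta_op J) t"

definition P_vertices :: "nat \<Rightarrow> real \<Rightarrow> (real \<times> real) set" where
  "P_vertices J d = {mesh_pt J J m |m. m \<le> 4 * J} \<inter> square d"

definition v_fun :: "nat \<Rightarrow> real \<Rightarrow> (real \<times> real \<Rightarrow> real)" where
  "v_fun J d = (\<lambda>p. \<Sum>z\<in>P_vertices J d. nodal_basis J z p)"

end

theory Submission
  imports Defs
begin

text \<open>Write \<open>m\<close> for the lumped inner product, \<open>a\<close> for the Dirichlet form, \<open>D\<close> for the discrete Laplacian,
  and \<open>e(\<psi>, \<eta>) = (\<psi>, J \<eta>) - (\<psi>, \<eta>)\<close> for the defect that defines \<open>Q\<close>. It suffices to test the evolved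
  function against one fixed element of \<open>S\<close>, the interpolant \<open>\<theta>\<close> of the first eigenfunction \<open>\<phi>\<close>.
  At time zero both inverse operators drop out of the pairing:
  \<open>m(D Q v, \<theta>) = - a(Q v, \<theta>) = - e(v, \<theta>)\<close>.

  On a triangle \<open>T\<close> the defect is \<open>|T|/54\<close> times the sum over the edges of the products of the
  differences of the two functions. Hence the defect of a nodal basis function against \<open>\<theta>\<close> is a
  combination of differences of \<open>\<phi>\<close> over the six triangles at the node. At a node with equal
  neighbouring cells the first-order terms cancel, but on the line \<open>x = 1/4\<close>, where the cell width jumps from
  \<open>h\<close> to \<open>h/2\<close>, there remains, up to \<open>O(h^4)\<close>, \<open>h^3/108\<close> times the derivative of \<open>\<phi>\<close> in direction \<open>(3, -1)\<close>, which is at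
  least one in the square, and \<open>v\<close> collects at least \<open>d/h\<close> such nodes, so \<open>e(v, \<theta>)\<close> is bounded
  below by a multiple of \<open>h^2\<close> (\<open>defect_stencil_ge\<close>, \<open>defect_lower_bound\<close>). Since \<open>v\<close> lives on two
  columns of cells, its norm is at most \<open>sqrt (2h)\<close> (\<open>v_norm\<close>), and \<open>h^2\<close> is \<open>h^(3/2)\<close> times that order.

  It remains to follow the pairing up to time \<open>t\<close>. The interpolant is not an exact eigenfunction of
  \<open>D\<close>, but \<open>\<rho> = D \<theta> + \<lambda> \<theta>\<close> with \<open>\<lambda> = 2 pi^2\<close> is small. With \<open>q = Q v\<close> and \<open>u(s) = E(s) D q\<close> the
  function \<open>exp(\<lambda> s) m(u(s), \<theta>)\<close> has derivative \<open>exp(\<lambda> s) m(\<rho>, u(s))\<close>. This is controlled in the time mean, because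
  \<open>m(u(s), u(s))\<close> is \<open>-1/2\<close> times the derivative of the Dirichlet energy of \<open>E(s) q\<close>. So the change of the
  pairing is bounded, for every \<open>\<alpha> > 0\<close>, by \<open>exp(\<lambda> t)\<close> times \<open>\<alpha>/4 a(q, q) + t/(2\<alpha>) m(\<rho>, \<rho>)\<close>
  (\<open>perturbed_eigenfunction\<close>). The local support of \<open>v\<close> gives \<open>a(q, q) \<le> h^3\<close> (\<open>Q_energy\<close>), and
  a second-order Taylor expansion gives \<open>m(\<rho>, \<rho>) = O(h^2)\<close> (\<open>residual_energy\<close>); the interface does not
  spoil the latter, since the stiffness stencil divides each difference by its own cell width. A large
  fixed \<open>\<alpha>\<close> and then a small \<open>h\<close> make the change at most half of the initial pairing.

  The remaining work is to reduce the integrals to nodal values. Every triangle is the image of one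
  reference triangle under an axis-parallel map, which yields the element matrices of \<open>m\<close>, \<open>a\<close> and the
  \<open>L2\<close> product (\<open>lumped_formula\<close>, \<open>grad_formula\<close>, \<open>l2_formula\<close>), and \<open>assembly\<close> turns
  sums over triangles into sums over nodes.\<close>

section \<open>Galerkin problems in finite-dimensional function spaces\<close>

text \<open>Gaussian elimination. The Schur complement of a pivot is again positive: its quadratic form at \<open>u\<close> is
  the full form at the extension of \<open>u\<close> for which the pivot row vanishes.\<close>

lemma positive_definite_solvable:
  fixes B :: "'a \<Rightarrow> 'a \<Rightarrow> real" and r :: "'a \<Rightarrow> real"
  assumes "finite Z"
    and "\<And>u. (\<exists>z\<in>Z. u z \<noteq> 0) \<Longrightarrow> (\<Sum>i\<in>Z. u i * (\<Sum>j\<in>Z. B i j * u j)) > 0"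
  shows "\<exists>u. \<forall>i\<in>Z. (\<Sum>j\<in>Z. B i j * u j) = r i"
  using assms
proof (induction Z arbitrary: B r rule: finite_induct)
  case empty
  then show ?case by simp
next
  case (insert z Z)
  have "(\<Sum>i\<in>insert z Z. of_bool (i = z) * (\<Sum>j\<in>insert z Z. B i j * of_bool (j = z))) > 0"
    by (rule insert.prems) auto
  then have piv: "B z z > 0"
    using insert.hyps by (simp add: sum.insert[OF insert.hyps(1,2)] if_distrib cong: if_cong)
  define C where "C = (\<lambda>i j. B i j - B i z * B z j / B z z)"
  have "\<exists>u. \<forall>i\<in>Z. (\<Sum>j\<in>Z. C i j * u j) = r i - B i z * r z / B z z"
  proof (rule insert.IH)
    fix u :: "'a \<Rightarrow> real" assume nz: "\<exists>z\<in>Z. u z \<noteq> 0"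
    \<comment> \<open>the extension of \<open>u\<close> for which row \<open>z\<close> vanishes\<close>
    define w where "w = (\<lambda>i. if i = z then - (\<Sum>j\<in>Z. B z j * u j) / B z z else u i)"
    have wu: "w i = u i" if "i \<in> Z" for i using that insert.hyps by (auto simp: w_def)
    have wz: "w z = - (\<Sum>j\<in>Z. B z j * u j) / B z z" by (simp add: w_def)
    have row: "(\<Sum>j\<in>insert z Z. B i j * w j) = B i z * w z + (\<Sum>j\<in>Z. B i j * u j)" for i
      using insert.hyps by (simp add: wu)
    have rz: "(\<Sum>j\<in>insert z Z. B z j * w j) = 0"
      unfolding row wz using piv by simp
    have ri: "(\<Sum>j\<in>insert z Z. B i j * w j) = (\<Sum>j\<in>Z. C i j * u j)" for i
      unfolding row wz C_def
      by (simp add: algebra_simps sum_subtractf sum_distrib_left sum_divide_distrib)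
    have "(\<Sum>i\<in>insert z Z. w i * (\<Sum>j\<in>insert z Z. B i j * w j)) > 0"
      by (rule insert.prems) (use nz wu in auto)
    also have "(\<Sum>i\<in>insert z Z. w i * (\<Sum>j\<in>insert z Z. B i j * w j)) = (\<Sum>i\<in>Z. w i * (\<Sum>j\<in>insert z Z. B i j * w j))"
      using sum.insert[OF insert.hyps(1,2), of "\<lambda>i. w i * (\<Sum>j\<in>insert z Z. B i j * w j)"] rz by simp
    also have "\<dots> = (\<Sum>i\<in>Z. u i * (\<Sum>j\<in>Z. C i j * u j))"
      by (intro sum.cong refl) (simp only: ri wu)
    finally show "(\<Sum>i\<in>Z. u i * (\<Sum>j\<in>Z. C i j * u j)) > 0" .
  qed
  then obtain u where u: "\<And>i. i \<in> Z \<Longrightarrow> (\<Sum>j\<in>Z. C i j * u j) = r i - B i z * r z / B z z" by blast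
  define w where "w = (\<lambda>i. if i = z then (r z - (\<Sum>j\<in>Z. B z j * u j)) / B z z else u i)"
  have wu: "w i = u i" if "i \<in> Z" for i using that insert.hyps by (auto simp: w_def)
  have wz: "w z = (r z - (\<Sum>j\<in>Z. B z j * u j)) / B z z" by (simp add: w_def)
  have row: "(\<Sum>j\<in>insert z Z. B i j * w j) = B i z * w z + (\<Sum>j\<in>Z. B i j * u j)" for i
    using insert.hyps by (simp add: wu)
  have ri: "B i z * w z + (\<Sum>j\<in>Z. B i j * u j) = (\<Sum>j\<in>Z. C i j * u j) + B i z * r z / B z z" for i
    unfolding wz C_def
    by (simp add: algebra_simps sum_subtractf sum_distrib_left sum_divide_distrib diff_divide_distrib)
  have "(\<Sum>j\<in>insert z Z. B i j * w j) = r i" if "i \<in> insert z Z" for i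
  proof (cases "i = z")
    case True
    then show ?thesis unfolding row wz using piv by simp
  next
    case False
    then have "i \<in> Z" using that by simp
    from u[OF this] show ?thesis unfolding row ri by simp
  qed
  then show ?case by blast
qed

text \<open>A space of functions that is determined by the values on a finite set \<open>Z\<close> of nodes, with the nodal basis
  \<open>b\<close>. Carrying functions instead of coordinate vectors keeps the operators of the scheme, which act on functions, in
  their original form.\<close>

locale function_space =
  fixes V :: "('a \<Rightarrow> real) set" and Z :: "'a set" and b :: "'a \<Rightarrow> 'a \<Rightarrow> real"
  assumes fin: "finite Z"
    and basis_mem: "z \<in> Z \<Longrightarrow> b z \<in> V"
    and basis_kron: "z \<in> Z \<Longrightarrow> w \<in> Z \<Longrightarrow> b z w = of_bool (w = z)"
    and zero_mem: "(\<lambda>p. 0) \<in> V"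
    and lin_mem: "f \<in> V \<Longrightarrow> g \<in> V \<Longrightarrow> (\<lambda>p. f p + c * g p) \<in> V"
    and expand: "f \<in> V \<Longrightarrow> (\<lambda>p. \<Sum>z\<in>Z. f z * b z p) = f"
begin

definition linear_form :: "(('a \<Rightarrow> real) \<Rightarrow> real) \<Rightarrow> bool" where
  "linear_form l \<longleftrightarrow> (\<forall>f\<in>V. \<forall>g\<in>V. \<forall>c. l (\<lambda>p. f p + c * g p) = l f + c * l g)"

definition semi_inner :: "(('a \<Rightarrow> real) \<Rightarrow> ('a \<Rightarrow> real) \<Rightarrow> real) \<Rightarrow> bool" where
  "semi_inner B \<longleftrightarrow> (\<forall>k\<in>V. linear_form (\<lambda>f. B f k)) \<and> (\<forall>f\<in>V. \<forall>g\<in>V. B f g = B g f) \<and> (\<forall>f\<in>V. B f f \<ge> 0)"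

definition inner_form :: "(('a \<Rightarrow> real) \<Rightarrow> ('a \<Rightarrow> real) \<Rightarrow> real) \<Rightarrow> bool" where
  "inner_form B \<longleftrightarrow> semi_inner B \<and> (\<forall>f\<in>V. B f f = 0 \<longrightarrow> (\<forall>z\<in>Z. f z = 0))"

lemma linear_formD:
  "linear_form l \<Longrightarrow> f \<in> V \<Longrightarrow> g \<in> V \<Longrightarrow> l (\<lambda>p. f p + c * g p) = l f + c * l g"
  by (simp add: linear_form_def)

lemma comb_mem: "finite Y \<Longrightarrow> Y \<subseteq> Z \<Longrightarrow> (\<lambda>p. \<Sum>z\<in>Y. c z * b z p) \<in> V"
proof (induction rule: finite_induct)
  case empty
  then show ?case by (simp add: zero_mem)
next
  case (insert z Y)
  then have "(\<lambda>p. (\<Sum>z\<in>Y. c z * b z p) + c z * b z p) \<in> V"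
    by (intro lin_mem basis_mem) auto
  then show ?case using insert by (simp add: add.commute)
qed

lemma linear_form_zero:
  assumes "linear_form l" shows "l (\<lambda>p. 0) = 0"
  using assms[unfolded linear_form_def, rule_format, OF zero_mem zero_mem, of 1] by simp

lemma linear_form_comb:
  assumes l: "linear_form l"
  shows "finite Y \<Longrightarrow> Y \<subseteq> Z \<Longrightarrow> l (\<lambda>p. \<Sum>z\<in>Y. c z * b z p) = (\<Sum>z\<in>Y. c z * l (b z))"
proof (induction rule: finite_induct)
  case empty
  then show ?case using linear_form_zero[OF l] by simp
next
  case (insert z Y)
  then have "l (\<lambda>p. (\<Sum>z\<in>Y. c z * b z p) + c z * b z p) = l (\<lambda>p. \<Sum>z\<in>Y. c z * b z p) + c z * l (b z)"
    by (intro linear_formD[OF l] comb_mem basis_mem) auto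
  then show ?case using insert by (simp add: add.commute)
qed

lemma linear_form_expand:
  assumes l: "linear_form l" and f: "f \<in> V"
  shows "l f = (\<Sum>z\<in>Z. f z * l (b z))"
proof -
  have "l f = l (\<lambda>p. \<Sum>z\<in>Z. f z * b z p)" by (simp only: expand[OF f])
  then show ?thesis using linear_form_comb[OF l fin subset_refl] by simp
qed

lemma eq_if_eq_on_nodes:
  assumes "f \<in> V" "g \<in> V" "\<And>z. z \<in> Z \<Longrightarrow> f z = g z"
  shows "f = g"
proof -
  have "(\<lambda>p. \<Sum>z\<in>Z. f z * b z p) = (\<lambda>p. \<Sum>z\<in>Z. g z * b z p)"
    by (intro ext sum.cong) (auto simp: assms(3))
  then show ?thesis using expand assms(1,2) by simp
qed

lemma semi_innerD:
  assumes "semi_inner B"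
  shows "k \<in> V \<Longrightarrow> linear_form (\<lambda>f. B f k)" "k \<in> V \<Longrightarrow> linear_form (B k)"
    "f \<in> V \<Longrightarrow> g \<in> V \<Longrightarrow> B f g = B g f" "f \<in> V \<Longrightarrow> B f f \<ge> 0"
proof -
  show a: "linear_form (\<lambda>f. B f k)" if "k \<in> V" for k using assms that by (auto simp: semi_inner_def)
  show s: "B f g = B g f" if "f \<in> V" "g \<in> V" for f g using assms that by (auto simp: semi_inner_def)
  show "linear_form (B k)" if "k \<in> V" for k
    using a[OF that] s[OF that] unfolding linear_form_def by (simp add: lin_mem)
  show "B f f \<ge> 0" if "f \<in> V" for f using assms that by (auto simp: semi_inner_def)
qed

text \<open>The Cauchy-Schwarz inequality in the form of Young: expand the nonnegative squares of \<open>f + \<alpha> g\<close> and \<open>f - \<alpha> g\<close>.\<close>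

lemma semi_inner_weighted:
  assumes B: "semi_inner B" and f: "f \<in> V" and g: "g \<in> V" and al: "\<alpha> > 0"
  shows "\<bar>B f g\<bar> \<le> \<alpha> / 2 * B g g + B f f / (2 * \<alpha>)"
proof -
  have "0 \<le> B f f + 2 * c * B f g + c^2 * B g g" for c
  proof -
    have m: "(\<lambda>p. f p + c * g p) \<in> V" by (rule lin_mem[OF f g])
    have "0 \<le> B (\<lambda>p. f p + c * g p) (\<lambda>p. f p + c * g p)" by (rule semi_innerD(4)[OF B m])
    also have "\<dots> = B f (\<lambda>p. f p + c * g p) + c * B g (\<lambda>p. f p + c * g p)"
      by (rule linear_formD[OF semi_innerD(1)[OF B m] f g])
    also have "B f (\<lambda>p. f p + c * g p) = B f f + c * B f g"
      by (rule linear_formD[OF semi_innerD(2)[OF B f] f g])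
    also have "B g (\<lambda>p. f p + c * g p) = B g f + c * B g g"
      by (rule linear_formD[OF semi_innerD(2)[OF B g] f g])
    also have "B g f = B f g" by (rule semi_innerD(3)[OF B g f])
    finally show ?thesis by (simp add: algebra_simps power2_eq_square)
  qed
  from this[of \<alpha>] this[of "-\<alpha>"]
  have "2 * \<alpha> * \<bar>B f g\<bar> \<le> B f f + \<alpha>^2 * B g g" by (auto simp: abs_if)
  then show ?thesis using al by (simp add: field_simps power2_eq_square)
qed

lemma inner_form_unique:
  assumes B: "inner_form B" and f: "f \<in> V" and g: "g \<in> V" and eq: "\<And>k. k \<in> V \<Longrightarrow> B f k = B g k"
  shows "f = g"
proof -
  have s: "semi_inner B" using B by (simp add: inner_form_def)
  define d where "d = (\<lambda>p. f p + (-1) * g p)"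
  have d: "d \<in> V" unfolding d_def by (rule lin_mem[OF f g])
  have "B d d = B f d + (-1) * B g d"
    using linear_formD[OF semi_innerD(1)[OF s d] f g, of "-1"] by (simp only: d_def)
  then have "B d d = 0" using eq[OF d] by simp
  then have "\<forall>z\<in>Z. d z = 0" using B d by (auto simp: inner_form_def)
  then show ?thesis using f g by (intro eq_if_eq_on_nodes) (auto simp: d_def)
qed

lemma riesz:
  assumes B: "inner_form B" and l: "linear_form l"
  shows "\<exists>!\<phi>. \<phi> \<in> V \<and> (\<forall>\<eta>\<in>V. B \<phi> \<eta> = l \<eta>)"
proof -
  have s: "semi_inner B" using B by (simp add: inner_form_def)
  have BB: "B (\<lambda>p. \<Sum>z\<in>Z. u z * b z p) k = (\<Sum>j\<in>Z. u j * B (b j) k)" if "k \<in> V" for u k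
    by (rule linear_form_comb[OF semi_innerD(1)[OF s that] fin subset_refl])
  have "\<exists>u. \<forall>i\<in>Z. (\<Sum>j\<in>Z. B (b i) (b j) * u j) = l (b i)"
  proof (rule positive_definite_solvable[OF fin])
    fix u :: "'a \<Rightarrow> real" assume nz: "\<exists>z\<in>Z. u z \<noteq> 0"
    define f where "f = (\<lambda>p. \<Sum>z\<in>Z. u z * b z p)"
    have f: "f \<in> V" unfolding f_def by (rule comb_mem[OF fin subset_refl])
    have fz: "f z = u z" if "z \<in> Z" for z
    proof -
      have "f z = (\<Sum>w\<in>Z. if w = z then u w else 0)"
        unfolding f_def using that by (intro sum.cong) (auto simp: basis_kron)
      then show ?thesis using that fin by simp
    qed
    have "B f f \<noteq> 0" using B f nz fz by (auto simp: inner_form_def)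
    then have "B f f > 0" using semi_innerD(4)[OF s f] by simp
    also have "B f f = (\<Sum>i\<in>Z. u i * B (b i) f)" using BB[OF f, of u] by (simp add: f_def)
    also have "\<dots> = (\<Sum>i\<in>Z. u i * (\<Sum>j\<in>Z. B (b i) (b j) * u j))"
    proof (intro sum.cong refl arg_cong[where f = "(*) _"])
      fix i assume i: "i \<in> Z"
      have "B (b i) f = (\<Sum>j\<in>Z. u j * B (b i) (b j))"
        unfolding f_def by (rule linear_form_comb[OF semi_innerD(2)[OF s basis_mem[OF i]] fin subset_refl])
      then show "B (b i) f = (\<Sum>j\<in>Z. B (b i) (b j) * u j)" by (simp add: mult.commute)
    qed
    finally show "(\<Sum>i\<in>Z. u i * (\<Sum>j\<in>Z. B (b i) (b j) * u j)) > 0" .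
  qed
  then obtain u where u: "\<And>i. i \<in> Z \<Longrightarrow> (\<Sum>j\<in>Z. B (b i) (b j) * u j) = l (b i)" by blast
  define f where "f = (\<lambda>p. \<Sum>z\<in>Z. u z * b z p)"
  have f: "f \<in> V" unfolding f_def by (rule comb_mem[OF fin subset_refl])
  have Bf: "B f (b i) = l (b i)" if i: "i \<in> Z" for i
  proof -
    have "B f (b i) = (\<Sum>j\<in>Z. u j * B (b j) (b i))" unfolding f_def by (rule BB[OF basis_mem[OF i]])
    also have "\<dots> = (\<Sum>j\<in>Z. B (b i) (b j) * u j)"
      using semi_innerD(3)[OF s basis_mem basis_mem[OF i]] by (intro sum.cong refl) (simp add: mult.commute)
    finally show ?thesis using u[OF i] by simp
  qed
  have "B f k = l k" if "k \<in> V" for k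
    using linear_form_expand[OF semi_innerD(2)[OF s f] that] linear_form_expand[OF l that] Bf by simp
  then show ?thesis using f by (intro ex1I[of _ f]) (auto intro: inner_form_unique[OF B])
qed

end

section \<open>Gradient flows and perturbed eigenfunctions\<close>

text \<open>\<open>A\<close> is minus the gradient of half the energy \<open>a\<close> with respect to the inner product \<open>m\<close>, so
  \<open>op_exp A\<close> is the semigroup of the gradient flow.\<close>

locale gradient_flow = function_space +
  fixes A :: "('a \<Rightarrow> real) \<Rightarrow> ('a \<Rightarrow> real)" and m a :: "('a \<Rightarrow> real) \<Rightarrow> ('a \<Rightarrow> real) \<Rightarrow> real"
  assumes m: "inner_form m" and a: "semi_inner a"
    and A_mem: "f \<in> V \<Longrightarrow> A f \<in> V"
    and A_weak: "f \<in> V \<Longrightarrow> g \<in> V \<Longrightarrow> m (A f) g = - a f g"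
begin

lemma semi_inner_m: "semi_inner m" using m by (simp add: inner_form_def)

lemma A_linear:
  assumes f: "f \<in> V" and g: "g \<in> V"
  shows "A (\<lambda>p. f p + c * g p) = (\<lambda>p. A f p + c * A g p)"
proof (rule inner_form_unique[OF m])
  fix k assume k: "k \<in> V"
  have "m (A (\<lambda>p. f p + c * g p)) k = - (a f k + c * a g k)"
    using linear_formD[OF semi_innerD(1)[OF a k] f g] A_weak[OF lin_mem[OF f g] k] by simp
  moreover have "m (\<lambda>p. A f p + c * A g p) k = m (A f) k + c * m (A g) k"
    by (rule linear_formD[OF semi_innerD(1)[OF semi_inner_m k] A_mem[OF f] A_mem[OF g]])
  ultimately show "m (A (\<lambda>p. f p + c * g p)) k = m (\<lambda>p. A f p + c * A g p) k"
    using A_weak f g k by simp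
qed (intro A_mem lin_mem f g)+

lemma A_nodal: "f \<in> V \<Longrightarrow> A f p = (\<Sum>w\<in>Z. f w * A (b w) p)"
  by (rule linear_form_expand[of "\<lambda>f. A f p"]) (auto simp: linear_form_def A_linear)

lemma Apow_mem: "f \<in> V \<Longrightarrow> (A ^^ n) f \<in> V"
  by (induction n) (auto intro: A_mem)

definition growth :: real where "growth = (\<Sum>z\<in>Z. \<Sum>w\<in>Z. \<bar>A (b w) z\<bar>)"

text \<open>A bound for \<open>A\<close> in the \<open>l1\<close> norm of the nodal values; it makes the exponential series converge like that of
  a number.\<close>

lemma A_sum_bound:
  assumes f: "f \<in> V" shows "(\<Sum>z\<in>Z. \<bar>A f z\<bar>) \<le> growth * (\<Sum>w\<in>Z. \<bar>f w\<bar>)"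
proof -
  have "(\<Sum>z\<in>Z. \<bar>A f z\<bar>) \<le> (\<Sum>z\<in>Z. \<Sum>w\<in>Z. \<bar>f w\<bar> * \<bar>A (b w) z\<bar>)"
    unfolding A_nodal[OF f] by (intro sum_mono order.trans[OF sum_abs]) (simp add: abs_mult)
  also have "\<dots> \<le> (\<Sum>z\<in>Z. \<Sum>w\<in>Z. (\<Sum>v\<in>Z. \<bar>f v\<bar>) * \<bar>A (b w) z\<bar>)"
    by (intro sum_mono mult_right_mono member_le_sum fin) auto
  also have "\<dots> = growth * (\<Sum>w\<in>Z. \<bar>f w\<bar>)"
    by (simp add: growth_def sum_distrib_left sum_distrib_right mult.commute)
  finally show ?thesis .
qed

lemma Apow_bound:
  assumes f: "f \<in> V" and z: "z \<in> Z"
  shows "\<bar>(A ^^ n) f z\<bar> \<le> growth ^ n * (\<Sum>w\<in>Z. \<bar>f w\<bar>)"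
proof -
  have g0: "growth \<ge> 0" unfolding growth_def by (intro sum_nonneg) auto
  have "(\<Sum>z\<in>Z. \<bar>(A ^^ n) f z\<bar>) \<le> growth ^ n * (\<Sum>w\<in>Z. \<bar>f w\<bar>)"
  proof (induction n)
    case (Suc n)
    have "(\<Sum>z\<in>Z. \<bar>(A ^^ Suc n) f z\<bar>) \<le> growth * (\<Sum>z\<in>Z. \<bar>(A ^^ n) f z\<bar>)"
      using A_sum_bound[OF Apow_mem[OF f]] by simp
    also have "\<dots> \<le> growth * (growth ^ n * (\<Sum>w\<in>Z. \<bar>f w\<bar>))"
      by (intro mult_left_mono Suc g0)
    finally show ?case by (simp add: mult.assoc)
  qed simp
  moreover have "\<bar>(A ^^ n) f z\<bar> \<le> (\<Sum>z\<in>Z. \<bar>(A ^^ n) f z\<bar>)"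
    using z fin by (intro member_le_sum) auto
  ultimately show ?thesis by linarith
qed

lemma exp_summable_node:
  assumes f: "f \<in> V" and z: "z \<in> Z"
  shows "summable (\<lambda>n. (A ^^ n) f z / fact n * t ^ n)"
proof (rule summable_comparison_test', rule summable_mult)
  show "summable (\<lambda>n. (growth * \<bar>t\<bar>) ^ n / fact n)"
    using summable_exp_generic[of "growth * \<bar>t\<bar>"] by (simp add: field_simps)
  show "norm ((A ^^ n) f z / fact n * t ^ n) \<le> (\<Sum>w\<in>Z. \<bar>f w\<bar>) * ((growth * \<bar>t\<bar>) ^ n / fact n)" for n
    using mult_right_mono[OF Apow_bound[OF f z, of n], of "\<bar>t\<bar> ^ n / fact n"]
    by (simp add: abs_mult power_abs power_mult_distrib field_simps)
qed

lemma exp_sums: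
  assumes f: "f \<in> V"
  shows "(\<lambda>n. (A ^^ n) f p / fact n * t ^ n) sums (\<Sum>z\<in>Z. op_exp A t f z * b z p)"
proof -
  have "(\<lambda>n. \<Sum>z\<in>Z. (A ^^ n) f z / fact n * t ^ n * b z p) sums (\<Sum>z\<in>Z. op_exp A t f z * b z p)"
  proof (intro sums_sum sums_mult2)
    fix z assume z: "z \<in> Z"
    show "(\<lambda>n. (A ^^ n) f z / fact n * t ^ n) sums op_exp A t f z"
      using summable_sums[OF exp_summable_node[OF f z, of t]] by (simp add: op_exp_def mult.commute)
  qed
  moreover have "(\<Sum>z\<in>Z. (A ^^ n) f z / fact n * t ^ n * b z p) = (A ^^ n) f p / fact n * t ^ n" for n
  proof -
    have "(A ^^ n) f p = (\<Sum>z\<in>Z. (A ^^ n) f z * b z p)"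
      using expand[OF Apow_mem[OF f, of n]] by metis
    then show ?thesis by (simp add: sum_distrib_left sum_distrib_right sum_divide_distrib field_simps)
  qed
  ultimately show ?thesis by simp
qed

lemma exp_expand:
  assumes "f \<in> V" shows "op_exp A t f = (\<lambda>p. \<Sum>z\<in>Z. op_exp A t f z * b z p)"
proof
  fix p
  have "op_exp A t f p = (\<Sum>n. (A ^^ n) f p / fact n * t ^ n)" by (simp add: op_exp_def mult.commute)
  then show "op_exp A t f p = (\<Sum>z\<in>Z. op_exp A t f z * b z p)"
    using sums_unique[OF exp_sums[OF assms, of p t]] by simp
qed

lemma exp_mem: "f \<in> V \<Longrightarrow> op_exp A t f \<in> V"
  by (subst exp_expand) (simp_all add: comb_mem[OF fin subset_refl])

lemma exp_zero: "op_exp A 0 f = f"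
proof
  fix p
  have "(\<Sum>n. (A ^^ n) f p / fact n * 0 ^ n) = (A ^^ 0) f p / fact 0"
    by (rule powser_zero)
  then show "op_exp A 0 f p = f p" by (simp add: op_exp_def mult.commute)
qed

text \<open>On nodal values \<open>A\<close> is a finite matrix, so it may be applied termwise to the series.\<close>

lemma exp_commute:
  assumes f: "f \<in> V" shows "A (op_exp A t f) = op_exp A t (A f)"
proof (rule eq_if_eq_on_nodes)
  fix z assume z: "z \<in> Z"
  have "(\<lambda>n. \<Sum>w\<in>Z. (A ^^ n) f w / fact n * t ^ n * A (b w) z) sums (\<Sum>w\<in>Z. op_exp A t f w * A (b w) z)"
  proof (intro sums_sum sums_mult2)
    fix z assume z: "z \<in> Z"
    show "(\<lambda>n. (A ^^ n) f z / fact n * t ^ n) sums op_exp A t f z"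
      using summable_sums[OF exp_summable_node[OF f z, of t]] by (simp add: op_exp_def mult.commute)
  qed
  moreover have "(\<Sum>w\<in>Z. (A ^^ n) f w / fact n * t ^ n * A (b w) z) = (A ^^ n) (A f) z / fact n * t ^ n" for n
    using A_nodal[OF Apow_mem[OF f, of n], of z]
    by (simp add: funpow_swap1 sum_distrib_left sum_distrib_right sum_divide_distrib field_simps)
  ultimately show "A (op_exp A t f) z = op_exp A t (A f) z"
    using A_nodal[OF exp_mem[OF f]] by (simp add: sums_iff op_exp_def mult.commute)
qed (intro exp_mem A_mem f)+

lemma exp_deriv:
  assumes f: "f \<in> V" and z: "z \<in> Z"
  shows "((\<lambda>t. op_exp A t f z) has_real_derivative op_exp A t (A f) z) (at t)"
proof -
  have "((\<lambda>x. \<Sum>n. (A ^^ n) f z / fact n * x ^ n) has_field_derivative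
      (\<Sum>n. diffs (\<lambda>n. (A ^^ n) f z / fact n) n * t ^ n)) (at t)"
    by (rule termdiffs_strong_converges_everywhere[OF exp_summable_node[OF f z]])
  moreover have "diffs (\<lambda>n. (A ^^ n) f z / fact n) n = (A ^^ n) (A f) z / fact n" for n
    by (simp add: diffs_def funpow_swap1 field_simps del: of_nat_Suc)
  ultimately show ?thesis by (simp add: op_exp_def mult.commute)
qed

lemma exp_deriv_linear:
  assumes l: "linear_form l" and f: "f \<in> V"
  shows "((\<lambda>t. l (op_exp A t f)) has_real_derivative l (op_exp A t (A f))) (at t)"
  unfolding linear_form_expand[OF l exp_mem[OF f]] linear_form_expand[OF l exp_mem[OF A_mem[OF f]]]
  by (intro DERIV_sum DERIV_cmult_right exp_deriv f)

text \<open>Energy dissipation. It controls the time integral of \<open>m\<close> on the flow of \<open>A q\<close> by the initial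
  energy of \<open>q\<close>.\<close>

lemma exp_deriv_energy:
  assumes q: "q \<in> V"
  shows "((\<lambda>t. a (op_exp A t q) (op_exp A t q)) has_real_derivative
     - 2 * m (op_exp A t (A q)) (op_exp A t (A q))) (at t)"
proof -
  let ?y = "\<lambda>t. op_exp A t q" and ?u = "\<lambda>t. op_exp A t (A q)"
  have y: "?y t \<in> V" and u: "?u t \<in> V" for t by (auto intro: exp_mem A_mem q)
  have ex: "a (?y t) (?y t) = (\<Sum>z\<in>Z. ?y t z * a (b z) (?y t))" for t
    by (rule linear_form_expand[OF semi_innerD(1)[OF a y] y])
  have "((\<lambda>t. \<Sum>z\<in>Z. ?y t z * a (b z) (?y t)) has_real_derivative
     (\<Sum>z\<in>Z. ?u t z * a (b z) (?y t) + a (b z) (?u t) * ?y t z)) (at t)"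
    by (intro DERIV_sum DERIV_mult exp_deriv exp_deriv_linear semi_innerD(2)[OF a] basis_mem q)
  moreover have "(\<Sum>z\<in>Z. ?u t z * a (b z) (?y t) + a (b z) (?u t) * ?y t z) = a (?u t) (?y t) + a (?y t) (?u t)"
    using linear_form_expand[OF semi_innerD(1)[OF a y] u] linear_form_expand[OF semi_innerD(1)[OF a u] y]
    by (simp add: sum.distrib mult.commute)
  moreover have "a (?u t) (?y t) = a (?y t) (?u t)" by (rule semi_innerD(3)[OF a u y])
  moreover have "a (?y t) (?u t) = - m (?u t) (?u t)"
    using A_weak[OF y u, of t t] exp_commute[OF q] by simp
  ultimately show ?thesis unfolding ex by simp
qed

text \<open>If \<open>\<theta>\<close> were an eigenfunction, then \<open>exp (\<mu> s) * m (E(s) A q) \<theta>\<close> would be constant in \<open>s\<close>. In general its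
  derivative is \<open>exp (\<mu> s) * m \<rho> (E(s) A q)\<close>. Young's inequality splits this into a multiple of
  \<open>m \<rho> \<rho>\<close>, which is constant in time, and a multiple of \<open>m\<close> on the flow, which is the derivative of an
  energy by \<open>exp_deriv_energy\<close>.\<close>

lemma perturbed_eigenfunction:
  assumes q: "q \<in> V" and \<theta>: "\<theta> \<in> V" and \<rho>: "\<rho> \<in> V"
    and res: "\<And>\<eta>. \<eta> \<in> V \<Longrightarrow> m \<rho> \<eta> = - a \<theta> \<eta> + \<mu> * m \<theta> \<eta>"
    and al: "\<alpha> > 0" and t: "t \<ge> 0" and lam: "\<mu> \<ge> 0"
  shows "\<bar>exp (\<mu> * t) * m (op_exp A t (A q)) \<theta> - m (A q) \<theta>\<bar>
    \<le> exp (\<mu> * t) * (\<alpha> / 4 * a q q + t / (2 * \<alpha>) * m \<rho> \<rho>)"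
proof -
  let ?y = "\<lambda>t. op_exp A t q" and ?u = "\<lambda>t. op_exp A t (A q)"
  have y: "?y t \<in> V" and u: "?u t \<in> V" for t by (auto intro: exp_mem A_mem q)
  define G where "G = (\<lambda>s. exp (\<mu> * s) * m (?u s) \<theta>)"
  have G: "(G has_real_derivative exp (\<mu> * s) * m \<rho> (?u s)) (at s)" for s
  proof -
    have "((\<lambda>s. m (?u s) \<theta>) has_real_derivative m (op_exp A s (A (A q))) \<theta>) (at s)"
      by (rule exp_deriv_linear[OF semi_innerD(1)[OF semi_inner_m \<theta>] A_mem[OF q]])
    moreover have "m (op_exp A s (A (A q))) \<theta> = m \<rho> (?u s) - \<mu> * m (?u s) \<theta>"
    proof -
      have "m (op_exp A s (A (A q))) \<theta> = - a (?u s) \<theta>"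
        using A_weak[OF u \<theta>, of s] exp_commute[OF A_mem[OF q]] by simp
      then show ?thesis
        using res[OF u, of s] semi_innerD(3)[OF a u \<theta>, of s] semi_innerD(3)[OF semi_inner_m u \<theta>, of s] by simp
    qed
    ultimately show ?thesis
      unfolding G_def
      by (auto intro!: derivative_eq_intros simp: algebra_simps)
  qed
  have bound: "\<bar>exp (\<mu> * s) * m \<rho> (?u s)\<bar> \<le> exp (\<mu> * t) * (\<alpha> / 2 * m (?u s) (?u s) + m \<rho> \<rho> / (2 * \<alpha>))"
    if s: "0 \<le> s" "s \<le> t" for s
  proof -
    have "exp (\<mu> * s) \<le> exp (\<mu> * t)" using s lam by (simp add: mult_left_mono)
    moreover have "\<bar>m \<rho> (?u s)\<bar> \<le> \<alpha> / 2 * m (?u s) (?u s) + m \<rho> \<rho> / (2 * \<alpha>)"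
      by (rule semi_inner_weighted[OF semi_inner_m \<rho> u al])
    ultimately show ?thesis by (simp add: abs_mult mult_mono)
  qed
  \<comment> \<open>Monotonicity in time replaces integration: \<open>H 1\<close> and \<open>H (-1)\<close> are nonincreasing on \<open>[0, t]\<close>.\<close>
  define H where "H = (\<lambda>\<sigma> s. \<sigma> * G s + exp (\<mu> * t) * (\<alpha> / 4 * a (?y s) (?y s) - s / (2 * \<alpha>) * m \<rho> \<rho>))"
  have H: "\<sigma> * G t - \<sigma> * G 0 \<le> exp (\<mu> * t) * (\<alpha> / 4 * a q q + t / (2 * \<alpha>) * m \<rho> \<rho>)" if "\<bar>\<sigma>\<bar> = 1" for \<sigma>
  proof -
    have "(H \<sigma> has_real_derivative \<sigma> * (exp (\<mu> * s) * m \<rho> (?u s))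
        + exp (\<mu> * t) * (\<alpha> / 4 * (- 2 * m (?u s) (?u s)) - 1 / (2 * \<alpha>) * m \<rho> \<rho>)) (at s)" for s
      unfolding H_def
      by (intro DERIV_add DERIV_cmult DERIV_diff G exp_deriv_energy q DERIV_cmult_right DERIV_cdivide DERIV_ident)
    moreover have "\<sigma> * (exp (\<mu> * s) * m \<rho> (?u s))
        + exp (\<mu> * t) * (\<alpha> / 4 * (- 2 * m (?u s) (?u s)) - 1 / (2 * \<alpha>) * m \<rho> \<rho>) \<le> 0"
      if s: "0 \<le> s" "s \<le> t" for s
    proof -
      have "\<sigma> * (exp (\<mu> * s) * m \<rho> (?u s)) \<le> \<bar>\<sigma> * (exp (\<mu> * s) * m \<rho> (?u s))\<bar>" by simp
      also have "\<dots> = \<bar>exp (\<mu> * s) * m \<rho> (?u s)\<bar>" using \<open>\<bar>\<sigma>\<bar> = 1\<close> by (simp add: abs_mult)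
      also note bound[OF s]
      finally show ?thesis by (simp add: algebra_simps)
    qed
    ultimately have "H \<sigma> t \<le> H \<sigma> 0"
      by (intro DERIV_nonpos_imp_nonincreasing[OF t]) blast
    moreover have "exp (\<mu> * t) * (\<alpha> / 4 * a (?y t) (?y t)) \<ge> 0"
      using semi_innerD(4)[OF a y] al by simp
    ultimately show ?thesis by (simp add: H_def exp_zero algebra_simps)
  qed
  show ?thesis using H[of 1] H[of "-1"] by (simp add: G_def exp_zero abs_le_iff)
qed

end

section \<open>Integrals over the reference triangle\<close>

text \<open>Fubini and the fundamental theorem of calculus: \<open>G\<close> is an antiderivative of the integrand in the second
  variable and \<open>W\<close> one of the resulting inner integral.\<close>

lemma trapezoid_integral:
  fixes P :: "real \<Rightarrow> real \<Rightarrow> real"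
  assumes pq: "p \<le> q"
    and cl: "continuous_on UNIV l" and cu: "continuous_on UNIV u"
    and lu: "\<And>s. p \<le> s \<Longrightarrow> s \<le> q \<Longrightarrow> l s \<le> u s"
    and cP: "continuous_on UNIV (\<lambda>z. P (fst z) (snd z))"
    and G: "\<And>s r. ((\<lambda>r. G s r) has_real_derivative P s r) (at r)"
    and W: "\<And>s. (W has_real_derivative G s (u s) - G s (l s)) (at s)"
    and cw: "continuous_on UNIV (\<lambda>s. G s (u s) - G s (l s))"
  shows "has_bochner_integral lborel
    (\<lambda>z. if p \<le> fst z \<and> fst z \<le> q \<and> l (fst z) \<le> snd z \<and> snd z \<le> u (fst z)
         then P (fst z) (snd z) else 0) (W q - W p)"
proof -
  define D where "D = {z::real\<times>real. p \<le> fst z \<and> fst z \<le> q \<and> l (fst z) \<le> snd z \<and> snd z \<le> u (fst z)}"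
  have c1: "continuous_on UNIV (\<lambda>z::real\<times>real. l (fst z))" "continuous_on UNIV (\<lambda>z::real\<times>real. u (fst z))"
    by (auto intro!: continuous_on_compose2[OF cl] continuous_on_compose2[OF cu] continuous_intros)
  have "closed D"
    unfolding D_def by (intro closed_Collect_conj closed_Collect_le continuous_intros c1)
  moreover have "bounded D"
  proof -
    have "bounded (l ` {p..q})" "bounded (u ` {p..q})"
      by (auto intro!: compact_imp_bounded compact_continuous_image continuous_on_subset[OF cl] continuous_on_subset[OF cu])
    then obtain A B where A: "\<And>s. s \<in> {p..q} \<Longrightarrow> \<bar>l s\<bar> \<le> A" and B: "\<And>s. s \<in> {p..q} \<Longrightarrow> \<bar>u s\<bar> \<le> B"
      unfolding bounded_iff by (metis image_eqI real_norm_def)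
    have "D \<subseteq> {p..q} \<times> {-A..B}"
    proof
      fix z assume "z \<in> D"
      then show "z \<in> {p..q} \<times> {-A..B}"
        using A[of "fst z"] B[of "fst z"] by (cases z) (auto simp: D_def)
    qed
    then show ?thesis
      by (rule bounded_subset[rotated]) (intro bounded_Times bounded_closed_interval)
  qed
  ultimately have "compact D" by (simp add: compact_eq_bounded_closed)
  moreover have "(\<lambda>z. if z \<in> D then P (fst z) (snd z) else 0) = (\<lambda>z. indicator D z *\<^sub>R P (fst z) (snd z))"
    by (auto simp: fun_eq_iff)
  ultimately have int: "integrable lborel (\<lambda>z. if z \<in> D then P (fst z) (snd z) else 0)"
    using borel_integrable_compact[OF _ continuous_on_subset[OF cP subset_UNIV], of D] by simp
  have inner: "(\<integral>r. (if (s,r) \<in> D then P s r else 0) \<partial>lborel) = (G s (u s) - G s (l s)) * indicator {p..q} s" for s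
  proof (cases "s \<in> {p..q}")
    case True
    have cPs: "isCont (P s) r" for r
    proof -
      have "continuous_on UNIV (\<lambda>r. P s r)"
        using continuous_on_compose2[OF cP continuous_on_Pair[OF continuous_on_const continuous_on_id, of UNIV s]]
        by simp
      then show ?thesis by (simp add: continuous_on_eq_continuous_at)
    qed
    have "(\<integral>r. (if (s,r) \<in> D then P s r else 0) \<partial>lborel) = (\<integral>r. P s r * indicator {l s..u s} r \<partial>lborel)"
      using True by (intro Bochner_Integration.integral_cong) (auto simp: D_def indicator_def)
    also have "\<dots> = G s (u s) - G s (l s)"
      using True lu G cPs by (intro integral_FTC_Icc_real) auto
    finally show ?thesis using True by simp
  next
    case False
    then show ?thesis by (auto simp: D_def)
  qed
  have "integral\<^sup>L lborel (\<lambda>z. if z \<in> D then P (fst z) (snd z) else 0)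
      = integral\<^sup>L (lborel \<Otimes>\<^sub>M lborel) (\<lambda>z. if z \<in> D then P (fst z) (snd z) else 0)"
    by (simp add: lborel_prod)
  also have "\<dots> = (\<integral>s. (\<integral>r. (if (s,r) \<in> D then P s r else 0) \<partial>lborel) \<partial>lborel)"
    using int by (subst lborel_pair.integral_fst'[symmetric]) (simp_all add: lborel_prod cong: if_cong)
  also have "\<dots> = (\<integral>s. (G s (u s) - G s (l s)) * indicator {p..q} s \<partial>lborel)"
    by (simp add: inner)
  also have "\<dots> = W q - W p"
    using pq W cw by (intro integral_FTC_Icc_real) (auto simp: continuous_on_eq_continuous_at)
  finally show ?thesis using int by (simp add: has_bochner_integral_iff D_def)
qed

lemma AE_line:
  fixes a b c :: real
  assumes "a \<noteq> 0 \<or> b \<noteq> 0"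
  shows "AE z in lborel. a * fst z + b * snd z \<noteq> c"
proof -
  have "negligible {z. (a, b) \<bullet> z = c}"
    using assms by (intro negligible_hyperplane) (auto simp: zero_prod_def)
  then have "{z. (a, b) \<bullet> z = c} \<in> null_sets lebesgue"
    by (simp add: negligible_iff_null_sets)
  moreover have "{z. (a, b) \<bullet> z = c} \<in> sets borel"
    by (intro borel_closed closed_hyperplane)
  ultimately have "{z. (a, b) \<bullet> z = c} \<in> null_sets lborel"
    by (subst null_sets_completion_iff[symmetric]) auto
  then have "AE z in lborel. z \<notin> {z. (a, b) \<bullet> z = c}" by (rule AE_not_in)
  then show ?thesis by eventually_elim (auto simp: inner_prod_def)
qed

text \<open>Reflections (negative \<open>\<alpha>\<close> and \<open>\<beta>\<close>) are included because the upper triangle of a cell is a point reflection of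
  the lower one.\<close>

lemma affine_change:
  fixes H :: "real \<Rightarrow> real \<Rightarrow> real"
  assumes I: "has_bochner_integral lborel (\<lambda>z. H (fst z) (snd z)) I" and ab: "\<alpha> \<noteq> 0" "\<beta> \<noteq> 0"
  shows "has_bochner_integral lborel (\<lambda>z. H ((fst z - p) / \<alpha>) ((snd z - q) / \<beta>)) (\<bar>\<alpha> * \<beta>\<bar> * I)"
proof -
  define c :: "real \<times> real \<Rightarrow> real" where "c = (\<lambda>j. if j = (1,0) then \<alpha> else \<beta>)"
  define T :: "real \<times> real \<Rightarrow> real \<times> real" where "T = (\<lambda>z. (p + \<alpha> * fst z, q + \<beta> * snd z))"
  have B: "(Basis :: (real \<times> real) set) = {(1,0), (0,1)}"
    by (auto simp: Basis_prod_def)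
  have T: "T = (\<lambda>x. (p, q) + (\<Sum>j\<in>Basis. (c j * (x \<bullet> j)) *\<^sub>R j))"
    by (auto simp: T_def B c_def inner_prod_def fun_eq_iff)
  have "lborel = density (distr lborel borel T) (\<lambda>_. ennreal (\<Prod>j\<in>Basis. \<bar>c j\<bar>))"
    unfolding T by (rule lborel_affine_euclidean) (auto simp: B c_def ab)
  then have L: "lborel = density (distr lborel borel T) (\<lambda>_. ennreal \<bar>\<alpha> * \<beta>\<bar>)"
    by (simp add: B c_def abs_mult)
  have [measurable]: "T \<in> borel_measurable borel"
    unfolding T_def by (intro borel_measurable_continuous_onI continuous_intros)
  have [measurable]: "(\<lambda>z. H (fst z) (snd z)) \<in> borel_measurable borel"
    using I by (auto simp: has_bochner_integral_iff dest: borel_measurable_integrable)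
  have "(\<lambda>z. H (fst z) (snd z)) \<circ> (\<lambda>z. ((fst z - p) / \<alpha>, (snd z - q) / \<beta>)) \<in> borel_measurable borel"
    by (rule measurable_comp[of _ _ borel]) (auto intro!: borel_measurable_continuous_onI continuous_intros simp: ab)
  then have mS[measurable]: "(\<lambda>z. H ((fst z - p) / \<alpha>) ((snd z - q) / \<beta>)) \<in> borel_measurable borel"
    by (simp add: comp_def)
  have "has_bochner_integral (distr lborel borel T)
     (\<lambda>z. \<bar>\<alpha> * \<beta>\<bar> *\<^sub>R H ((fst z - p) / \<alpha>) ((snd z - q) / \<beta>)) (\<bar>\<alpha> * \<beta>\<bar> * I)"
  proof (rule has_bochner_integral_distr)
    show "has_bochner_integral lborel
      (\<lambda>x. \<bar>\<alpha> * \<beta>\<bar> *\<^sub>R H ((fst (T x) - p) / \<alpha>) ((snd (T x) - q) / \<beta>)) (\<bar>\<alpha> * \<beta>\<bar> * I)"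
      using has_bochner_integral_mult_right[OF I] ab by (simp add: T_def)
  qed auto
  then show ?thesis
    by (subst L, intro has_bochner_integral_density) (auto simp: measurable_distr_eq1)
qed

definition trapezoid :: "real \<Rightarrow> real \<Rightarrow> (real \<Rightarrow> real) \<Rightarrow> (real \<Rightarrow> real) \<Rightarrow> (real \<times> real) set" where
  "trapezoid p q l u = {z. p \<le> fst z \<and> fst z \<le> q \<and> l (fst z) \<le> snd z \<and> snd z \<le> u (fst z)}"

lemma affine_trapezoid_integral:
  fixes p q l0 l1 u0 u1 e0 e1 e2 :: real
  assumes pq: "p \<le> q"
    and lp: "l0 + l1 * p \<le> u0 + u1 * p" and lq: "l0 + l1 * q \<le> u0 + u1 * q"
  defines "W \<equiv> \<lambda>s. e0 * ((u0 - l0) * s + (u1 - l1) * s^2 / 2) + e1 * ((u0 - l0) * s^2 / 2 + (u1 - l1) * s^3 / 3)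
      + e2 / 2 * ((u0^2 - l0^2) * s + (u0 * u1 - l0 * l1) * s^2 + (u1^2 - l1^2) * s^3 / 3)"
  shows "has_bochner_integral lborel
    (\<lambda>z. if z \<in> trapezoid p q (\<lambda>s. l0 + l1 * s) (\<lambda>s. u0 + u1 * s) then e0 + e1 * fst z + e2 * snd z else 0)
    (W q - W p)"
  unfolding trapezoid_def mem_Collect_eq
proof (rule trapezoid_integral[where G = "\<lambda>s r. (e0 + e1 * s) * r + e2 * r^2 / 2"
      and P = "\<lambda>s r. e0 + e1 * s + e2 * r", OF pq])
  fix s assume s: "p \<le> s" "s \<le> q"
  show "l0 + l1 * s \<le> u0 + u1 * s"
  proof (cases "l1 \<le> u1")
    case True
    then have "(u1 - l1) * p \<le> (u1 - l1) * s" using s by (intro mult_left_mono) auto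
    then show ?thesis using lp by (simp add: algebra_simps)
  next
    case False
    then have "(l1 - u1) * s \<le> (l1 - u1) * q" using s by (intro mult_left_mono) auto
    then show ?thesis using lq by (simp add: algebra_simps)
  qed
next
  fix s :: real
  show "(W has_real_derivative (e0 + e1 * s) * (u0 + u1 * s) + e2 * (u0 + u1 * s)^2 / 2
      - ((e0 + e1 * s) * (l0 + l1 * s) + e2 * (l0 + l1 * s)^2 / 2)) (at s)"
    unfolding W_def
    by (rule derivative_eq_intros refl | simp)+ (simp add: field_simps power2_eq_square)
next
  fix s r :: real
  show "((\<lambda>r. (e0 + e1 * s) * r + e2 * r\<^sup>2 / 2) has_real_derivative e0 + e1 * s + e2 * r) (at r)"
    by (rule derivative_eq_intros refl | simp)+
qed (auto intro!: continuous_intros)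

text \<open>Extension by zero from the open reference triangle with corners \<open>(0,0)\<close>, \<open>(1,0)\<close> and \<open>(0,1)\<close>.\<close>

definition on_ref :: "(real \<Rightarrow> real \<Rightarrow> real) \<Rightarrow> real \<times> real \<Rightarrow> real" where
  "on_ref H z = (if 0 < fst z \<and> 0 < snd z \<and> fst z + snd z < 1 then H (fst z) (snd z) else 0)"

lemma borel_measurable_on_ref:
  assumes [measurable]: "(\<lambda>z. H (fst z) (snd z)) \<in> borel_measurable borel"
  shows "on_ref H \<in> borel_measurable borel"
proof -
  have [measurable]: "{z::real\<times>real. 0 < fst z \<and> 0 < snd z \<and> fst z + snd z < 1} \<in> sets borel"
    by (intro borel_open open_Collect_conj open_Collect_less continuous_intros)
  have "on_ref H = (\<lambda>z. indicator {z::real\<times>real. 0 < fst z \<and> 0 < snd z \<and> fst z + snd z < 1} z * H (fst z) (snd z))"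
    by (auto simp: on_ref_def fun_eq_iff)
  also have "\<dots> \<in> borel_measurable borel" by measurable
  finally show ?thesis .
qed

text \<open>The excluded lines carry all edges and all cuts by which the reference triangle is divided into trapezoids below.\<close>

lemma AE_generic_point:
  "AE z::real\<times>real in lborel. fst z \<noteq> 0 \<and> snd z \<noteq> 0 \<and> fst z + snd z \<noteq> 1 \<and> fst z \<noteq> 1/3 \<and> fst z \<noteq> 1/2 \<and>
     2 * fst z + snd z \<noteq> 1 \<and> fst z + 2 * snd z \<noteq> 1 \<and> fst z \<noteq> snd z"
  using AE_line[of 1 0 0] AE_line[of 0 1 0] AE_line[of 1 1 1] AE_line[of 1 0 "1/3"] AE_line[of 1 0 "1/2"]
    AE_line[of 2 1 1] AE_line[of 1 2 1] AE_line[of 1 "-1" 0]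
  by simp

text \<open>Both factors are affine with prescribed corner values; the value is the mass matrix of the reference triangle.\<close>

lemma ref_mass:
  "has_bochner_integral lborel
    (on_ref (\<lambda>s r. (c0 + s * (c1 - c0) + r * (c2 - c0)) * (d0 + s * (d1 - d0) + r * (d2 - d0))))
    ((2 * c0 * d0 + 2 * c1 * d1 + 2 * c2 * d2 + c0 * d1 + c1 * d0 + c0 * d2 + c2 * d0 + c1 * d2 + c2 * d1) / 24)"
proof -
  define a0 a1 a2 where "a0 = c0 * d0" and "a1 = c0 * (d1 - d0) + (c1 - c0) * d0" and "a2 = (c1 - c0) * (d1 - d0)"
  define b0 b1 where "b0 = c0 * (d2 - d0) + (c2 - c0) * d0" and "b1 = (c1 - c0) * (d2 - d0) + (c2 - c0) * (d1 - d0)"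
  define C where "C = (c2 - c0) * (d2 - d0)"
  note defs = a0_def a1_def a2_def b0_def b1_def C_def
  define W where "W = (\<lambda>s. a0 * s + (a1 - a0) * s^2 / 2 + (a2 - a1) * s^3 / 3 - a2 * s^4 / 4
    + (b0 * s + (b1 - 2 * b0) * s^2 / 2 + (b0 - 2 * b1) * s^3 / 3 + b1 * s^4 / 4) / 2
    + C * (s - 3 * s^2 / 2 + s^3 - s^4 / 4) / 3)"
  have "has_bochner_integral lborel
    (\<lambda>z. if 0 \<le> fst z \<and> fst z \<le> 1 \<and> 0 \<le> snd z \<and> snd z \<le> 1 - fst z
       then a0 + a1 * fst z + a2 * (fst z)^2 + (b0 + b1 * fst z) * snd z + C * (snd z)^2 else 0)
    (W 1 - W 0)"
  proof (rule trapezoid_integral[where G = "\<lambda>s r. (a0 + a1 * s + a2 * s^2) * r + (b0 + b1 * s) * r^2 / 2 + C * r^3 / 3"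
      and P = "\<lambda>s r. a0 + a1 * s + a2 * s^2 + (b0 + b1 * s) * r + C * r^2"])
    fix s r :: real
    show "((\<lambda>r. (a0 + a1 * s + a2 * s^2) * r + (b0 + b1 * s) * r^2 / 2 + C * r^3 / 3) has_real_derivative
      a0 + a1 * s + a2 * s^2 + (b0 + b1 * s) * r + C * r^2) (at r)"
      by (rule derivative_eq_intros refl | simp)+
    show "(W has_real_derivative (a0 + a1 * s + a2 * s^2) * (1 - s) + (b0 + b1 * s) * (1 - s)^2 / 2 + C * (1 - s)^3 / 3
       - ((a0 + a1 * s + a2 * s^2) * 0 + (b0 + b1 * s) * 0^2 / 2 + C * 0^3 / 3)) (at s)"
      unfolding W_def
      by (rule derivative_eq_intros refl | simp)+
         (simp add: field_simps power2_eq_square power3_eq_cube power4_eq_xxxx)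
  qed (auto intro!: continuous_intros)
  moreover have "W 1 - W 0 = (2 * c0 * d0 + 2 * c1 * d1 + 2 * c2 * d2 + c0 * d1 + c1 * d0 + c0 * d2 + c2 * d0 + c1 * d2 + c2 * d1) / 24"
    by (simp add: W_def defs field_simps)
  ultimately have I: "has_bochner_integral lborel
    (\<lambda>z. if 0 \<le> fst z \<and> fst z \<le> 1 \<and> 0 \<le> snd z \<and> snd z \<le> 1 - fst z
       then a0 + a1 * fst z + a2 * (fst z)^2 + (b0 + b1 * fst z) * snd z + C * (snd z)^2 else 0)
    ((2 * c0 * d0 + 2 * c1 * d1 + 2 * c2 * d2 + c0 * d1 + c1 * d0 + c0 * d2 + c2 * d0 + c1 * d2 + c2 * d1) / 24)"
    by simp
  have P: "(c0 + s * (c1 - c0) + r * (c2 - c0)) * (d0 + s * (d1 - d0) + r * (d2 - d0))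
      = a0 + a1 * s + a2 * s^2 + (b0 + b1 * s) * r + C * r^2" for s r
    by (simp add: defs algebra_simps power2_eq_square)
  have m: "on_ref (\<lambda>s r. a0 + a1 * s + a2 * s^2 + (b0 + b1 * s) * r + C * r^2) \<in> borel_measurable lborel"
    unfolding measurable_lborel2
    by (intro borel_measurable_on_ref borel_measurable_continuous_onI continuous_intros)
  have "AE z in lborel. (if 0 \<le> fst z \<and> fst z \<le> 1 \<and> 0 \<le> snd z \<and> snd z \<le> 1 - fst z
       then a0 + a1 * fst z + a2 * (fst z)^2 + (b0 + b1 * fst z) * snd z + C * (snd z)^2 else 0) =
     on_ref (\<lambda>s r. a0 + a1 * s + a2 * s^2 + (b0 + b1 * s) * r + C * r^2) z"
    using AE_generic_point by eventually_elim (auto simp: on_ref_def)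
  from has_bochner_integral_cong_AE[THEN iffD1, OF _ m this I] show ?thesis
    unfolding P using I by (auto simp: has_bochner_integral_iff)
qed

lemma ref_const: "has_bochner_integral lborel (on_ref (\<lambda>s r. g)) (g / 2)"
  using ref_mass[of g g g 1 1 1] by (simp add: field_simps)

text \<open>The lumped function on the reference triangle with corner values \<open>d0\<close>, \<open>d1\<close>, \<open>d2\<close>. The quadrilateral of a
  corner is where its barycentric coordinate is the largest of the three coordinates \<open>1 - s - r\<close>, \<open>s\<close>, \<open>r\<close>.\<close>

definition quad_weight :: "real \<Rightarrow> real \<Rightarrow> real \<Rightarrow> real \<Rightarrow> real \<Rightarrow> real" where
  "quad_weight d0 d1 d2 s r = d0 * of_bool (2 * s + r \<le> 1 \<and> s + 2 * r \<le> 1)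
     + d1 * of_bool (r \<le> s \<and> 1 \<le> 2 * s + r) + d2 * of_bool (s \<le> r \<and> 1 \<le> s + 2 * r)"

text \<open>Each of the three quadrilaterals is a union of two trapezoids; the cuts are at the abscissa \<open>1/3\<close> of the barycenter
  and the abscissa \<open>1/2\<close> of the midpoints. The resulting matrix is symmetric, which is why \<open>lumped_inner\<close> is
  an inner product.\<close>

lemma ref_lump:
  "has_bochner_integral lborel
    (on_ref (\<lambda>s r. (c0 + s * (c1 - c0) + r * (c2 - c0)) * quad_weight d0 d1 d2 s r))
    ((d0 * (22 * c0 + 7 * c1 + 7 * c2) + d1 * (7 * c0 + 22 * c1 + 7 * c2) + d2 * (7 * c0 + 7 * c1 + 22 * c2)) / 216)"
proof -
  define T where "T = (\<lambda>p q l0 l1 u0 u1 z. if z \<in> trapezoid p q (\<lambda>s. l0 + l1 * s) (\<lambda>s. u0 + u1 * s)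
    then c0 + (c1 - c0) * fst z + (c2 - c0) * snd z else 0)"
  define S where "S = (\<lambda>z. d0 * (T 0 (1/3) 0 0 (1/2) (-1/2) z + T (1/3) (1/2) 0 0 1 (-2) z)
      + d1 * (T (1/3) (1/2) 1 (-2) 0 1 z + T (1/2) 1 0 0 1 (-1) z)
      + d2 * (T 0 (1/3) (1/2) (-1/2) 1 (-1) z + T (1/3) (1/2) 0 1 1 (-1) z))"
  define V where "V = (\<lambda>p q l0 l1 u0 u1.
      c0 * ((u0 - l0) * (q - p) + (u1 - l1) * (q^2 - p^2) / 2)
      + (c1 - c0) * ((u0 - l0) * (q^2 - p^2) / 2 + (u1 - l1) * (q^3 - p^3) / 3)
      + (c2 - c0) / 2 * ((u0^2 - l0^2) * (q - p) + (u0 * u1 - l0 * l1) * (q^2 - p^2) + (u1^2 - l1^2) * (q^3 - p^3) / 3))"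
  have aff: "has_bochner_integral lborel (T p q l0 l1 u0 u1) (V p q l0 l1 u0 u1)"
    if "p \<le> q" "l0 + l1 * p \<le> u0 + u1 * p" "l0 + l1 * q \<le> u0 + u1 * q" for p q l0 l1 u0 u1
    using affine_trapezoid_integral[OF that, of c0 "c1 - c0" "c2 - c0"]
    unfolding T_def V_def
    by (rule back_subst[where P = "has_bochner_integral lborel _"]) (simp add: field_simps)
  have v0: "(22 * c0 + 7 * c1 + 7 * c2) / 216 = V 0 (1/3) 0 0 (1/2) (-1/2) + V (1/3) (1/2) 0 0 1 (-2)"
    by (simp add: V_def power2_eq_square power3_eq_cube) (simp add: field_simps)
  have v1: "(7 * c0 + 22 * c1 + 7 * c2) / 216 = V (1/3) (1/2) 1 (-2) 0 1 + V (1/2) 1 0 0 1 (-1)"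
    by (simp add: V_def power2_eq_square power3_eq_cube) (simp add: field_simps)
  have v2: "(7 * c0 + 7 * c1 + 22 * c2) / 216 = V 0 (1/3) (1/2) (-1/2) 1 (-1) + V (1/3) (1/2) 0 1 1 (-1)"
    by (simp add: V_def power2_eq_square power3_eq_cube) (simp add: field_simps)
  have Q0: "has_bochner_integral lborel (\<lambda>z. T 0 (1/3) 0 0 (1/2) (-1/2) z + T (1/3) (1/2) 0 0 1 (-2) z)
     ((22 * c0 + 7 * c1 + 7 * c2) / 216)"
    unfolding v0 by (intro has_bochner_integral_add aff) auto
  have Q1: "has_bochner_integral lborel (\<lambda>z. T (1/3) (1/2) 1 (-2) 0 1 z + T (1/2) 1 0 0 1 (-1) z)
     ((7 * c0 + 22 * c1 + 7 * c2) / 216)"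
    unfolding v1 by (intro has_bochner_integral_add aff) auto
  have Q2: "has_bochner_integral lborel (\<lambda>z. T 0 (1/3) (1/2) (-1/2) 1 (-1) z + T (1/3) (1/2) 0 1 1 (-1) z)
     ((7 * c0 + 7 * c1 + 22 * c2) / 216)"
    unfolding v2 by (intro has_bochner_integral_add aff) auto
  have I: "has_bochner_integral lborel S
    ((d0 * (22 * c0 + 7 * c1 + 7 * c2) + d1 * (7 * c0 + 22 * c1 + 7 * c2) + d2 * (7 * c0 + 7 * c1 + 22 * c2)) / 216)"
    unfolding S_def
    using has_bochner_integral_add[OF has_bochner_integral_add[OF
        has_bochner_integral_mult_right[OF Q0, of d0] has_bochner_integral_mult_right[OF Q1, of d1]]
        has_bochner_integral_mult_right[OF Q2, of d2]]
    by (rule back_subst[where P = "has_bochner_integral lborel _"]) (simp add: field_simps)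
  have m: "on_ref (\<lambda>s r. (c0 + s * (c1 - c0) + r * (c2 - c0)) * quad_weight d0 d1 d2 s r) \<in> borel_measurable lborel"
    unfolding measurable_lborel2
  proof (intro borel_measurable_on_ref borel_measurable_times)
    have [measurable]: "{z::real\<times>real. 2 * fst z + snd z \<le> 1 \<and> fst z + 2 * snd z \<le> 1} \<in> sets borel"
      "{z::real\<times>real. snd z \<le> fst z \<and> 1 \<le> 2 * fst z + snd z} \<in> sets borel"
      "{z::real\<times>real. fst z \<le> snd z \<and> 1 \<le> fst z + 2 * snd z} \<in> sets borel"
      by (intro borel_closed closed_Collect_conj closed_Collect_le continuous_intros)+
    have "(\<lambda>z::real\<times>real. quad_weight d0 d1 d2 (fst z) (snd z)) = (\<lambda>z.
      d0 * indicator {z::real\<times>real. 2 * fst z + snd z \<le> 1 \<and> fst z + 2 * snd z \<le> 1} z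
      + d1 * indicator {z::real\<times>real. snd z \<le> fst z \<and> 1 \<le> 2 * fst z + snd z} z
      + d2 * indicator {z::real\<times>real. fst z \<le> snd z \<and> 1 \<le> fst z + 2 * snd z} z)"
      by (auto simp: quad_weight_def fun_eq_iff)
    also have "\<dots> \<in> borel_measurable borel" by measurable
    finally show "(\<lambda>z::real\<times>real. quad_weight d0 d1 d2 (fst z) (snd z)) \<in> borel_measurable borel" .
  qed (intro borel_measurable_continuous_onI continuous_intros)
  have "AE z in lborel. S z = on_ref (\<lambda>s r. (c0 + s * (c1 - c0) + r * (c2 - c0)) * quad_weight d0 d1 d2 s r) z"
    using AE_generic_point
  proof eventually_elim
    case (elim z)
    obtain s r where z: "z = (s, r)" by (cases z)
    define v where "v = c0 + s * (c1 - c0) + r * (c2 - c0)"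
    have T: "T p q l0 l1 u0 u1 z = v * of_bool (p \<le> s \<and> s \<le> q \<and> l0 + l1 * s \<le> r \<and> r \<le> u0 + u1 * s)" for p q l0 l1 u0 u1
      by (auto simp: T_def trapezoid_def z v_def algebra_simps)
    have ne: "s \<noteq> 0" "r \<noteq> 0" "s + r \<noteq> 1" "s \<noteq> 1/3" "s \<noteq> 1/2" "2 * s + r \<noteq> 1" "s + 2 * r \<noteq> 1" "s \<noteq> r"
      using elim by (auto simp: z)
    \<comment> \<open>Off the excluded lines exactly the stated pair of trapezoids covers each quadrilateral.\<close>
    have e0: "of_bool (0 \<le> s \<and> s \<le> 1/3 \<and> 0 + 0 * s \<le> r \<and> r \<le> 1/2 + -1/2 * s)
        + of_bool (1/3 \<le> s \<and> s \<le> 1/2 \<and> 0 + 0 * s \<le> r \<and> r \<le> 1 + -2 * s)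
        = (of_bool (0 < s \<and> 0 < r \<and> s + r < 1 \<and> 2 * s + r \<le> 1 \<and> s + 2 * r \<le> 1) :: real)"
      using ne(1,2,4) by (auto split: split_of_bool)
    have e1: "of_bool (1/3 \<le> s \<and> s \<le> 1/2 \<and> 1 + -2 * s \<le> r \<and> r \<le> 0 + 1 * s)
        + of_bool (1/2 \<le> s \<and> s \<le> 1 \<and> 0 + 0 * s \<le> r \<and> r \<le> 1 + -1 * s)
        = (of_bool (0 < s \<and> 0 < r \<and> s + r < 1 \<and> r \<le> s \<and> 1 \<le> 2 * s + r) :: real)"
      using ne(2,3,5) by (auto split: split_of_bool)
    have e2: "of_bool (0 \<le> s \<and> s \<le> 1/3 \<and> 1/2 + -1/2 * s \<le> r \<and> r \<le> 1 + -1 * s)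
        + of_bool (1/3 \<le> s \<and> s \<le> 1/2 \<and> 0 + 1 * s \<le> r \<and> r \<le> 1 + -1 * s)
        = (of_bool (0 < s \<and> 0 < r \<and> s + r < 1 \<and> s \<le> r \<and> 1 \<le> s + 2 * r) :: real)"
      using ne(1,3,4) by (auto split: split_of_bool)
    have "S z = v * (d0 * of_bool (0 < s \<and> 0 < r \<and> s + r < 1 \<and> 2 * s + r \<le> 1 \<and> s + 2 * r \<le> 1)
      + d1 * of_bool (0 < s \<and> 0 < r \<and> s + r < 1 \<and> r \<le> s \<and> 1 \<le> 2 * s + r)
      + d2 * of_bool (0 < s \<and> 0 < r \<and> s + r < 1 \<and> s \<le> r \<and> 1 \<le> s + 2 * r))"
      unfolding S_def T e0[symmetric] e1[symmetric] e2[symmetric] by (simp only: algebra_simps)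
    also have "\<dots> = on_ref (\<lambda>s r. (c0 + s * (c1 - c0) + r * (c2 - c0)) * quad_weight d0 d1 d2 s r) z"
      by (cases "0 < s \<and> 0 < r \<and> s + r < 1") (auto simp: on_ref_def z quad_weight_def v_def)
    finally show ?case .
  qed
  from has_bochner_integral_cong_AE[THEN iffD1, OF _ m this I] show ?thesis
    using I by (auto simp: has_bochner_integral_iff)
qed

section \<open>Geometry of the mesh\<close>

text \<open>The continuous piecewise linear coordinate whose value at the mesh line \<open>x = x_j\<close> is \<open>j\<close>. In the
  coordinates \<open>idx_x\<close> and \<open>idx_y\<close> the mesh is uniform, so combinatorial facts need no case distinction at
  \<open>x = 1/4\<close>.\<close>

definition idx_x :: "nat \<Rightarrow> real \<Rightarrow> real" where
  "idx_x J x = 4 * real J * x + max 0 (4 * real J * x - real J)"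

definition idx_y :: "nat \<Rightarrow> real \<Rightarrow> real" where
  "idx_y J y = 4 * real J * y"

definition cell_width :: "nat \<Rightarrow> nat \<Rightarrow> real" where
  "cell_width J j = mesh_x J (Suc j) - mesh_x J j"

text \<open>The index \<open>(j, m, up)\<close> stands for the lower (\<open>\<not> up\<close>) or upper (\<open>up\<close>) triangle of the cell \<open>(j, m)\<close>.\<close>

definition triangles :: "nat \<Rightarrow> (nat \<times> nat \<times> bool) set" where
  "triangles J = {..<7 * J} \<times> {..<4 * J} \<times> UNIV"

text \<open>The vertex at the right angle. The legs below are signed lengths from this vertex, so that lower and upper triangles
  have the same parametrization \<open>tri_pt\<close>.\<close>

fun tri_corner :: "nat \<Rightarrow> nat \<times> nat \<times> bool \<Rightarrow> real \<times> real" where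
  "tri_corner J (j, m, up) = (if up then mesh_pt J (Suc j) (Suc m) else mesh_pt J j m)"

fun leg_x :: "nat \<Rightarrow> nat \<times> nat \<times> bool \<Rightarrow> real" where
  "leg_x J (j, m, up) = (if up then - cell_width J j else cell_width J j)"

fun leg_y :: "nat \<Rightarrow> nat \<times> nat \<times> bool \<Rightarrow> real" where
  "leg_y J (j, m, up) = (if up then - mesh_size J else mesh_size J)"

definition tri_pt :: "nat \<Rightarrow> nat \<times> nat \<times> bool \<Rightarrow> real \<Rightarrow> real \<Rightarrow> real \<times> real" where
  "tri_pt J k s r = (fst (tri_corner J k) + leg_x J k * s, snd (tri_corner J k) + leg_y J k * r)"

text \<open>Mesh indices of the three vertices in the order: right angle, end of the horizontal leg, end of the
  vertical leg.\<close>

fun corner_index :: "nat \<Rightarrow> nat \<times> nat \<times> bool \<Rightarrow> nat \<times> nat" where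
  "corner_index v (j, m, up) =
     (if v = 0 then (if up then (Suc j, Suc m) else (j, m))
      else if v = 1 then (if up then (j, Suc m) else (Suc j, m))
      else (if up then (Suc j, m) else (j, Suc m)))"

definition tri_verts :: "nat \<Rightarrow> nat \<times> nat \<times> bool \<Rightarrow> (real \<times> real) set" where
  "tri_verts J k = {tri_pt J k 0 0, tri_pt J k 1 0, tri_pt J k 0 1}"

lemma finite_triangles: "finite (triangles J)" by (simp add: triangles_def)

locale mesh =
  fixes J :: nat
  assumes J_pos: "J > 0"
begin

lemma real_J_pos: "real J > 0" using J_pos by simp

lemma h_pos: "mesh_size J > 0" using real_J_pos by (simp add: mesh_size_def)

lemma cell_width: "cell_width J j = (if j < J then mesh_size J else mesh_size J / 2)"
  using real_J_pos by (auto simp: cell_width_def mesh_x_def mesh_size_def field_simps)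

lemma cell_width_pos: "cell_width J j > 0" using h_pos by (simp add: cell_width)

lemma idx_x_cell:
  assumes "0 \<le> s" "s \<le> 1"
  shows "idx_x J (mesh_x J j + cell_width J j * s) = real j + s"
proof (cases "j < J")
  case True
  have "4 * real J * (mesh_x J j + cell_width J j * s) = real j + s"
    using True real_J_pos by (simp add: mesh_x_def cell_width mesh_size_def field_simps)
  moreover have "real j + s \<le> real J" using True assms by linarith
  ultimately show ?thesis by (simp add: idx_x_def)
next
  case False
  have e: "mesh_x J j = 1/4 + (real j - real J) * mesh_size J / 2"
    using False real_J_pos by (auto simp: mesh_x_def mesh_size_def field_simps)
  have "4 * real J * (mesh_x J j + cell_width J j * s) = real J + (real j - real J + s) / 2"
    using False real_J_pos by (simp add: e cell_width mesh_size_def field_simps)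
  moreover have "real j \<ge> real J" using False by simp
  ultimately show ?thesis using assms by (simp add: idx_x_def max_def field_simps)
qed

lemma idx_x_mesh: "idx_x J (mesh_x J j) = real j"
  using idx_x_cell[of 0 j] by simp

lemma idx_y_cell: "idx_y J (mesh_y J m + mesh_size J * r) = real m + r"
  using real_J_pos by (simp add: idx_y_def mesh_y_def mesh_size_def field_simps)

lemma idx_y_mesh: "idx_y J (mesh_y J m) = real m"
  using idx_y_cell[of m 0] by simp

lemma idx_x_strict: "x < y \<Longrightarrow> idx_x J x < idx_x J y"
proof -
  assume "x < y"
  then have "4 * real J * x < 4 * real J * y" using real_J_pos by simp
  then show ?thesis unfolding idx_x_def by (intro add_less_le_mono max.mono) auto
qed

lemma idx_x_less: "idx_x J x < idx_x J y \<longleftrightarrow> x < y"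
  using idx_x_strict by (metis less_asym' linorder_neqE_linordered_idom order_less_irrefl)

lemma idx_x_eq: "idx_x J x = idx_x J y \<longleftrightarrow> x = y"
  using idx_x_less by (metis less_irrefl linorder_neqE_linordered_idom)

lemma idx_x_le: "idx_x J x \<le> idx_x J y \<longleftrightarrow> x \<le> y"
  using idx_x_less by (metis not_le)

lemma idx_y_less: "idx_y J x < idx_y J y \<longleftrightarrow> x < y" using real_J_pos by (simp add: idx_y_def)
lemma idx_y_le: "idx_y J x \<le> idx_y J y \<longleftrightarrow> x \<le> y" using real_J_pos by (simp add: idx_y_def)
lemma idx_y_eq: "idx_y J x = idx_y J y \<longleftrightarrow> x = y" using real_J_pos by (simp add: idx_y_def)

lemma idx_eqI:
  "idx_x J (fst z) = idx_x J (fst w) \<Longrightarrow> idx_y J (snd z) = idx_y J (snd w) \<Longrightarrow> z = w"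
  using idx_x_eq idx_y_eq by (simp add: prod_eq_iff)

lemma idx_ends: "idx_x J 0 = 0" "idx_x J 1 = real (7 * J)" "idx_y J 0 = 0" "idx_y J 1 = real (4 * J)"
  using real_J_pos by (auto simp: idx_x_def idx_y_def)

lemma mesh_pt_inj: "mesh_pt J j m = mesh_pt J j' m' \<longleftrightarrow> j = j' \<and> m = m'"
  unfolding mesh_pt_def prod.inject
  by (metis idx_x_mesh idx_y_mesh of_nat_eq_iff)

lemma idx_tri_pt:
  assumes "0 \<le> s" "s \<le> 1"
  shows "idx_x J (fst (tri_pt J (j, m, up) s r)) = (if up then real (Suc j) - s else real j + s)"
    "idx_y J (snd (tri_pt J (j, m, up) s r)) = (if up then real (Suc m) - r else real m + r)"
proof -
  have "mesh_x J (Suc j) - cell_width J j * s = mesh_x J j + cell_width J j * (1 - s)"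
    by (simp add: cell_width_def algebra_simps)
  then show "idx_x J (fst (tri_pt J (j, m, up) s r)) = (if up then real (Suc j) - s else real j + s)"
    using idx_x_cell[of s j] idx_x_cell[of "1 - s" j] assms by (simp add: tri_pt_def mesh_pt_def)
  have "mesh_y J (Suc m) - mesh_size J * r = mesh_y J m + mesh_size J * (1 - r)"
    by (simp add: mesh_y_def algebra_simps)
  then show "idx_y J (snd (tri_pt J (j, m, up) s r)) = (if up then real (Suc m) - r else real m + r)"
    using idx_y_cell[of m r] idx_y_cell[of m "1 - r"] by (simp add: tri_pt_def mesh_pt_def)
qed

lemma tri_pt_vertex:
  "tri_pt J k 0 0 = mesh_pt J (fst (corner_index 0 k)) (snd (corner_index 0 k))"
  "tri_pt J k 1 0 = mesh_pt J (fst (corner_index 1 k)) (snd (corner_index 1 k))"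
  "tri_pt J k 0 1 = mesh_pt J (fst (corner_index 2 k)) (snd (corner_index 2 k))"
  by (cases k; simp add: tri_pt_def mesh_pt_def cell_width_def mesh_y_def algebra_simps)+

lemma triangulation_eq: "triangulation J = tri_verts J ` triangles J"
proof -
  have low: "{mesh_pt J j m, mesh_pt J (j + 1) m, mesh_pt J j (m + 1)} = tri_verts J (j, m, False)" for j m
    by (simp add: tri_verts_def tri_pt_vertex)
  have up: "{mesh_pt J (j + 1) (m + 1), mesh_pt J (j + 1) m, mesh_pt J j (m + 1)} = tri_verts J (j, m, True)" for j m
    by (simp add: tri_verts_def tri_pt_vertex insert_commute)
  have UB: "(UNIV::bool set) = {False, True}" by auto
  show ?thesis unfolding triangulation_def low up triangles_def UB by (fastforce simp: image_iff)
qed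

lemma legs_nonzero: "leg_x J k \<noteq> 0" "leg_y J k \<noteq> 0"
  using cell_width_pos h_pos by (cases k; simp add: less_imp_neq[symmetric])+

lemma tri_verts_distinct: "tri_pt J k 0 0 \<noteq> tri_pt J k 1 0" "tri_pt J k 0 0 \<noteq> tri_pt J k 0 1" "tri_pt J k 1 0 \<noteq> tri_pt J k 0 1"
  using legs_nonzero[of k] by (cases "tri_corner J k"; simp add: tri_pt_def)+

lemma tri_hull: "convex hull (tri_verts J k) = {tri_pt J k s r |s r. 0 \<le> s \<and> 0 \<le> r \<and> s + r \<le> 1}"
proof -
  have pt: "u *\<^sub>R tri_pt J k 0 0 + v *\<^sub>R tri_pt J k 1 0 + w *\<^sub>R tri_pt J k 0 1 = tri_pt J k v w"
    if "u + v + w = 1" for u v w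
  proof -
    have u: "u = 1 - v - w" using that by simp
    show ?thesis unfolding u by (cases "tri_corner J k") (simp add: tri_pt_def algebra_simps)
  qed
  show ?thesis
    unfolding tri_verts_def convex_hull_3
  proof (safe, goal_cases)
    case (1 p1 p2 u v w)
    then show ?case using pt[of u v w] by (intro exI[of _ v] exI[of _ w]) auto
  next
    case (2 p1 p2 s r)
    then show ?case using pt[of "1 - s - r" s r] by (intro exI[of _ "1 - s - r"] exI[of _ s] exI[of _ r]) auto
  qed
qed

lemma tri_pt_inj: "tri_pt J k s r = tri_pt J k s' r' \<longleftrightarrow> s = s' \<and> r = r'"
  using legs_nonzero[of k] by (auto simp: tri_pt_def)

definition tri_aff :: "nat \<times> nat \<times> bool \<Rightarrow> real \<times> real \<Rightarrow> real \<times> real" where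
  "tri_aff k p = tri_pt J k (fst p) (snd p)"

lemma tri_aff_hull: "convex hull (tri_aff k ` X) = tri_aff k ` (convex hull X)"
proof -
  define L where "L = (\<lambda>p::real\<times>real. (leg_x J k * fst p, leg_y J k * snd p))"
  have L: "linear L"
    by (rule linearI) (auto simp: L_def algebra_simps)
  have T: "tri_aff k = (\<lambda>p. tri_corner J k + p) \<circ> L"
    by (auto simp: tri_aff_def tri_pt_def L_def fun_eq_iff prod_eq_iff)
  show ?thesis
    unfolding T image_comp[symmetric] convex_hull_translation convex_hull_linear_image[OF L] ..
qed

lemma barycenter_tri: "barycenter (tri_verts J k) = tri_aff k (1/3, 1/3)"
  unfolding barycenter_def tri_verts_def using tri_verts_distinct[of k]
  by (cases "tri_corner J k") (simp add: tri_aff_def tri_pt_def field_simps)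

lemma midpoint_tri: "midpoint (tri_pt J k s r) (tri_pt J k s' r') = tri_aff k ((s + s') / 2, (r + r') / 2)"
  by (simp add: midpoint_def tri_aff_def tri_pt_def field_simps)

lemma quad_image:
  "quadrilateral (tri_verts J k) (tri_pt J k s r) =
     tri_aff k ` (convex hull {(1/3,1/3), (s/2, r/2), ((s + 1)/2, r/2), (s/2, (r+1)/2)})"
proof -
  have "insert (barycenter (tri_verts J k)) (midpoint (tri_pt J k s r) ` tri_verts J k) =
     tri_aff k ` {(1/3,1/3), (s/2, r/2), ((s + 1)/2, r/2), (s/2, (r+1)/2)}"
    unfolding barycenter_tri by (simp add: tri_verts_def midpoint_tri)
  then show ?thesis unfolding quadrilateral_def by (simp only: tri_aff_hull)
qed

end

lemma convex_halfplane: "convex {p::real\<times>real. a * fst p + b * snd p \<le> c}"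
  using convex_halfspace_le[of "(a, b)" c] by (simp add: inner_prod_def)

lemma convex_halfplane': "convex {p::real\<times>real. c \<le> a * fst p + b * snd p}"
  using convex_halfspace_ge[of c "(a, b)"] by (simp add: inner_prod_def)

text \<open>Each of the three hulls below is cut into two triangles by the segment from the vertex to the barycenter; this
  lemma is applied to each half with explicit weights.\<close>

lemma combine_hull:
  assumes "a \<in> X" "b \<in> X" "c \<in> X" "0 \<le> u" "0 \<le> v" "0 \<le> w" "u + v + w = 1"
  shows "u *\<^sub>R a + v *\<^sub>R b + w *\<^sub>R c \<in> convex hull X"
proof -
  have "u *\<^sub>R a + v *\<^sub>R b + w *\<^sub>R c \<in> convex hull {a, b, c}"
    unfolding convex_hull_3 using assms by blast
  then show ?thesis using hull_mono[of "{a,b,c}" X convex] assms by auto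
qed

lemma quad0_hull:
  "convex hull {(1/3,1/3), (0, 0), (1/2, 0), (0, 1/2)} =
    {p::real\<times>real. 0 \<le> fst p \<and> 0 \<le> snd p \<and> 2 * fst p + snd p \<le> 1 \<and> fst p + 2 * snd p \<le> 1}" (is "?H = ?P")
proof
  have "convex ?P"
    using convex_halfplane[of "-1" 0 0] convex_halfplane[of 0 "-1" 0] convex_halfplane[of 2 1 1] convex_halfplane[of 1 2 1]
    by (simp add: Collect_conj_eq convex_Int)
  then show "?H \<subseteq> ?P" by (intro hull_minimal) auto
  show "?P \<subseteq> ?H"
  proof
    fix p :: "real \<times> real" assume p: "p \<in> ?P"
    obtain s r where sr: "p = (s, r)" by (cases p)
    show "p \<in> ?H"
    proof (cases "r \<le> s")
      case True
      have "p = (1 - s - r - s) *\<^sub>R (0, 0) + (2 * (s - r)) *\<^sub>R (1/2, 0) + (3 * r) *\<^sub>R (1/3, 1/3)"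
        by (simp add: sr algebra_simps)
      also have "\<dots> \<in> ?H" by (rule combine_hull) (use p True in \<open>auto simp: sr\<close>)
      finally show ?thesis .
    next
      case False
      have "p = (1 - s - r - r) *\<^sub>R (0, 0) + (2 * (r - s)) *\<^sub>R (0, 1/2) + (3 * s) *\<^sub>R (1/3, 1/3)"
        by (simp add: sr algebra_simps)
      also have "\<dots> \<in> ?H" by (rule combine_hull) (use p False in \<open>auto simp: sr\<close>)
      finally show ?thesis .
    qed
  qed
qed

lemma quad1_hull:
  "convex hull {(1/3,1/3), (1/2, 0), (1, 0), (1/2, 1/2)} =
    {p::real\<times>real. 0 \<le> snd p \<and> fst p + snd p \<le> 1 \<and> snd p \<le> fst p \<and> 1 \<le> 2 * fst p + snd p}" (is "?H = ?P")
proof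
  have "convex ?P"
    using convex_halfplane[of 0 "-1" 0] convex_halfplane[of 1 1 1] convex_halfplane[of "-1" 1 0] convex_halfplane'[of 1 2 1]
    by (simp add: Collect_conj_eq convex_Int)
  then show "?H \<subseteq> ?P" by (intro hull_minimal) auto
  show "?P \<subseteq> ?H"
  proof
    fix p :: "real \<times> real" assume p: "p \<in> ?P"
    obtain s r where sr: "p = (s, r)" by (cases p)
    show "p \<in> ?H"
    proof (cases "r \<le> 1 - s - r")
      case True
      have "p = (s - (1 - s - r)) *\<^sub>R (1, 0) + (2 * (1 - s - r - r)) *\<^sub>R (1/2, 0) + (3 * r) *\<^sub>R (1/3, 1/3)"
        by (simp add: sr algebra_simps)
      also have "\<dots> \<in> ?H" by (rule combine_hull) (use p True in \<open>auto simp: sr\<close>)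
      finally show ?thesis .
    next
      case False
      have "p = (s - r) *\<^sub>R (1, 0) + (2 * (r - (1 - s - r))) *\<^sub>R (1/2, 1/2) + (3 * (1 - s - r)) *\<^sub>R (1/3, 1/3)"
        by (simp add: sr algebra_simps)
      also have "\<dots> \<in> ?H" by (rule combine_hull) (use p False in \<open>auto simp: sr\<close>)
      finally show ?thesis .
    qed
  qed
qed

lemma quad2_hull:
  "convex hull {(1/3,1/3), (0, 1/2), (1/2, 1/2), (0, 1)} =
    {p::real\<times>real. 0 \<le> fst p \<and> fst p + snd p \<le> 1 \<and> fst p \<le> snd p \<and> 1 \<le> fst p + 2 * snd p}" (is "?H = ?P")
proof
  have "convex ?P"
    using convex_halfplane[of "-1" 0 0] convex_halfplane[of 1 1 1] convex_halfplane[of 1 "-1" 0] convex_halfplane'[of 1 1 2]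
    by (simp add: Collect_conj_eq convex_Int)
  then show "?H \<subseteq> ?P" by (intro hull_minimal) auto
  show "?P \<subseteq> ?H"
  proof
    fix p :: "real \<times> real" assume p: "p \<in> ?P"
    obtain s r where sr: "p = (s, r)" by (cases p)
    show "p \<in> ?H"
    proof (cases "s \<le> 1 - s - r")
      case True
      have "p = (r - (1 - s - r)) *\<^sub>R (0, 1) + (2 * (1 - s - r - s)) *\<^sub>R (0, 1/2) + (3 * s) *\<^sub>R (1/3, 1/3)"
        by (simp add: sr algebra_simps)
      also have "\<dots> \<in> ?H" by (rule combine_hull) (use p True in \<open>auto simp: sr\<close>)
      finally show ?thesis .
    next
      case False
      have "p = (r - s) *\<^sub>R (0, 1) + (2 * (s - (1 - s - r))) *\<^sub>R (1/2, 1/2) + (3 * (1 - s - r)) *\<^sub>R (1/3, 1/3)"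
        by (simp add: sr algebra_simps)
      also have "\<dots> \<in> ?H" by (rule combine_hull) (use p False in \<open>auto simp: sr\<close>)
      finally show ?thesis .
    qed
  qed
qed

context mesh begin

lemma mem_tri_aff_image: "tri_pt J k s r \<in> tri_aff k ` X \<longleftrightarrow> (s, r) \<in> X"
  by (auto simp: tri_aff_def tri_pt_inj image_iff) (metis fst_conv snd_conv)

lemma mem_quadrilateral:
  assumes "0 < s" "0 < r" "s + r < 1"
  shows "tri_pt J k s r \<in> quadrilateral (tri_verts J k) (tri_pt J k 0 0) \<longleftrightarrow> 2 * s + r \<le> 1 \<and> s + 2 * r \<le> 1"
    "tri_pt J k s r \<in> quadrilateral (tri_verts J k) (tri_pt J k 1 0) \<longleftrightarrow> r \<le> s \<and> 1 \<le> 2 * s + r"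
    "tri_pt J k s r \<in> quadrilateral (tri_verts J k) (tri_pt J k 0 1) \<longleftrightarrow> s \<le> r \<and> 1 \<le> s + 2 * r"
  using assms quad0_hull quad1_hull quad2_hull unfolding quad_image mem_tri_aff_image by simp_all

text \<open>An interior point of a triangle lies in no other closed triangle: the integer parts of the index coordinates
  give the cell, and their fractional parts lie strictly on one side of the diagonal.\<close>

lemma tri_unique:
  assumes eq: "tri_pt J k s r = tri_pt J k' s' r'"
    and sr: "0 < s" "0 < r" "s + r < 1" and sr': "0 \<le> s'" "0 \<le> r'" "s' + r' \<le> 1"
  shows "k = k'"
proof -
  obtain j m u where k: "k = (j, m, u)" by (cases k)
  obtain j' m' u' where k': "k' = (j', m', u')" by (cases k')
  have x: "(if u then real (Suc j) - s else real j + s) = (if u' then real (Suc j') - s' else real j' + s')"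
    using idx_tri_pt(1)[of s j m u r] idx_tri_pt(1)[of s' j' m' u' r'] eq sr sr' by (simp add: k k')
  have y: "(if u then real (Suc m) - r else real m + r) = (if u' then real (Suc m') - r' else real m' + r')"
    using idx_tri_pt(2)[of s j m u r] idx_tri_pt(2)[of s' j' m' u' r'] eq sr sr' by (simp add: k k')
  define \<sigma> where "\<sigma> = (if u then 1 - s else s)"
  define \<sigma>' where "\<sigma>' = (if u' then 1 - s' else s')"
  define \<rho> where "\<rho> = (if u then 1 - r else r)"
  define \<rho>' where "\<rho>' = (if u' then 1 - r' else r')"
  have X: "real j + \<sigma> = real j' + \<sigma>'" and Y: "real m + \<rho> = real m' + \<rho>'"
    using x y by (auto simp: \<sigma>_def \<sigma>'_def \<rho>_def \<rho>'_def split: if_splits)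
  have B: "0 < \<sigma>" "\<sigma> < 1" "0 < \<rho>" "\<rho> < 1" "0 \<le> \<sigma>'" "\<sigma>' \<le> 1" "0 \<le> \<rho>'" "\<rho>' \<le> 1"
    using sr sr' by (auto simp: \<sigma>_def \<sigma>'_def \<rho>_def \<rho>'_def)
  have "real j < real j' + 1" "real j' < real j + 1" "real m < real m' + 1" "real m' < real m + 1"
    using X Y B by linarith+
  then have jm: "j = j'" "m = m'" by linarith+
  then have "\<sigma> = \<sigma>'" "\<rho> = \<rho>'" using X Y by auto
  then have "u = u'" using sr sr' by (cases u; cases u') (auto simp: \<sigma>_def \<sigma>'_def \<rho>_def \<rho>'_def)
  then show ?thesis using jm by (simp add: k k')
qed

lemma closure_Omega: "closure Omega = {0..1} \<times> {0..1}"
  by (simp add: Omega_def closure_Times)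

lemma closure_Omega_iff:
  "z \<in> closure Omega \<longleftrightarrow> 0 \<le> idx_x J (fst z) \<and> idx_x J (fst z) \<le> real (7 * J) \<and>
     0 \<le> idx_y J (snd z) \<and> idx_y J (snd z) \<le> real (4 * J)"
  using idx_x_le[of 0 "fst z"] idx_x_le[of "fst z" 1] idx_y_le[of 0 "snd z"] idx_y_le[of "snd z" 1]
  unfolding idx_ends by (auto simp: closure_Omega mem_Times_iff)

lemma Omega_iff:
  "z \<in> Omega \<longleftrightarrow> 0 < idx_x J (fst z) \<and> idx_x J (fst z) < real (7 * J) \<and>
     0 < idx_y J (snd z) \<and> idx_y J (snd z) < real (4 * J)"
  using idx_x_less[of 0 "fst z"] idx_x_less[of "fst z" 1] idx_y_less[of 0 "snd z"] idx_y_less[of "snd z" 1]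
  unfolding idx_ends by (auto simp: Omega_def mem_Times_iff)

lemma open_Omega: "open Omega" by (simp add: Omega_def open_Times)

lemma frontier_Omega: "frontier Omega = closure Omega - Omega"
  using open_Omega by (simp add: frontier_def interior_open)

lemma grid_cell:
  fixes n :: nat assumes "0 \<le> \<xi>" "\<xi> \<le> real n" "n > 0"
  obtains j s where "j < n" "0 \<le> s" "s \<le> 1" "\<xi> = real j + s"
proof (cases "\<xi> = real n")
  case True
  show ?thesis by (rule that[of "n - 1" 1]) (use assms True in \<open>auto simp: of_nat_diff\<close>)
next
  case False
  define j where "j = nat \<lfloor>\<xi>\<rfloor>"
  have j: "real j = of_int \<lfloor>\<xi>\<rfloor>" using assms by (simp add: j_def)
  have "real j \<le> \<xi>" "\<xi> < real j + 1" unfolding j by linarith+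
  then show ?thesis using that[of j "\<xi> - real j"] False assms by simp
qed

lemma tri_cover:
  assumes z: "z \<in> closure Omega"
  obtains k s r where "k \<in> triangles J" "0 \<le> s" "0 \<le> r" "s + r \<le> 1" "z = tri_pt J k s r"
proof -
  obtain x y where xy: "z = (x, y)" by (cases z)
  have x: "0 \<le> idx_x J x" "idx_x J x \<le> real (7 * J)" and y: "0 \<le> idx_y J y" "idx_y J y \<le> real (4 * J)"
    using z unfolding closure_Omega_iff xy by auto
  obtain j s where j: "j < 7 * J" "0 \<le> s" "s \<le> 1" "idx_x J x = real j + s"
    by (rule grid_cell[OF x]) (use J_pos in auto)
  obtain m r where m: "m < 4 * J" "0 \<le> r" "r \<le> 1" "idx_y J y = real m + r"
    by (rule grid_cell[OF y]) (use J_pos in auto)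
  show ?thesis
  proof (cases "s + r \<le> 1")
    case True
    have "z = tri_pt J (j, m, False) s r"
      by (rule idx_eqI) (use j m idx_tri_pt[of s j m False r] in \<open>simp_all add: xy\<close>)
    then show ?thesis using True j m by (intro that[of "(j, m, False)" s r]) (auto simp: triangles_def)
  next
    case False
    have "z = tri_pt J (j, m, True) (1 - s) (1 - r)"
      by (rule idx_eqI) (use j m idx_tri_pt[of "1 - s" j m True "1 - r"] in \<open>simp_all add: xy\<close>)
    then show ?thesis using False j m by (intro that[of "(j, m, True)" "1 - s" "1 - r"]) (auto simp: triangles_def)
  qed
qed

lemma tri_pt_in_Omega:
  assumes "k \<in> triangles J" "0 < s" "0 < r" "s + r < 1"
  shows "tri_pt J k s r \<in> Omega"
proof -
  obtain j m u where k: "k = (j, m, u)" by (cases k)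
  have jm: "real j + 1 \<le> real (7 * J)" "real m + 1 \<le> real (4 * J)" using assms by (auto simp: k triangles_def)
  show ?thesis
    unfolding Omega_iff k using idx_tri_pt[of s j m u r] assms(2-) jm by (auto split: if_splits)
qed

lemma mesh_pt_in_Omega: "mesh_pt J j m \<in> Omega \<longleftrightarrow> 0 < j \<and> j < 7 * J \<and> 0 < m \<and> m < 4 * J"
  unfolding Omega_iff mesh_pt_def fst_conv snd_conv idx_x_mesh idx_y_mesh of_nat_less_iff of_nat_0_less_iff by simp

lemma interior_vertices_eq: "interior_vertices J = (\<lambda>(j, m). mesh_pt J j m) ` ({0<..<7 * J} \<times> {0<..<4 * J})"
  unfolding interior_vertices_def vertices_def
  by (auto simp: mesh_pt_in_Omega image_iff mesh_pt_inj)

lemma finite_interior_vertices: "finite (interior_vertices J)"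
  unfolding interior_vertices_eq by simp

end

section \<open>The space of piecewise linear functions\<close>

text \<open>The nodal basis function at the node with indices \<open>q\<close>. In index coordinates relative to the node, the six
  triangles at the node form the hexagon \<open>max \<bar>s\<bar> (max \<bar>r\<bar> \<bar>s + r\<bar>) \<le> 1\<close>, and this gauge is linear on each of
  them.\<close>

definition hat :: "nat \<Rightarrow> nat \<times> nat \<Rightarrow> real \<times> real \<Rightarrow> real" where
  "hat J q p = (let s = idx_x J (fst p) - real (fst q); r = idx_y J (snd p) - real (snd q)
     in max 0 (1 - max \<bar>s\<bar> (max \<bar>r\<bar> \<bar>s + r\<bar>)))"

lemma hat_vanishes:
  fixes a b c :: real
  assumes "1 \<le> \<bar>a\<bar> \<or> 1 \<le> \<bar>b\<bar>"
  shows "max 0 (1 - max \<bar>a\<bar> (max \<bar>b\<bar> c)) = 0"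
proof -
  have "1 \<le> max \<bar>a\<bar> (max \<bar>b\<bar> c)" using assms by (simp only: le_max_iff_disj) blast
  then show ?thesis by (intro max_absorb1) linarith
qed

text \<open>Here \<open>d\<close> and \<open>e\<close> are the integer offsets of the lower left corner of a cell from the node.\<close>

lemma hat_on_lower:
  fixes d e :: int and s r :: real
  assumes sr: "0 \<le> s" "0 \<le> r" "s + r \<le> 1"
  shows "max 0 (1 - max \<bar>of_int d + s\<bar> (max \<bar>of_int e + r\<bar> \<bar>of_int d + s + (of_int e + r)\<bar>)) =
    (1 - s - r) * of_bool (d = 0 \<and> e = 0) + s * of_bool (d = -1 \<and> e = 0) + r * of_bool (d = 0 \<and> e = -1)"
proof -
  consider "d \<ge> 1 \<or> d \<le> -2 \<or> e \<ge> 1 \<or> e \<le> -2" | "d = 0" "e = 0" | "d = 0" "e = -1" | "d = -1" "e = 0" | "d = -1" "e = -1"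
    by linarith
  then show ?thesis
  proof cases
    case 1
    then have "1 \<le> \<bar>real_of_int d + s\<bar> \<or> 1 \<le> \<bar>real_of_int e + r\<bar>" using sr by linarith
    note hat_vanishes[OF this]
    then show ?thesis using 1 by auto
  next
    case 2
    have "max \<bar>s\<bar> (max \<bar>r\<bar> \<bar>s + r\<bar>) = s + r" using sr by (simp add: max_def)
    then show ?thesis using 2 sr by simp
  next
    case 3
    have "max \<bar>s\<bar> (max \<bar>r - 1\<bar> \<bar>s + (r - 1)\<bar>) = 1 - r" using sr by (simp add: max_def abs_if)
    then show ?thesis using 3 sr by simp
  next
    case 4
    have "max \<bar>s - 1\<bar> (max \<bar>r\<bar> \<bar>s - 1 + r\<bar>) = 1 - s" using sr by (simp add: max_def abs_if)
    then show ?thesis using 4 sr by simp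
  next
    case 5
    have "max \<bar>s - 1\<bar> (max \<bar>r - 1\<bar> \<bar>s - 1 + (r - 1)\<bar>) = 2 - s - r" using sr by (simp add: max_def abs_if)
    then show ?thesis using 5 sr by simp
  qed
qed

lemma hat_on_upper:
  fixes d e :: int and s r :: real
  assumes "0 \<le> s" "0 \<le> r" "s + r \<le> 1"
  shows "max 0 (1 - max \<bar>of_int d - s\<bar> (max \<bar>of_int e - r\<bar> \<bar>of_int d - s + (of_int e - r)\<bar>)) =
    (1 - s - r) * of_bool (d = 0 \<and> e = 0) + s * of_bool (d = 1 \<and> e = 0) + r * of_bool (d = 0 \<and> e = 1)"
proof -
  have 1: "\<bar>of_int d - s\<bar> = \<bar>of_int (- d) + s\<bar>" "\<bar>of_int e - r\<bar> = \<bar>of_int (- e) + r\<bar>"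
    "\<bar>of_int d - s + (of_int e - r)\<bar> = \<bar>of_int (- d) + s + (of_int (- e) + r)\<bar>"
    by auto
  have 2: "d = 0 \<longleftrightarrow> - d = 0" "e = 0 \<longleftrightarrow> - e = 0" "d = 1 \<longleftrightarrow> - d = -1" "e = 1 \<longleftrightarrow> - e = -1"
    by auto
  show ?thesis unfolding 1 unfolding 2 by (rule hat_on_lower[OF assms])
qed

definition node_val :: "nat \<Rightarrow> (real \<times> real \<Rightarrow> real) \<Rightarrow> nat \<times> nat \<Rightarrow> real" where
  "node_val J f q = f (mesh_pt J (fst q) (snd q))"

definition corner_val :: "nat \<Rightarrow> (real \<times> real \<Rightarrow> real) \<Rightarrow> nat \<times> nat \<times> bool \<Rightarrow> nat \<Rightarrow> real" where
  "corner_val J f k i = node_val J f (corner_index i k)"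

context mesh begin

lemma tri_hull_mem: "0 \<le> s \<Longrightarrow> 0 \<le> r \<Longrightarrow> s + r \<le> 1 \<Longrightarrow> tri_pt J k s r \<in> convex hull (tri_verts J k)"
  unfolding tri_hull by blast

lemma corner_val_tri: "corner_val J f k 0 = f (tri_pt J k 0 0)" "corner_val J f k (Suc 0) = f (tri_pt J k 1 0)" "corner_val J f k 1 = f (tri_pt J k 1 0)" "corner_val J f k 2 = f (tri_pt J k 0 1)"
  by (simp_all add: corner_val_def node_val_def tri_pt_vertex)

lemma S_affine:
  assumes f: "f \<in> S_space J" and k: "k \<in> triangles J" and sr: "0 \<le> s" "0 \<le> r" "s + r \<le> 1"
  shows "f (tri_pt J k s r) = corner_val J f k 0 + s * (corner_val J f k 1 - corner_val J f k 0) + r * (corner_val J f k 2 - corner_val J f k 0)"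
proof -
  have "tri_verts J k \<in> triangulation J" using k by (simp add: triangulation_eq)
  then obtain a b where "\<And>z. z \<in> convex hull (tri_verts J k) \<Longrightarrow> f z = a + b \<bullet> z"
    using f unfolding S_space_def by blast
  then have e: "f (tri_pt J k s r) = a + b \<bullet> tri_pt J k s r" if "0 \<le> s" "0 \<le> r" "s + r \<le> 1" for s r
    using tri_hull_mem[OF that] by blast
  show ?thesis
    using e[OF sr] e[of 0 0] e[of 1 0] e[of 0 1] unfolding corner_val_tri
    by (simp add: tri_pt_def inner_prod_def algebra_simps)
qed

lemma S_outside: "f \<in> S_space J \<Longrightarrow> z \<notin> Omega \<Longrightarrow> f z = 0"
  unfolding S_space_def frontier_Omega by blast

lemma S_memI:
  assumes c: "continuous_on UNIV f" and z: "\<And>z. z \<notin> Omega \<Longrightarrow> f z = 0"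
    and aff: "\<And>k s r. k \<in> triangles J \<Longrightarrow> 0 \<le> s \<Longrightarrow> 0 \<le> r \<Longrightarrow> s + r \<le> 1 \<Longrightarrow>
      f (tri_pt J k s r) = corner_val J f k 0 + s * (corner_val J f k 1 - corner_val J f k 0) + r * (corner_val J f k 2 - corner_val J f k 0)"
  shows "f \<in> S_space J"
proof -
  have "\<exists>a b. \<forall>z\<in>convex hull T. f z = a + b \<bullet> z" if T: "T \<in> triangulation J" for T
  proof -
    obtain k where k: "k \<in> triangles J" "T = tri_verts J k" using T unfolding triangulation_eq by blast
    define b where "b = ((corner_val J f k 1 - corner_val J f k 0) / leg_x J k, (corner_val J f k 2 - corner_val J f k 0) / leg_y J k)"
    have "f z = (corner_val J f k 0 - b \<bullet> tri_corner J k) + b \<bullet> z" if z: "z \<in> convex hull T" for z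
    proof -
      obtain s r where sr: "0 \<le> s" "0 \<le> r" "s + r \<le> 1" "z = tri_pt J k s r"
        using z unfolding k(2) tri_hull by blast
      have "b \<bullet> z = b \<bullet> tri_corner J k + s * (corner_val J f k 1 - corner_val J f k 0) + r * (corner_val J f k 2 - corner_val J f k 0)"
        using legs_nonzero[of k] by (cases "tri_corner J k") (simp add: sr(4) b_def tri_pt_def inner_prod_def field_simps)
      then show ?thesis using aff[OF k(1) sr(1-3)] sr(4) by simp
    qed
    then show ?thesis by blast
  qed
  moreover have "Omega \<subseteq> closure Omega" by (rule closure_subset)
  ultimately show ?thesis
    unfolding S_space_def frontier_Omega using z continuous_on_subset[OF c subset_UNIV] by blast
qed

lemma S_continuous:
  assumes "f \<in> S_space J" shows "continuous_on UNIV f"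
proof -
  have "continuous_on (closure Omega \<union> - Omega) f"
  proof (rule continuous_on_closed_Un)
    show "closed (- Omega)" using open_Omega by (simp add: closed_Compl)
    show "continuous_on (- Omega) f"
      by (rule continuous_on_cong[THEN iffD2, OF refl _ continuous_on_const[of _ 0]]) (use S_outside[OF assms] in auto)
    show "continuous_on (closure Omega) f" using assms by (simp add: S_space_def)
  qed simp
  moreover have "closure Omega \<union> - Omega = UNIV" using closure_subset[of Omega] by blast
  ultimately show ?thesis by simp
qed

lemma corner_val_lin: "corner_val J (\<lambda>p. f p + c * g p) k i = corner_val J f k i + c * corner_val J g k i"
  by (simp add: corner_val_def node_val_def)

lemma S_lin:
  assumes f: "f \<in> S_space J" and g: "g \<in> S_space J"
  shows "(\<lambda>p. f p + c * g p) \<in> S_space J"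
proof (rule S_memI)
  show "continuous_on UNIV (\<lambda>p. f p + c * g p)"
    by (intro continuous_intros S_continuous f g)
  show "f z + c * g z = 0" if "z \<notin> Omega" for z
    using S_outside[OF f that] S_outside[OF g that] by simp
  fix k s r assume k: "k \<in> triangles J" "0 \<le> s" "0 \<le> r" "s + r \<le> (1::real)"
  show "f (tri_pt J k s r) + c * g (tri_pt J k s r) = corner_val J (\<lambda>p. f p + c * g p) k 0
    + s * (corner_val J (\<lambda>p. f p + c * g p) k 1 - corner_val J (\<lambda>p. f p + c * g p) k 0)
    + r * (corner_val J (\<lambda>p. f p + c * g p) k 2 - corner_val J (\<lambda>p. f p + c * g p) k 0)"
    unfolding S_affine[OF f k] S_affine[OF g k] corner_val_lin by (simp add: algebra_simps)
qed

lemma S_zero: "(\<lambda>p. 0) \<in> S_space J"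
  by (rule S_memI) (auto simp: corner_val_tri)

lemma corner_index_range:
  assumes "k \<in> triangles J" shows "fst (corner_index i k) \<le> 7 * J" "snd (corner_index i k) \<le> 4 * J"
  using assms by (cases k; auto simp: triangles_def)+

lemma node_val_boundary:
  assumes "f \<in> S_space J" "\<not> (0 < fst q \<and> fst q < 7 * J \<and> 0 < snd q \<and> snd q < 4 * J)"
  shows "node_val J f q = 0"
  unfolding node_val_def by (rule S_outside[OF assms(1)]) (use assms(2) in \<open>simp add: mesh_pt_in_Omega\<close>)

text \<open>A function of the space is affine on each closed triangle, hence determined by its values at the vertices.\<close>

lemma S_eqI:
  assumes f: "f \<in> S_space J" and g: "g \<in> S_space J" and eq: "\<And>z. z \<in> interior_vertices J \<Longrightarrow> f z = g z"
  shows "f = g"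
proof
  fix p
  have v: "node_val J f q = node_val J g q" for q
  proof (cases "0 < fst q \<and> fst q < 7 * J \<and> 0 < snd q \<and> snd q < 4 * J")
    case True
    then have "mesh_pt J (fst q) (snd q) \<in> interior_vertices J"
      unfolding interior_vertices_eq by force
    then show ?thesis by (simp add: node_val_def eq)
  qed (use node_val_boundary f g in simp)
  show "f p = g p"
  proof (cases "p \<in> closure Omega")
    case True
    then obtain k s r where k: "k \<in> triangles J" "0 \<le> s" "0 \<le> r" "s + r \<le> 1" "p = tri_pt J k s r" by (rule tri_cover)
    show ?thesis unfolding k(5) S_affine[OF f k(1-4)] S_affine[OF g k(1-4)] corner_val_def v ..
  next
    case False
    then have "p \<notin> Omega" using closure_subset by blast
    then show ?thesis using S_outside[OF f] S_outside[OF g] by simp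
  qed
qed

lemma hat_tri_pt:
  assumes sr: "0 \<le> s" "0 \<le> r" "s + r \<le> 1"
  shows "hat J q (tri_pt J k s r) =
    (1 - s - r) * of_bool (corner_index 0 k = q) + s * of_bool (corner_index 1 k = q) + r * of_bool (corner_index 2 k = q)"
proof -
  obtain j m u where k: "k = (j, m, u)" by (cases k)
  obtain i l where q: "q = (i, l)" by (cases q)
  have s1: "s \<le> 1" using sr by simp
  show ?thesis
  proof (cases u)
    case False
    have x: "idx_x J (fst (tri_pt J k s r)) - real i = of_int (int j - int i) + s"
      and y: "idx_y J (snd (tri_pt J k s r)) - real l = of_int (int m - int l) + r"
      using idx_tri_pt[of s j m u r] sr s1 False by (auto simp: k)
    have "(j, m) = (i, l) \<longleftrightarrow> int j - int i = 0 \<and> int m - int l = 0"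
      "(Suc j, m) = (i, l) \<longleftrightarrow> int j - int i = -1 \<and> int m - int l = 0"
      "(j, Suc m) = (i, l) \<longleftrightarrow> int j - int i = 0 \<and> int m - int l = -1"
      by auto
    then show ?thesis
      unfolding hat_def Let_def q fst_conv snd_conv x y hat_on_lower[OF sr] using False by (simp add: k)
  next
    case True
    have x: "idx_x J (fst (tri_pt J k s r)) - real i = of_int (int (Suc j) - int i) - s"
      and y: "idx_y J (snd (tri_pt J k s r)) - real l = of_int (int (Suc m) - int l) - r"
      using idx_tri_pt[of s j m u r] sr s1 True by (auto simp: k)
    have "(Suc j, Suc m) = (i, l) \<longleftrightarrow> int (Suc j) - int i = 0 \<and> int (Suc m) - int l = 0"
      "(j, Suc m) = (i, l) \<longleftrightarrow> int (Suc j) - int i = 1 \<and> int (Suc m) - int l = 0"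
      "(Suc j, m) = (i, l) \<longleftrightarrow> int (Suc j) - int i = 0 \<and> int (Suc m) - int l = 1"
      by auto
    then show ?thesis
      unfolding hat_def Let_def q fst_conv snd_conv x y hat_on_upper[OF sr] using True by (simp add: k)
  qed
qed

lemma hat_mesh: "hat J q (mesh_pt J j m) = of_bool ((j, m) = q)"
  using hat_tri_pt[of 0 0 q "(j, m, False)"] by (simp add: tri_pt_vertex)

lemma hat_outside:
  assumes q: "0 < fst q" "fst q < 7 * J" "0 < snd q" "snd q < 4 * J" and p: "p \<notin> Omega"
  shows "hat J q p = 0"
proof -
  define s r where "s = idx_x J (fst p) - real (fst q)" and "r = idx_y J (snd p) - real (snd q)"
  have "1 \<le> real (fst q)" "real (fst q) + 1 \<le> real (7 * J)" "1 \<le> real (snd q)" "real (snd q) + 1 \<le> real (4 * J)"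
    using q by linarith+
  then have "1 \<le> \<bar>s\<bar> \<or> 1 \<le> \<bar>r\<bar>"
    using p unfolding Omega_iff s_def r_def by (auto simp: not_less)
  then show ?thesis unfolding hat_def Let_def s_def[symmetric] r_def[symmetric] by (rule hat_vanishes)
qed

lemma hat_mem:
  assumes q: "0 < fst q" "fst q < 7 * J" "0 < snd q" "snd q < 4 * J"
  shows "hat J q \<in> S_space J"
proof (rule S_memI)
  show "continuous_on UNIV (hat J q)"
    unfolding hat_def Let_def idx_x_def idx_y_def by (intro continuous_intros)
  show "hat J q z = 0" if "z \<notin> Omega" for z by (rule hat_outside[OF q that])
  show "hat J q (tri_pt J k s r) = corner_val J (hat J q) k 0 + s * (corner_val J (hat J q) k 1 - corner_val J (hat J q) k 0)
      + r * (corner_val J (hat J q) k 2 - corner_val J (hat J q) k 0)"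
    if "0 \<le> s" "0 \<le> r" "s + r \<le> 1" for k s r
    unfolding corner_val_tri hat_tri_pt[OF that] using hat_tri_pt[of 0 0 q k] hat_tri_pt[of 1 0 q k] hat_tri_pt[of 0 1 q k]
    by (simp add: algebra_simps)
qed

lemma nodal_basis_eq:
  assumes q: "0 < j" "j < 7 * J" "0 < m" "m < 4 * J"
  shows "nodal_basis J (mesh_pt J j m) = hat J (j, m)"
  unfolding nodal_basis_def
proof (rule the_equality)
  show "hat J (j, m) \<in> S_space J \<and> hat J (j, m) (mesh_pt J j m) = 1 \<and>
    (\<forall>w\<in>vertices J - {mesh_pt J j m}. hat J (j, m) w = 0)"
    using hat_mem[of "(j, m)"] q by (auto simp: hat_mesh vertices_def)
  fix f assume f: "f \<in> S_space J \<and> f (mesh_pt J j m) = 1 \<and> (\<forall>w\<in>vertices J - {mesh_pt J j m}. f w = 0)"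
  show "f = hat J (j, m)"
  proof (rule S_eqI)
    fix z assume z: "z \<in> interior_vertices J"
    then obtain i l where il: "z = mesh_pt J i l" unfolding interior_vertices_eq by auto
    have "z \<in> vertices J" using z by (simp add: interior_vertices_def)
    then show "f z = hat J (j, m) z"
      using f by (cases "(i, l) = (j, m)") (auto simp: il hat_mesh mesh_pt_inj)
  qed (use f hat_mem[of "(j, m)"] q in auto)
qed

lemma interior_cases:
  assumes "z \<in> interior_vertices J"
  obtains j m where "z = mesh_pt J j m" "0 < j" "j < 7 * J" "0 < m" "m < 4 * J"
  using assms unfolding interior_vertices_eq by auto

lemma nodal_basis_mem: "z \<in> interior_vertices J \<Longrightarrow> nodal_basis J z \<in> S_space J"
  by (auto elim!: interior_cases simp: nodal_basis_eq intro!: hat_mem)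

lemma nodal_basis_kron:
  "z \<in> interior_vertices J \<Longrightarrow> w \<in> interior_vertices J \<Longrightarrow> nodal_basis J z w = of_bool (w = z)"
  by (auto elim!: interior_cases simp: nodal_basis_eq hat_mesh mesh_pt_inj)

lemma S_comb: "finite Y \<Longrightarrow> Y \<subseteq> interior_vertices J \<Longrightarrow> (\<lambda>p. \<Sum>z\<in>Y. c z * nodal_basis J z p) \<in> S_space J"
proof (induction rule: finite_induct)
  case (insert z Y)
  then have "(\<lambda>p. (\<Sum>z\<in>Y. c z * nodal_basis J z p) + c z * nodal_basis J z p) \<in> S_space J"
    by (intro S_lin nodal_basis_mem) auto
  then show ?case using insert by (simp add: add.commute)
qed (simp add: S_zero)

lemma S_comb_node:
  assumes "finite Y" "Y \<subseteq> interior_vertices J" "w \<in> interior_vertices J"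
  shows "(\<Sum>z\<in>Y. c z * nodal_basis J z w) = (if w \<in> Y then c w else 0)"
proof -
  have "(\<Sum>z\<in>Y. c z * nodal_basis J z w) = (\<Sum>z\<in>Y. if w = z then c z else 0)"
    using assms by (intro sum.cong) (auto simp: nodal_basis_kron subset_iff)
  then show ?thesis using assms(1) by simp
qed

sublocale FS: function_space "S_space J" "interior_vertices J" "nodal_basis J"
proof
  fix f assume f: "f \<in> S_space J"
  show "(\<lambda>p. \<Sum>z\<in>interior_vertices J. f z * nodal_basis J z p) = f"
    by (rule S_eqI[OF S_comb[OF finite_interior_vertices subset_refl] f])
       (simp add: S_comb_node finite_interior_vertices)
qed (simp_all add: finite_interior_vertices nodal_basis_mem nodal_basis_kron S_zero S_lin)

end

section \<open>Element matrices\<close>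

lemma grad_eqI: "GDERIV f z :> D \<Longrightarrow> grad f z = D"
  unfolding grad_def
proof (rule the_equality)
  fix D' assume "GDERIV f z :> D" "GDERIV f z :> D'"
  then have "(\<lambda>h. h \<bullet> D') = (\<lambda>h. h \<bullet> D)"
    unfolding gderiv_def by (rule has_derivative_unique[rotated])
  then have "\<forall>h. h \<bullet> D' = h \<bullet> D" by meson
  then show "D' = D" by (simp only: vector_eq_ldot)
qed

definition double_area :: "nat \<Rightarrow> nat \<times> nat \<times> bool \<Rightarrow> real" where
  "double_area J k = \<bar>leg_x J k * leg_y J k\<bar>"

text \<open>The element forms act on corner values, numbered as in \<open>corner_index\<close>. They are integrals over the reference
  triangle, so they are multiplied by twice the area of the actual triangle.\<close>

definition mass_loc :: "(nat \<Rightarrow> real) \<Rightarrow> (nat \<Rightarrow> real) \<Rightarrow> real" where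
  "mass_loc c d = (2 * c 0 * d 0 + 2 * c 1 * d 1 + 2 * c 2 * d 2
     + c 0 * d 1 + c 1 * d 0 + c 0 * d 2 + c 2 * d 0 + c 1 * d 2 + c 2 * d 1) / 24"

definition lump_loc :: "(nat \<Rightarrow> real) \<Rightarrow> (nat \<Rightarrow> real) \<Rightarrow> real" where
  "lump_loc c d = (d 0 * (22 * c 0 + 7 * c 1 + 7 * c 2) + d 1 * (7 * c 0 + 22 * c 1 + 7 * c 2)
     + d 2 * (7 * c 0 + 7 * c 1 + 22 * c 2)) / 216"

definition grad_loc :: "nat \<Rightarrow> nat \<times> nat \<times> bool \<Rightarrow> (nat \<Rightarrow> real) \<Rightarrow> (nat \<Rightarrow> real) \<Rightarrow> real" where
  "grad_loc J k c d = ((c 1 - c 0) * (d 1 - d 0) / (leg_x J k)\<^sup>2 + (c 2 - c 0) * (d 2 - d 0) / (leg_y J k)\<^sup>2) / 2"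

context mesh begin

definition s_coord :: "nat \<times> nat \<times> bool \<Rightarrow> real \<times> real \<Rightarrow> real" where
  "s_coord k z = (fst z - fst (tri_corner J k)) / leg_x J k"

definition r_coord :: "nat \<times> nat \<times> bool \<Rightarrow> real \<times> real \<Rightarrow> real" where
  "r_coord k z = (snd z - snd (tri_corner J k)) / leg_y J k"

lemma coords_tri_pt [simp]: "s_coord k (tri_pt J k s r) = s" "r_coord k (tri_pt J k s r) = r"
  using legs_nonzero[of k] by (auto simp: s_coord_def r_coord_def tri_pt_def)

lemma tri_pt_coords [simp]: "tri_pt J k (s_coord k z) (r_coord k z) = z"
  using legs_nonzero[of k] by (auto simp: s_coord_def r_coord_def tri_pt_def prod_eq_iff)

text \<open>Off the finitely many lines that carry edges, each point of the domain lies in exactly one open triangle. The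
  integrand enters only through its values on open triangles, because gradients need not exist on the
  edges; its measurability follows from the completeness of Lebesgue measure.\<close>

lemma tri_integral_sum:
  assumes I: "\<And>k. k \<in> triangles J \<Longrightarrow> has_bochner_integral lborel (on_ref (H k)) (I k)"
    and F: "\<And>k s r. k \<in> triangles J \<Longrightarrow> 0 < s \<Longrightarrow> 0 < r \<Longrightarrow> s + r < 1 \<Longrightarrow> F (tri_pt J k s r) = H k s r"
  shows "(LINT z:Omega|lebesgue. F z) = (\<Sum>k\<in>triangles J. double_area J k * I k)"
proof -
  define G where "G = (\<lambda>z. \<Sum>k\<in>triangles J. on_ref (H k) (s_coord k z, r_coord k z))"
  have "has_bochner_integral lborel G (\<Sum>k\<in>triangles J. double_area J k * I k)"
    unfolding G_def
  proof (rule has_bochner_integral_sum)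
    fix k assume k: "k \<in> triangles J"
    show "has_bochner_integral lborel (\<lambda>z. on_ref (H k) (s_coord k z, r_coord k z)) (double_area J k * I k)"
      unfolding double_area_def s_coord_def r_coord_def
      by (rule affine_change[where H = "\<lambda>s r. on_ref (H k) (s, r)", OF _ legs_nonzero]) (use I[OF k] in simp)
  qed
  then have G: "integral\<^sup>L lebesgue G = (\<Sum>k\<in>triangles J. double_area J k * I k)" and mG: "G \<in> borel_measurable lborel"
    by (auto simp: has_bochner_integral_iff integral_completion dest: borel_measurable_integrable)
  have mG': "G \<in> borel_measurable lebesgue" by (rule measurable_completion[OF mG])
  have "AE z in lborel. \<forall>k\<in>triangles J. s_coord k z \<noteq> 0 \<and> r_coord k z \<noteq> 0 \<and> s_coord k z + r_coord k z \<noteq> 1"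
  proof (rule AE_finite_allI[OF finite_triangles])
    fix k assume "k \<in> triangles J"
    note nz = legs_nonzero[of k]
    have l: "AE z in lborel. a * s_coord k z + b * r_coord k z \<noteq> c" if "a \<noteq> 0 \<or> b \<noteq> 0" for a b c
    proof -
      have "AE z in lborel. a / leg_x J k * fst z + b / leg_y J k * snd z
          \<noteq> c + a / leg_x J k * fst (tri_corner J k) + b / leg_y J k * snd (tri_corner J k)"
        by (rule AE_line) (use that nz in auto)
      then show ?thesis
      proof eventually_elim
        case (elim z)
        have "a * s_coord k z + b * r_coord k z = (a / leg_x J k * fst z + b / leg_y J k * snd z)
          - (a / leg_x J k * fst (tri_corner J k) + b / leg_y J k * snd (tri_corner J k))"
          by (simp add: s_coord_def r_coord_def algebra_simps diff_divide_distrib)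
        then show ?case using elim by linarith
      qed
    qed
    from l[of 1 0 0] l[of 0 1 0] l[of 1 1 1]
    show "AE z in lborel. s_coord k z \<noteq> 0 \<and> r_coord k z \<noteq> 0 \<and> s_coord k z + r_coord k z \<noteq> 1" by simp
  qed
  then have "AE z in lborel. indicat_real Omega z *\<^sub>R F z = G z"
  proof eventually_elim
    case (elim z)
    show ?case
    proof (cases "z \<in> Omega")
      case True
      then have "z \<in> closure Omega" using closure_subset by blast
      then obtain k s r where k: "k \<in> triangles J" "0 \<le> s" "0 \<le> r" "s + r \<le> 1" "z = tri_pt J k s r" by (rule tri_cover)
      then have o: "0 < s" "0 < r" "s + r < 1" using elim by (auto simp: less_le)
      have "G z = (\<Sum>k'\<in>{k}. on_ref (H k') (s_coord k' z, r_coord k' z))"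
        unfolding G_def
      proof (rule sum.mono_neutral_right[OF finite_triangles])
        show "\<forall>i\<in>triangles J - {k}. on_ref (H i) (s_coord i z, r_coord i z) = 0"
        proof
          fix i assume i: "i \<in> triangles J - {k}"
          have "\<not> (0 < s_coord i z \<and> 0 < r_coord i z \<and> s_coord i z + r_coord i z < 1)"
            using tri_unique[of i "s_coord i z" "r_coord i z" k s r] k(2-5) i by (auto simp del: k(5))
          then show "on_ref (H i) (s_coord i z, r_coord i z) = 0" by (auto simp: on_ref_def)
        qed
      qed (use k in simp)
      also have "\<dots> = H k s r" using o by (simp add: on_ref_def k(5))
      finally show ?thesis using True F[OF k(1) o] k(5) by simp
    next
      case False
      have "on_ref (H k) (s_coord k z, r_coord k z) = 0" if "k \<in> triangles J" for k
        using False tri_pt_in_Omega[OF that, of "s_coord k z" "r_coord k z"] by (auto simp: on_ref_def)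
      then show ?thesis using False by (simp add: G_def)
    qed
  qed
  then have AE: "AE z in lebesgue. indicat_real Omega z *\<^sub>R F z = G z" by (rule AE_completion)
  have "(\<lambda>z. indicat_real Omega z *\<^sub>R F z) \<in> borel_measurable lebesgue"
    by (rule borel_measurable_AE[OF mG']) (use AE in \<open>auto elim: eventually_mono\<close>)
  then show ?thesis
    unfolding set_lebesgue_integral_def using integral_cong_AE[OF _ mG' AE] G by simp
qed

lemma l2_formula:
  assumes f: "f \<in> S_space J" and g: "g \<in> S_space J"
  shows "l2_inner f g = (\<Sum>k\<in>triangles J. double_area J k * mass_loc (corner_val J f k) (corner_val J g k))"
  unfolding l2_inner_def mass_loc_def
  by (rule tri_integral_sum[OF ref_mass]) (use S_affine f g in simp)

lemma grad_tri:
  assumes f: "f \<in> S_space J" and k: "k \<in> triangles J" and sr: "0 < s" "0 < r" "s + r < 1"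
  shows "grad f (tri_pt J k s r) = ((corner_val J f k 1 - corner_val J f k 0) / leg_x J k, (corner_val J f k 2 - corner_val J f k 0) / leg_y J k)"
proof (rule grad_eqI)
  let ?D = "((corner_val J f k 1 - corner_val J f k 0) / leg_x J k, (corner_val J f k 2 - corner_val J f k 0) / leg_y J k)"
  let ?z = "tri_pt J k s r"
  let ?A = "\<lambda>z. corner_val J f k 0 + s_coord k z * (corner_val J f k 1 - corner_val J f k 0) + r_coord k z * (corner_val J f k 2 - corner_val J f k 0)"
  define U where "U = {z. 0 < s_coord k z \<and> 0 < r_coord k z \<and> s_coord k z + r_coord k z < 1}"
  have U: "open U" unfolding U_def s_coord_def r_coord_def using legs_nonzero[of k]
    by (intro open_Collect_conj open_Collect_less continuous_intros) auto
  have zU: "?z \<in> U" using sr by (simp add: U_def)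
  have eq: "?A z = f z" if "z \<in> U" for z
    using S_affine[OF f k, of "s_coord k z" "r_coord k z"] that by (simp add: U_def)
  have "(?A has_derivative (\<lambda>h. h \<bullet> ?D)) (at ?z)"
    unfolding s_coord_def r_coord_def using legs_nonzero[of k]
    by (auto intro!: derivative_eq_intros simp: inner_prod_def fun_eq_iff field_simps)
  then show "GDERIV f ?z :> ?D"
    unfolding gderiv_def by (rule has_derivative_transform_within_open[OF _ U zU eq])
qed

lemma grad_formula:
  assumes f: "f \<in> S_space J" and g: "g \<in> S_space J"
  shows "grad_inner f g = (\<Sum>k\<in>triangles J. double_area J k * grad_loc J k (corner_val J f k) (corner_val J g k))"
  unfolding grad_inner_def grad_loc_def
  by (rule tri_integral_sum[OF ref_const]) (use grad_tri f g in \<open>simp add: inner_prod_def power2_eq_square\<close>)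

text \<open>A point inside a triangle meets the control volumes of the vertices of this triangle only. Boundary vertices,
  which do not occur in \<open>J_op\<close>, may be added because the function vanishes there.\<close>

lemma J_op_tri:
  assumes g: "g \<in> S_space J" and k: "k \<in> triangles J" and sr: "0 < s" "0 < r" "s + r < 1"
  shows "J_op J g (tri_pt J k s r) = quad_weight (corner_val J g k 0) (corner_val J g k 1) (corner_val J g k 2) s r"
proof -
  let ?p = "tri_pt J k s r"
  let ?Q = "\<lambda>z. g z * of_bool (?p \<in> quadrilateral (tri_verts J k) z)"
  have cvol: "?p \<in> control_volume J z \<longleftrightarrow> z \<in> tri_verts J k \<and> ?p \<in> quadrilateral (tri_verts J k) z" for z
  proof
    assume "?p \<in> control_volume J z"
    then obtain k' where k': "k' \<in> triangles J" "z \<in> tri_verts J k'" "?p \<in> quadrilateral (tri_verts J k') z"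
      by (auto simp: control_volume_def triangulation_eq)
    have "quadrilateral (tri_verts J k') z \<subseteq> convex hull (tri_verts J k')"
    proof -
      have V: "tri_verts J k' \<subseteq> convex hull (tri_verts J k')" by (rule hull_subset)
      have "barycenter (tri_verts J k') \<in> convex hull (tri_verts J k')"
        unfolding barycenter_tri tri_aff_def by (rule tri_hull_mem) auto
      moreover have "midpoint z w \<in> convex hull (tri_verts J k')" if "w \<in> tri_verts J k'" for w
      proof -
        have "midpoint z w \<in> closed_segment z w" by simp
        moreover have "closed_segment z w \<subseteq> convex hull (tri_verts J k')"
          using V that k'(2) by (intro closed_segment_subset) auto
        ultimately show ?thesis by blast
      qed
      ultimately show ?thesis
        unfolding quadrilateral_def by (intro hull_minimal) auto
    qed
    then have "?p \<in> convex hull (tri_verts J k')" using k'(3) by blast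
    then obtain s' r' where "0 \<le> s'" "0 \<le> r'" "s' + r' \<le> 1" "?p = tri_pt J k' s' r'" unfolding tri_hull by blast
    then have "k = k'" using tri_unique[of k s r k' s' r'] sr by simp
    then show "z \<in> tri_verts J k \<and> ?p \<in> quadrilateral (tri_verts J k) z" using k' by simp
  next
    assume "z \<in> tri_verts J k \<and> ?p \<in> quadrilateral (tri_verts J k) z"
    then show "?p \<in> control_volume J z" using k by (auto simp: control_volume_def triangulation_eq)
  qed
  have "J_op J g ?p = (\<Sum>z\<in>interior_vertices J. if z \<in> tri_verts J k then ?Q z else 0)"
    unfolding J_op_def by (rule sum.cong[OF refl]) (simp add: indicator_def cvol)
  also have "\<dots> = (\<Sum>z\<in>interior_vertices J \<inter> tri_verts J k. ?Q z)"
    by (rule sum.inter_restrict[OF finite_interior_vertices, symmetric])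
  also have "\<dots> = (\<Sum>z\<in>tri_verts J k. ?Q z)"
  proof (rule sum.mono_neutral_left)
    show "finite (tri_verts J k)" by (simp add: tri_verts_def)
    have "g z = 0" if z: "z \<in> tri_verts J k" "z \<notin> interior_vertices J" for z
    proof (rule S_outside[OF g])
      have "z \<in> vertices J"
        using z(1) k corner_index_range[OF k] unfolding tri_verts_def tri_pt_vertex vertices_def by blast
      then show "z \<notin> Omega" using z(2) by (simp add: interior_vertices_def)
    qed
    then show "\<forall>z\<in>tri_verts J k - interior_vertices J \<inter> tri_verts J k. ?Q z = 0" by auto
  qed auto
  also have "\<dots> = ?Q (tri_pt J k 0 0) + ?Q (tri_pt J k 1 0) + ?Q (tri_pt J k 0 1)"
    unfolding tri_verts_def using tri_verts_distinct[of k] by simp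
  also have "\<dots> = quad_weight (corner_val J g k 0) (corner_val J g k 1) (corner_val J g k 2) s r"
    unfolding mem_quadrilateral[OF sr] corner_val_tri quad_weight_def ..
  finally show ?thesis .
qed

lemma lumped_formula:
  assumes f: "f \<in> S_space J" and g: "g \<in> S_space J"
  shows "lumped_inner J f g = (\<Sum>k\<in>triangles J. double_area J k * lump_loc (corner_val J f k) (corner_val J g k))"
  unfolding lumped_inner_def l2_inner_def lump_loc_def
  by (rule tri_integral_sum[OF ref_lump]) (use S_affine f g J_op_tri in simp)

end

section \<open>Assembly of element forms into nodal stencils\<close>

text \<open>The coefficients of the element forms as linear forms in the corner values of the second argument, in
  preparation for the summation by parts in \<open>assembly\<close>.\<close>

definition grad_coef :: "nat \<Rightarrow> nat \<times> nat \<times> bool \<Rightarrow> (nat \<Rightarrow> real) \<Rightarrow> nat \<Rightarrow> real" where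
  "grad_coef J k c i = (if i = 0 then - ((c 1 - c 0) / (leg_x J k)\<^sup>2 + (c 2 - c 0) / (leg_y J k)\<^sup>2) / 2
     else if i = 1 then (c 1 - c 0) / (leg_x J k)\<^sup>2 / 2 else (c 2 - c 0) / (leg_y J k)\<^sup>2 / 2)"

definition lump_coef :: "(nat \<Rightarrow> real) \<Rightarrow> nat \<Rightarrow> real" where
  "lump_coef c i = (15 * c i + 7 * (c 0 + c 1 + c 2)) / 216"

definition defect_coef :: "(nat \<Rightarrow> real) \<Rightarrow> nat \<Rightarrow> real" where
  "defect_coef c i = (3 * c i - (c 0 + c 1 + c 2)) / 108"

text \<open>The defect \<open>(\<psi>, J \<eta>) - (\<psi>, \<eta>)\<close> on a triangle. It is a sum over the three edges of products of differences, hence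
  of order \<open>h^2\<close> relative to the product of the gradients, and it vanishes where one argument is constant.\<close>

definition defect_loc :: "(nat \<Rightarrow> real) \<Rightarrow> (nat \<Rightarrow> real) \<Rightarrow> real" where
  "defect_loc c d = ((c 0 - c 1) * (d 0 - d 1) + (c 0 - c 2) * (d 0 - d 2) + (c 1 - c 2) * (d 1 - d 2)) / 108"

lemma grad_loc_coef: "grad_loc J k c d = grad_coef J k c 0 * d 0 + grad_coef J k c 1 * d 1 + grad_coef J k c 2 * d 2"
  by (simp add: grad_loc_def grad_coef_def add_divide_distrib diff_divide_distrib algebra_simps)

lemma lump_loc_coef: "lump_loc c d = lump_coef c 0 * d 0 + lump_coef c 1 * d 1 + lump_coef c 2 * d 2"
  by (simp add: lump_loc_def lump_coef_def field_simps)

lemma defect_loc_coef: "defect_loc c d = defect_coef c 0 * d 0 + defect_coef c 1 * d 1 + defect_coef c 2 * d 2"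
  by (simp add: defect_loc_def defect_coef_def field_simps)

lemma lump_minus_mass: "lump_loc c d - mass_loc c d = defect_loc c d"
  by (simp add: lump_loc_def mass_loc_def defect_loc_def field_simps)

lemma lump_loc_lin: "lump_loc (\<lambda>i. c i + x * c' i) d = lump_loc c d + x * lump_loc c' d"
  unfolding lump_loc_def times_divide_eq_right add_divide_distrib[symmetric]
  by (rule arg_cong[where f = "\<lambda>x. x / 216"]) (simp add: algebra_simps)

lemma lump_loc_sym: "lump_loc c d = lump_loc d c"
  unfolding lump_loc_def by (rule arg_cong[where f = "\<lambda>x. x / 216"]) (simp add: algebra_simps)

lemma grad_loc_lin: "grad_loc J k (\<lambda>i. c i + x * c' i) d = grad_loc J k c d + x * grad_loc J k c' d"
  unfolding grad_loc_def times_divide_eq_right add_divide_distrib[symmetric]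
  by (rule arg_cong[where f = "\<lambda>x. x / 2"]) (simp add: algebra_simps add_divide_distrib diff_divide_distrib)

lemma grad_loc_sym: "grad_loc J k c d = grad_loc J k d c"
  by (simp add: grad_loc_def mult.commute)

text \<open>The element matrix is \<open>15/216\<close> times the identity plus a positive matrix of rank one.\<close>

lemma lump_loc_lower: "15 / 216 * ((c 0)\<^sup>2 + (c 1)\<^sup>2 + (c 2)\<^sup>2) \<le> lump_loc c c"
proof -
  have "lump_loc c c = 15 / 216 * ((c 0)\<^sup>2 + (c 1)\<^sup>2 + (c 2)\<^sup>2) + 7 / 216 * (c 0 + c 1 + c 2)\<^sup>2"
    by (simp add: lump_loc_def power2_eq_square field_simps)
  then show ?thesis by simp
qed

lemma lump_loc_zero:
  assumes "lump_loc c c = 0" shows "c 0 = 0"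
proof -
  have "15 / 216 * (c 0)\<^sup>2 \<le> 15 / 216 * ((c 0)\<^sup>2 + (c 1)\<^sup>2 + (c 2)\<^sup>2)"
    by (intro mult_left_mono) auto
  also have "\<dots> \<le> 0" using lump_loc_lower[of c] assms by simp
  finally show ?thesis by simp
qed

lemma lump_loc_upper: "lump_loc c c \<le> 1 / 6 * ((c 0)\<^sup>2 + (c 1)\<^sup>2 + (c 2)\<^sup>2)"
proof -
  have "1 / 6 * ((c 0)\<^sup>2 + (c 1)\<^sup>2 + (c 2)\<^sup>2) - lump_loc c c
     = 7 / 216 * ((c 0 - c 1)\<^sup>2 + (c 0 - c 2)\<^sup>2 + (c 1 - c 2)\<^sup>2)"
    by (simp add: lump_loc_def power2_eq_square field_simps)
  then show ?thesis by (smt (verit) zero_le_power2 divide_nonneg_nonneg mult_nonneg_nonneg)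
qed

lemma lump_loc_le_mass: "lump_loc c c \<le> 5 / 3 * mass_loc c c"
proof -
  have "5 / 3 * mass_loc c c - lump_loc c c = 8 / 216 * (c 0 + c 1 + c 2)\<^sup>2"
    by (simp add: lump_loc_def mass_loc_def power2_eq_square field_simps)
  then show ?thesis by (smt (verit) zero_le_power2 divide_nonneg_nonneg mult_nonneg_nonneg)
qed

lemma grad_loc_nonneg: "0 \<le> grad_loc J k c c"
  by (simp add: grad_loc_def flip: power2_eq_square)

text \<open>The sum of the contributions of the six triangles around the node \<open>(j, m)\<close>. Where \<open>j = 0\<close> or \<open>m = 0\<close> the
  truncated subtraction picks wrong triangles; the value there is always multiplied by a boundary value, which
  is zero.\<close>

definition stencil :: "(nat \<times> nat \<times> bool \<Rightarrow> nat \<Rightarrow> real) \<Rightarrow> nat \<Rightarrow> nat \<Rightarrow> real" where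
  "stencil L j m = L (j, m, False) 0 + L (j - 1, m, False) 1 + L (j - 1, m, True) 2
     + L (j, m - 1, False) 2 + L (j, m - 1, True) 1 + L (j - 1, m - 1, True) 0"

lemma sum_shift:
  fixes f g :: "nat \<Rightarrow> real"
  assumes "g 0 = 0" "g n = 0"
  shows "(\<Sum>j<n. f j * g (Suc j)) = (\<Sum>j<n. f (j - 1) * g j)"
  using sum.lessThan_Suc_shift[of "\<lambda>j. f (j - 1) * g j" n] sum.lessThan_Suc[of "\<lambda>j. f (j - 1) * g j" n] assms
  by simp

context mesh begin

lemma double_area_eq: "double_area J (j, m, u) = cell_width J j * mesh_size J"
  using cell_width_pos[of j] h_pos by (simp add: double_area_def abs_mult)

lemma double_area_pos: "double_area J k > 0"
  using cell_width_pos h_pos by (cases k) (simp add: double_area_eq)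

lemma double_area_le: "double_area J k \<le> (mesh_size J)\<^sup>2"
  using h_pos by (cases k) (auto simp: double_area_eq cell_width power2_eq_square)

lemma double_area_ge: "(mesh_size J)\<^sup>2 / 2 \<le> double_area J k"
  using h_pos by (cases k) (auto simp: double_area_eq cell_width power2_eq_square)

lemma sum_triangles: "(\<Sum>k\<in>triangles J. F k) = (\<Sum>j<7*J. \<Sum>m<4*J. F (j, m, False) + F (j, m, True))"
proof -
  have "(\<Sum>k\<in>triangles J. F k) = (\<Sum>j<7*J. \<Sum>m<4*J. \<Sum>u\<in>UNIV. F (j, m, u))"
    unfolding triangles_def by (simp add: sum.cartesian_product')
  then show ?thesis by (simp add: UNIV_bool add.commute)
qed

text \<open>Discrete summation by parts: each corner contribution is shifted to the node to which it belongs, and the terms at the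
  ends of the shifts vanish by the boundary condition.\<close>

lemma assembly:
  assumes f: "f \<in> S_space J"
  shows "(\<Sum>k\<in>triangles J. L k 0 * corner_val J f k 0 + L k 1 * corner_val J f k 1 + L k 2 * corner_val J f k 2)
    = (\<Sum>j<7*J. \<Sum>m<4*J. node_val J f (j, m) * stencil L j m)"
proof -
  define e where "e = (\<lambda>j m. node_val J f (j, m))"
  have b: "e 0 m = 0" "e (7 * J) m = 0" "e j 0 = 0" "e j (4 * J) = 0" for j m
    by (simp_all add: e_def node_val_boundary[OF f])
  have Sx: "(\<Sum>j<7*J. \<Sum>m<4*J. F j m * e (Suc j) (g m)) = (\<Sum>j<7*J. \<Sum>m<4*J. F (j - 1) m * e j (g m))" for F g
  proof -
    have "(\<Sum>m<4*J. \<Sum>j<7*J. F j m * e (Suc j) (g m)) = (\<Sum>m<4*J. \<Sum>j<7*J. F (j - 1) m * e j (g m))"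
      by (intro sum.cong refl sum_shift) (simp_all add: b)
    then show ?thesis by (simp only: sum.swap[of _ "{..<4*J}" "{..<7*J}"])
  qed
  have Sy: "(\<Sum>j<7*J. \<Sum>m<4*J. F j m * e j (Suc m)) = (\<Sum>j<7*J. \<Sum>m<4*J. F j (m - 1) * e j m)" for F
    by (intro sum.cong refl sum_shift) (simp_all add: b)
  have "(\<Sum>k\<in>triangles J. L k 0 * corner_val J f k 0 + L k 1 * corner_val J f k 1 + L k 2 * corner_val J f k 2)
    = (\<Sum>j<7*J. \<Sum>m<4*J. L (j, m, False) 0 * e j m)
    + (\<Sum>j<7*J. \<Sum>m<4*J. (L (j, m, False) 1 + L (j, m, True) 2) * e (Suc j) m)
    + (\<Sum>j<7*J. \<Sum>m<4*J. (L (j, m, False) 2 + L (j, m, True) 1) * e j (Suc m))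
    + (\<Sum>j<7*J. \<Sum>m<4*J. L (j, m, True) 0 * e (Suc j) (Suc m))"
    unfolding sum_triangles by (simp add: corner_val_def e_def sum.distrib[symmetric] algebra_simps)
  also have "\<dots> = (\<Sum>j<7*J. \<Sum>m<4*J. L (j, m, False) 0 * e j m)
    + (\<Sum>j<7*J. \<Sum>m<4*J. (L (j - 1, m, False) 1 + L (j - 1, m, True) 2) * e j m)
    + (\<Sum>j<7*J. \<Sum>m<4*J. (L (j, m - 1, False) 2 + L (j, m - 1, True) 1) * e j m)
    + (\<Sum>j<7*J. \<Sum>m<4*J. L (j - 1, m - 1, True) 0 * e j m)"
    using Sx[of "\<lambda>j m. L (j, m, False) 1 + L (j, m, True) 2" "\<lambda>m. m"]
      Sy[of "\<lambda>j m. L (j, m, False) 2 + L (j, m, True) 1"]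
      Sx[of "\<lambda>j m. L (j, m, True) 0" Suc] Sy[of "\<lambda>j m. L (j - 1, m, True) 0"]
    by simp
  also have "\<dots> = (\<Sum>j<7*J. \<Sum>m<4*J. node_val J f (j, m) * stencil L j m)"
    unfolding stencil_def e_def by (simp add: sum.distrib[symmetric] algebra_simps)
  finally show ?thesis .
qed

text \<open>The five-point difference scheme: although each node has six triangles, the two diagonal neighbours do not occur.
  In the first variable each difference is divided by its own cell width \<open>a\<close> or \<open>b\<close>.\<close>

lemma grad_stencil:
  fixes j m :: nat and f :: "real \<times> real \<Rightarrow> real"
  defines "a \<equiv> cell_width J j" and "b \<equiv> cell_width J (Suc j)" and "h \<equiv> mesh_size J" and "u \<equiv> \<lambda>j m. node_val J f (j, m)"
  shows "stencil (\<lambda>k i. double_area J k * grad_coef J k (corner_val J f k) i) (Suc j) (Suc m) =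
    h / b * (u (Suc j) (Suc m) - u (Suc (Suc j)) (Suc m)) + h / a * (u (Suc j) (Suc m) - u j (Suc m))
    + (a + b) / (2 * h) * (2 * u (Suc j) (Suc m) - u (Suc j) (Suc (Suc m)) - u (Suc j) m)"
proof -
  have ab: "a > 0" "b > 0" "h > 0" unfolding a_def b_def h_def by (rule cell_width_pos h_pos)+
  show ?thesis
    unfolding stencil_def double_area_eq grad_coef_def corner_val_def using ab
    by (simp add: a_def[symmetric] b_def[symmetric] h_def[symmetric] u_def)
       (simp add: field_simps power2_eq_square)
qed

lemma lump_stencil:
  fixes j m :: nat and f :: "real \<times> real \<Rightarrow> real"
  defines "a \<equiv> cell_width J j" and "b \<equiv> cell_width J (Suc j)" and "h \<equiv> mesh_size J" and "u \<equiv> \<lambda>j m. node_val J f (j, m)"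
  shows "stencil (\<lambda>k i. double_area J k * lump_coef (corner_val J f k) i) (Suc j) (Suc m) =
    h / 216 * (66 * (a + b) * u (Suc j) (Suc m)
     + 7 * b * (2 * u (Suc (Suc j)) (Suc m) + 2 * u (Suc (Suc j)) m + u (Suc j) (Suc (Suc m)) + u (Suc j) m)
     + 7 * a * (2 * u j (Suc m) + 2 * u j (Suc (Suc m)) + u (Suc j) (Suc (Suc m)) + u (Suc j) m))"
  unfolding stencil_def double_area_eq lump_coef_def corner_val_def
  by (simp add: a_def[symmetric] b_def[symmetric] h_def[symmetric] u_def)
     (simp add: field_simps)

lemma defect_stencil_eq:
  fixes j m :: nat and f :: "real \<times> real \<Rightarrow> real"
  defines "a \<equiv> cell_width J j" and "b \<equiv> cell_width J (Suc j)" and "h \<equiv> mesh_size J" and "u \<equiv> \<lambda>j m. node_val J f (j, m)"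
  shows "stencil (\<lambda>k i. double_area J k * defect_coef (corner_val J f k) i) (Suc j) (Suc m) =
    h / 108 * (6 * (a + b) * u (Suc j) (Suc m)
     - b * (2 * u (Suc (Suc j)) (Suc m) + 2 * u (Suc (Suc j)) m + u (Suc j) (Suc (Suc m)) + u (Suc j) m)
     - a * (2 * u j (Suc m) + 2 * u j (Suc (Suc m)) + u (Suc j) (Suc (Suc m)) + u (Suc j) m))"
  unfolding stencil_def double_area_eq defect_coef_def corner_val_def
  by (simp add: a_def[symmetric] b_def[symmetric] h_def[symmetric] u_def)
     (simp add: field_simps)

end

section \<open>The discrete operators\<close>

context mesh begin

text \<open>A form that is assembled from symmetric positive semidefinite element forms inherits these properties.\<close>

lemma semi_inner_local:
  assumes B: "\<And>f g. f \<in> S_space J \<Longrightarrow> g \<in> S_space J \<Longrightarrow> B f g = (\<Sum>k\<in>triangles J. double_area J k * l k (corner_val J f k) (corner_val J g k))"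
    and lin: "\<And>k c c' x d. l k (\<lambda>i. c i + x * c' i) d = l k c d + x * l k c' d"
    and sym: "\<And>k c d. l k c d = l k d c" and pos: "\<And>k c. 0 \<le> l k c c"
  shows "FS.semi_inner B"
  unfolding FS.semi_inner_def FS.linear_form_def
proof (intro conjI ballI allI)
  have corner_val: "corner_val J (\<lambda>p. f p + c * g p) k = (\<lambda>i. corner_val J f k i + c * corner_val J g k i)" for f g c k
    by (rule ext) (rule corner_val_lin)
  fix f g k :: "real \<times> real \<Rightarrow> real" and c :: real
  assume f: "f \<in> S_space J" and g: "g \<in> S_space J" and k: "k \<in> S_space J"
  show "B (\<lambda>p. f p + c * g p) k = B f k + c * B g k"
    unfolding B[OF S_lin[OF f g] k] B[OF f k] B[OF g k] corner_val lin
    by (simp add: sum.distrib[symmetric] sum_distrib_left algebra_simps)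
next
  fix f g assume f: "f \<in> S_space J" and g: "g \<in> S_space J"
  show "B f g = B g f" unfolding B[OF f g] B[OF g f] by (simp add: sym[of _ "corner_val J f _"])
next
  fix f assume f: "f \<in> S_space J"
  show "0 \<le> B f f" unfolding B[OF f f] by (intro sum_nonneg mult_nonneg_nonneg pos less_imp_le double_area_pos)
qed

lemma local_zero:
  assumes "(\<Sum>k\<in>triangles J. double_area J k * l k) = 0" "\<And>k. 0 \<le> l k" "k \<in> triangles J"
  shows "l k = 0"
proof -
  have "\<forall>k\<in>triangles J. double_area J k * l k = 0"
    using assms(1) sum_nonneg_eq_0_iff[OF finite_triangles, of J "\<lambda>k. double_area J k * l k"] assms(2) double_area_pos
    by (simp add: less_imp_le)
  then show ?thesis using assms(3) double_area_pos[of k] by auto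
qed

lemma lumped_inner_form: "FS.inner_form (lumped_inner J)"
  unfolding FS.inner_form_def
proof (intro conjI ballI impI)
  have pos: "0 \<le> lump_loc c c" for c
    by (rule order.trans[OF _ lump_loc_lower]) simp
  show "FS.semi_inner (lumped_inner J)"
    by (rule semi_inner_local[where l = "\<lambda>_. lump_loc", OF lumped_formula])
       (rule lump_loc_lin lump_loc_sym pos | assumption)+
  fix f z assume f: "f \<in> S_space J" and 0: "lumped_inner J f f = 0" and z: "z \<in> interior_vertices J"
  obtain j m where jm: "z = mesh_pt J j m" "j < 7 * J" "m < 4 * J" using z by (rule interior_cases)
  have "lump_loc (corner_val J f (j, m, False)) (corner_val J f (j, m, False)) = 0"
    using 0[unfolded lumped_formula[OF f f]] by (rule local_zero) (use pos jm in \<open>auto simp: triangles_def\<close>)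
  then have "corner_val J f (j, m, False) 0 = 0" by (rule lump_loc_zero)
  then show "f z = 0" by (simp add: corner_val_def node_val_def jm)
qed

text \<open>Zero energy forces equal values at the ends of each horizontal edge, and the boundary value zero propagates along
  each mesh row.\<close>

lemma grad_inner_form: "FS.inner_form grad_inner"
  unfolding FS.inner_form_def
proof (intro conjI ballI impI)
  show "FS.semi_inner grad_inner"
    by (rule semi_inner_local[where l = "grad_loc J", OF grad_formula])
       (rule grad_loc_lin grad_loc_sym grad_loc_nonneg | assumption)+
  fix f z assume f: "f \<in> S_space J" and 0: "grad_inner f f = 0" and z: "z \<in> interior_vertices J"
  obtain j m where jm: "z = mesh_pt J j m" "j < 7 * J" "m < 4 * J" using z by (rule interior_cases)
  have "node_val J f (i, m) = 0" if "i \<le> 7 * J" for i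
    using that
  proof (induction i)
    case 0
    show ?case by (rule node_val_boundary[OF f]) simp
  next
    case (Suc i)
    let ?k = "(i, m, False)"
    have "grad_loc J ?k (corner_val J f ?k) (corner_val J f ?k) = 0"
      using 0[unfolded grad_formula[OF f f]]
      by (rule local_zero[where l = "\<lambda>k. grad_loc J k (corner_val J f k) (corner_val J f k)"]) (use grad_loc_nonneg jm Suc in \<open>auto simp: triangles_def\<close>)
    then have "(corner_val J f ?k 1 - corner_val J f ?k 0)\<^sup>2 / (leg_x J ?k)\<^sup>2 + (corner_val J f ?k 2 - corner_val J f ?k 0)\<^sup>2 / (leg_y J ?k)\<^sup>2 = 0"
      by (simp add: grad_loc_def power2_eq_square)
    then have "(corner_val J f ?k 1 - corner_val J f ?k 0)\<^sup>2 / (leg_x J ?k)\<^sup>2 = 0"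
      by (subst (asm) add_nonneg_eq_0_iff) auto
    then have "corner_val J f ?k 1 = corner_val J f ?k 0" using legs_nonzero(1)[of ?k] by simp
    then show ?case using Suc by (simp add: corner_val_def)
  qed
  from this[of j] show "f z = 0" using jm by (simp add: node_val_def)
qed

lemma Delta_op:
  assumes "\<psi> \<in> S_space J"
  shows "Delta_op J \<psi> \<in> S_space J \<and> (\<forall>\<eta>\<in>S_space J. - lumped_inner J (Delta_op J \<psi>) \<eta> = grad_inner \<psi> \<eta>)"
proof -
  have s: "FS.semi_inner grad_inner" using grad_inner_form by (simp add: FS.inner_form_def)
  have "FS.linear_form (\<lambda>\<eta>. - grad_inner \<psi> \<eta>)"
    using FS.semi_innerD(2)[OF s assms] by (simp add: FS.linear_form_def)
  have neg: "- x = y \<longleftrightarrow> x = - y" for x y :: real by auto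
  from FS.riesz[OF lumped_inner_form \<open>FS.linear_form _\<close>]
  have "\<exists>!\<phi>. \<phi> \<in> S_space J \<and> (\<forall>\<eta>\<in>S_space J. - lumped_inner J \<phi> \<eta> = grad_inner \<psi> \<eta>)"
    unfolding neg .
  then show ?thesis unfolding Delta_op_def by (rule theI')
qed

lemma defect_formula:
  assumes f: "f \<in> S_space J" and g: "g \<in> S_space J"
  shows "l2_inner f (J_op J g) - l2_inner f g = (\<Sum>k\<in>triangles J. double_area J k * defect_loc (corner_val J f k) (corner_val J g k))"
  unfolding lumped_inner_def[symmetric] lumped_formula[OF f g] l2_formula[OF f g] lump_minus_mass[symmetric]
  by (simp add: sum_subtractf algebra_simps)

lemma Q_op:
  assumes \<psi>: "\<psi> \<in> S_space J"
  shows "Q_op J \<psi> \<in> S_space J \<and>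
    (\<forall>\<eta>\<in>S_space J. grad_inner (Q_op J \<psi>) \<eta> = l2_inner \<psi> (J_op J \<eta>) - l2_inner \<psi> \<eta>)"
proof -
  have corner_val: "corner_val J (\<lambda>p. f p + c * g p) k = (\<lambda>i. corner_val J f k i + c * corner_val J g k i)" for f g c k
    by (rule ext) (rule corner_val_lin)
  have "FS.linear_form (\<lambda>\<eta>. l2_inner \<psi> (J_op J \<eta>) - l2_inner \<psi> \<eta>)"
    unfolding FS.linear_form_def
  proof (intro ballI allI)
    fix f g :: "real \<times> real \<Rightarrow> real" and c :: real assume f: "f \<in> S_space J" and g: "g \<in> S_space J"
    have l: "defect_loc d (\<lambda>i. e i + c * e' i) = defect_loc d e + c * defect_loc d e'" for d e e'
      by (simp add: defect_loc_def field_simps)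
    show "l2_inner \<psi> (J_op J (\<lambda>p. f p + c * g p)) - l2_inner \<psi> (\<lambda>p. f p + c * g p)
      = l2_inner \<psi> (J_op J f) - l2_inner \<psi> f + c * (l2_inner \<psi> (J_op J g) - l2_inner \<psi> g)"
      unfolding defect_formula[OF \<psi> S_lin[OF f g]] defect_formula[OF \<psi> f] defect_formula[OF \<psi> g] corner_val l
      by (simp add: sum.distrib[symmetric] sum_distrib_left algebra_simps)
  qed
  from FS.riesz[OF grad_inner_form this] show ?thesis unfolding Q_op_def by (rule theI')
qed

sublocale GF: gradient_flow "S_space J" "interior_vertices J" "nodal_basis J" "Delta_op J" "lumped_inner J" grad_inner
proof
  show "FS.inner_form (lumped_inner J)" by (rule lumped_inner_form)
  show "FS.semi_inner grad_inner" using grad_inner_form by (simp add: FS.inner_form_def)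
qed (use Delta_op in \<open>auto simp: minus_equation_iff\<close>)

end

section \<open>Taylor expansions of the first eigenfunction\<close>

lemma sin_remainder_2: "\<bar>sin (A + \<delta>) - sin A - \<delta> * cos A\<bar> \<le> \<delta>\<^sup>2" for A \<delta> :: real
proof -
  have s: "\<bar>sin \<delta> - \<delta>\<bar> \<le> \<delta>\<^sup>2 / 2"
    using Maclaurin_sin_bound[of \<delta> 2] by (simp add: numeral_2_eq_2 sin_coeff_def)
  have c: "\<bar>cos \<delta> - 1\<bar> \<le> \<delta>\<^sup>2 / 2"
  proof -
    obtain t where "cos \<delta> = (\<Sum>m<2. cos_coeff m * \<delta> ^ m) + cos (t + 1/2 * real 2 * pi) / fact 2 * \<delta> ^ 2"
      using Maclaurin_cos_expansion[of \<delta> 2] by blast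
    then have "cos \<delta> - 1 = cos (t + pi) / 2 * \<delta>\<^sup>2"
      by (simp add: numeral_2_eq_2 cos_coeff_def)
    then have "\<bar>cos \<delta> - 1\<bar> = \<bar>cos (t + pi)\<bar> / 2 * \<delta>\<^sup>2" by (simp add: abs_mult)
    also have "\<dots> \<le> 1 / 2 * \<delta>\<^sup>2" by (intro mult_right_mono divide_right_mono abs_cos_le_one) auto
    finally show ?thesis by simp
  qed
  have "sin (A + \<delta>) - sin A - \<delta> * cos A = sin A * (cos \<delta> - 1) + cos A * (sin \<delta> - \<delta>)"
    by (simp add: sin_add algebra_simps)
  also have "\<bar>\<dots>\<bar> \<le> \<bar>sin A\<bar> * \<bar>cos \<delta> - 1\<bar> + \<bar>cos A\<bar> * \<bar>sin \<delta> - \<delta>\<bar>"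
    by (metis abs_mult abs_triangle_ineq)
  also have "\<dots> \<le> 1 * (\<delta>\<^sup>2 / 2) + 1 * (\<delta>\<^sup>2 / 2)"
    by (intro add_mono mult_mono s c) auto
  finally show ?thesis by simp
qed

lemma sin_remainder_3: "\<bar>sin (A + \<delta>) - sin A - \<delta> * cos A + \<delta>\<^sup>2 / 2 * sin A\<bar> \<le> \<bar>\<delta>\<bar> ^ 3" for A \<delta> :: real
proof -
  have s: "\<bar>sin \<delta> - \<delta>\<bar> \<le> \<bar>\<delta>\<bar> ^ 3 / 2"
  proof -
    have "\<bar>sin \<delta> - \<delta>\<bar> \<le> \<bar>\<delta>\<bar> ^ 3 / 6"
      using Maclaurin_sin_bound[of \<delta> 3] by (simp add: numeral_3_eq_3 sin_coeff_def fact_numeral)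
    then show ?thesis using zero_le_power[of "\<bar>\<delta>\<bar>" 3] by linarith
  qed
  have c: "\<bar>cos \<delta> - 1 + \<delta>\<^sup>2 / 2\<bar> \<le> \<bar>\<delta>\<bar> ^ 3 / 2"
  proof -
    obtain t where t: "cos \<delta> = (\<Sum>m<3. cos_coeff m * \<delta> ^ m) + cos (t + 1/2 * real 3 * pi) / fact 3 * \<delta> ^ 3"
      using Maclaurin_cos_expansion[of \<delta> 3] by blast
    have "(\<Sum>m<3. cos_coeff m * \<delta> ^ m) = 1 - \<delta>\<^sup>2 / 2"
      by (simp add: eval_nat_numeral cos_coeff_def)
    then have "cos \<delta> - 1 + \<delta>\<^sup>2 / 2 = cos (t + 1/2 * real 3 * pi) / fact 3 * \<delta> ^ 3" using t by simp
    then have "\<bar>cos \<delta> - 1 + \<delta>\<^sup>2 / 2\<bar> = \<bar>cos (t + 1/2 * real 3 * pi)\<bar> / fact 3 * \<bar>\<delta>\<bar> ^ 3"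
      by (simp add: abs_mult power_abs)
    also have "\<dots> \<le> 1 / 2 * \<bar>\<delta>\<bar> ^ 3"
      by (intro mult_right_mono) (auto simp: fact_numeral intro: order.trans[OF abs_cos_le_one])
    finally show ?thesis by simp
  qed
  have "sin (A + \<delta>) - sin A - \<delta> * cos A + \<delta>\<^sup>2 / 2 * sin A = sin A * (cos \<delta> - 1 + \<delta>\<^sup>2 / 2) + cos A * (sin \<delta> - \<delta>)"
    by (simp add: sin_add algebra_simps)
  also have "\<bar>\<dots>\<bar> \<le> \<bar>sin A\<bar> * \<bar>cos \<delta> - 1 + \<delta>\<^sup>2 / 2\<bar> + \<bar>cos A\<bar> * \<bar>sin \<delta> - \<delta>\<bar>"
    by (metis abs_mult abs_triangle_ineq)
  also have "\<dots> \<le> 1 * (\<bar>\<delta>\<bar> ^ 3 / 2) + 1 * (\<bar>\<delta>\<bar> ^ 3 / 2)"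
    by (intro add_mono mult_mono s c) auto
  finally show ?thesis by simp
qed

lemma sin_diff_le: "\<bar>sin (A + \<delta>) - sin A\<bar> \<le> \<bar>\<delta>\<bar>" for A \<delta> :: real
proof -
  have "\<bar>sin (A + \<delta>) - sin A\<bar> = 2 * \<bar>sin (\<delta> / 2)\<bar> * \<bar>cos (A + \<delta> / 2)\<bar>"
    using sin_diff_sin[of "A + \<delta>" A] by (simp add: abs_mult add_divide_distrib)
  also have "\<dots> \<le> 2 * \<bar>\<delta> / 2\<bar> * 1"
    by (intro mult_mono abs_sin_x_le_abs_x) auto
  finally show ?thesis by simp
qed

lemma phi1_eq: "phi1 (x, y) = 2 * (sin (pi * x) * sin (pi * y))" by (simp add: phi1_def)

lemma phi1_grad: "grad phi1 (x, y) = (2 * pi * (cos (pi * x) * sin (pi * y)), 2 * pi * (sin (pi * x) * cos (pi * y)))"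
proof (rule grad_eqI)
  have "((\<lambda>z. 2 * sin (pi * fst z) * sin (pi * snd z)) has_derivative
     (\<lambda>h. h \<bullet> (2 * pi * (cos (pi * x) * sin (pi * y)), 2 * pi * (sin (pi * x) * cos (pi * y))))) (at (x, y))"
    by (auto intro!: derivative_eq_intros simp: inner_prod_def fun_eq_iff algebra_simps)
  then show "GDERIV phi1 (x, y) :> (2 * pi * (cos (pi * x) * sin (pi * y)), 2 * pi * (sin (pi * x) * cos (pi * y)))"
    unfolding gderiv_def phi1_def by (simp add: case_prod_unfold)
qed

text \<open>Also diagonal steps are covered, for the neighbours in the lumped stencil.\<close>

lemma phi1_diff:
  assumes "\<bar>p\<bar> \<le> h" "\<bar>q\<bar> \<le> h"
  shows "\<bar>phi1 (x + p, y + q) - phi1 (x, y)\<bar> \<le> 4 * pi * h"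
proof -
  have "phi1 (x + p, y + q) - phi1 (x, y) = 2 * ((sin (pi * x + pi * p) - sin (pi * x)) * sin (pi * y + pi * q)
      + sin (pi * x) * (sin (pi * y + pi * q) - sin (pi * y)))"
    by (simp add: phi1_eq algebra_simps)
  also have "\<bar>\<dots>\<bar> \<le> 2 * (\<bar>sin (pi * x + pi * p) - sin (pi * x)\<bar> * \<bar>sin (pi * y + pi * q)\<bar>
      + \<bar>sin (pi * x)\<bar> * \<bar>sin (pi * y + pi * q) - sin (pi * y)\<bar>)"
    unfolding abs_mult[of 2] abs_numeral
    by (intro mult_left_mono order.trans[OF abs_triangle_ineq] add_mono) (simp_all add: abs_mult)
  also have "\<dots> \<le> 2 * (\<bar>pi * p\<bar> * 1 + 1 * \<bar>pi * q\<bar>)"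
    by (intro mult_left_mono add_mono mult_mono sin_diff_le) auto
  also have "\<dots> \<le> 2 * (pi * h * 1 + 1 * (pi * h))"
    using assms by (intro mult_left_mono add_mono mult_mono) (auto simp: abs_mult intro!: mult_left_mono)
  finally show ?thesis by simp
qed

lemma phi1_taylor:
  assumes "\<bar>p\<bar> \<le> h" "\<bar>q\<bar> \<le> h"
  shows "\<bar>phi1 (x + p, y + q) - phi1 (x, y) - (p, q) \<bullet> grad phi1 (x, y)\<bar> \<le> 6 * pi\<^sup>2 * h\<^sup>2"
proof -
  let ?A = "pi * x" and ?B = "pi * y" and ?a = "pi * p" and ?b = "pi * q"
  have ab: "\<bar>?a\<bar> \<le> pi * h" "\<bar>?b\<bar> \<le> pi * h" using assms by (auto simp: abs_mult)
  have sq: "?a\<^sup>2 \<le> (pi * h)\<^sup>2" "?b\<^sup>2 \<le> (pi * h)\<^sup>2"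
    using power_mono[OF ab(1), of 2] power_mono[OF ab(2), of 2] by simp_all
  have eq: "phi1 (x + p, y + q) - phi1 (x, y) - (p, q) \<bullet> grad phi1 (x, y)
    = 2 * ((sin (?A + ?a) - sin ?A - ?a * cos ?A) * sin (?B + ?b)
      + (sin ?A * (sin (?B + ?b) - sin ?B - ?b * cos ?B) + ?a * cos ?A * (sin (?B + ?b) - sin ?B)))"
    by (simp add: phi1_eq phi1_grad inner_prod_def algebra_simps)
  have "\<bar>2 * ((sin (?A + ?a) - sin ?A - ?a * cos ?A) * sin (?B + ?b)
      + (sin ?A * (sin (?B + ?b) - sin ?B - ?b * cos ?B) + ?a * cos ?A * (sin (?B + ?b) - sin ?B)))\<bar>
    \<le> 2 * (\<bar>sin (?A + ?a) - sin ?A - ?a * cos ?A\<bar> * \<bar>sin (?B + ?b)\<bar>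
      + (\<bar>sin ?A\<bar> * \<bar>sin (?B + ?b) - sin ?B - ?b * cos ?B\<bar> + \<bar>?a\<bar> * \<bar>cos ?A\<bar> * \<bar>sin (?B + ?b) - sin ?B\<bar>))"
    unfolding abs_mult[of 2] abs_numeral
    by (intro mult_left_mono order.trans[OF abs_triangle_ineq] add_mono) (simp_all add: abs_mult)
  also have "\<dots> \<le> 2 * (?a\<^sup>2 * 1 + (1 * ?b\<^sup>2 + \<bar>?a\<bar> * 1 * \<bar>?b\<bar>))"
    by (intro mult_left_mono add_mono mult_mono sin_remainder_2 sin_diff_le) auto
  also have "\<dots> \<le> 2 * ((pi * h)\<^sup>2 * 1 + (1 * (pi * h)\<^sup>2 + (pi * h) * 1 * (pi * h)))"
    using ab sq by (intro mult_left_mono add_mono mult_mono) auto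
  also have "\<dots> = 6 * pi\<^sup>2 * h\<^sup>2" by (simp add: power2_eq_square algebra_simps)
  finally show ?thesis unfolding eq .
qed

text \<open>The three-point second difference with unequal steps: the first-order terms cancel, and the
  cubic Taylor remainders of the sine, divided by the steps, are left as the error.\<close>

lemma second_difference:
  fixes A p q :: real
  assumes p: "p > 0" and q: "q > 0"
  shows "\<bar>(sin A - sin (A + p)) / p + (sin A - sin (A - q)) / q - (p + q) / 2 * sin A\<bar> \<le> p\<^sup>2 + q\<^sup>2"
proof -
  define e1 where "e1 = sin (A + p) - sin A - p * cos A + p\<^sup>2 / 2 * sin A"
  define e2 where "e2 = sin (A - q) - sin A + q * cos A + q\<^sup>2 / 2 * sin A"
  have e: "\<bar>e1\<bar> \<le> p ^ 3" "\<bar>e2\<bar> \<le> q ^ 3"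
    using sin_remainder_3[of A p] sin_remainder_3[of A "- q"] p q by (simp_all add: e1_def e2_def)
  have "(sin A - sin (A + p)) / p + (sin A - sin (A - q)) / q - (p + q) / 2 * sin A = - (e1 / p) - e2 / q"
    using p q by (simp add: e1_def e2_def field_simps power2_eq_square)
  also have "\<bar>\<dots>\<bar> \<le> \<bar>e1\<bar> / p + \<bar>e2\<bar> / q"
    using abs_triangle_ineq4[of "- (e1 / p)" "e2 / q"] p q by simp
  also have "\<dots> \<le> p ^ 3 / p + q ^ 3 / q" using e p q by (intro add_mono divide_right_mono) auto
  also have "\<dots> = p\<^sup>2 + q\<^sup>2" using p q by (simp add: power3_eq_cube power2_eq_square)
  finally show ?thesis .
qed

section \<open>The interpolant of the first eigenfunction\<close>

context mesh begin

lemma mesh_ends: "mesh_x J 0 = 0" "mesh_x J (7 * J) = 1" "mesh_y J 0 = 0" "mesh_y J (4 * J) = 1"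
  using idx_eqI[of "(mesh_x J (7 * J), mesh_y J (4 * J))" "(1, 1)"] idx_eqI[of "(mesh_x J 0, mesh_y J 0)" "(0, 0)"]
  by (simp_all add: idx_x_mesh idx_y_mesh idx_ends)

text \<open>The interpolant of the first eigenfunction; it is the test function \<open>\<theta>\<close> of the argument at the beginning.\<close>

definition chi :: "real \<times> real \<Rightarrow> real" where
  "chi = (\<lambda>p. \<Sum>z\<in>interior_vertices J. phi1 z * nodal_basis J z p)"

lemma chi_mem: "chi \<in> S_space J"
  unfolding chi_def by (rule S_comb[OF finite_interior_vertices subset_refl])

lemma node_val_chi:
  assumes "j \<le> 7 * J" "m \<le> 4 * J"
  shows "node_val J chi (j, m) = phi1 (mesh_x J j, mesh_y J m)"
proof (cases "0 < j \<and> j < 7 * J \<and> 0 < m \<and> m < 4 * J")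
  case True
  then have "mesh_pt J j m \<in> interior_vertices J" unfolding interior_vertices_eq by force
  then show ?thesis
    unfolding chi_def node_val_def by (simp add: S_comb_node[OF finite_interior_vertices subset_refl] mesh_pt_def)
next
  case False
  then have "j = 0 \<or> j = 7 * J \<or> m = 0 \<or> m = 4 * J" using assms by auto
  then have "phi1 (mesh_x J j, mesh_y J m) = 0" by (auto simp: phi1_eq mesh_ends)
  then show ?thesis using node_val_boundary[OF chi_mem, of "(j, m)"] False by simp
qed

text \<open>With \<open>z\<close> the value of the eigenfunction at the node, both the stiffness stencil divided by \<open>2 pi^2\<close> and the lumped
  stencil equal \<open>(a + b) h / 2 * z\<close> up to order \<open>h^3\<close>. For the stiffness stencil this holds also at the
  interface by \<open>second_difference\<close>; for the lumped stencil it only needs that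
  neighbouring values differ by \<open>O(h)\<close>.\<close>

lemma residual_bound:
  assumes "Suc (Suc j) \<le> 7 * J" "Suc (Suc m) \<le> 4 * J"
  shows "\<bar>2 * pi\<^sup>2 * stencil (\<lambda>k i. double_area J k * lump_coef (corner_val J chi k) i) (Suc j) (Suc m)
     - stencil (\<lambda>k i. double_area J k * grad_coef J k (corner_val J chi k) i) (Suc j) (Suc m)\<bar> \<le> 12 * pi ^ 3 * mesh_size J ^ 3"
proof -
  define a b h where "a = cell_width J j" and "b = cell_width J (Suc j)" and "h = mesh_size J"
  define x y where "x = mesh_x J (Suc j)" and "y = mesh_y J (Suc m)"
  have pos: "a > 0" "b > 0" "h > 0" unfolding a_def b_def h_def by (rule cell_width_pos h_pos)+
  have le: "a \<le> h" "b \<le> h" using h_pos unfolding a_def b_def h_def by (auto simp: cell_width)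
  have X: "mesh_x J (Suc (Suc j)) = x + b" "mesh_x J j = x - a"
    by (simp_all add: x_def a_def b_def cell_width_def)
  have Y: "mesh_y J (Suc (Suc m)) = y + h" "mesh_y J m = y - h"
    by (simp_all add: y_def h_def mesh_y_def algebra_simps)
  define P where "P = (\<lambda>p q. phi1 (x + p, y + q))"
  define z where "z = phi1 (x, y)"
  have v: "node_val J chi (Suc j, Suc m) = z" "node_val J chi (Suc (Suc j), Suc m) = P b 0" "node_val J chi (j, Suc m) = P (- a) 0"
    "node_val J chi (Suc j, Suc (Suc m)) = P 0 h" "node_val J chi (Suc j, m) = P 0 (- h)"
    "node_val J chi (Suc (Suc j), m) = P b (- h)" "node_val J chi (j, Suc (Suc m)) = P (- a) h"
    using assms by (simp_all add: node_val_chi X Y P_def z_def x_def[symmetric] y_def[symmetric])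
  have near: "\<bar>P p q - z\<bar> \<le> 4 * pi * h" if "\<bar>p\<bar> \<le> h" "\<bar>q\<bar> \<le> h" for p q
    unfolding P_def z_def by (rule phi1_diff[OF that])
  define LS where "LS = stencil (\<lambda>k i. double_area J k * lump_coef (corner_val J chi k) i) (Suc j) (Suc m)"
  define GS where "GS = stencil (\<lambda>k i. double_area J k * grad_coef J k (corner_val J chi k) i) (Suc j) (Suc m)"
  define lb where "lb = 2 * (P b 0 - z) + 2 * (P b (- h) - z) + (P 0 h - z) + (P 0 (- h) - z)"
  define la where "la = 2 * (P (- a) 0 - z) + 2 * (P (- a) h - z) + (P 0 h - z) + (P 0 (- h) - z)"
  have LS: "LS - (a + b) * h / 2 * z = 7 * h / 216 * (b * lb + a * la)"
    unfolding LS_def lump_stencil v a_def[symmetric] b_def[symmetric] h_def[symmetric] lb_def la_def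
    by (simp add: field_simps)
  have lab: "\<bar>lb\<bar> \<le> 24 * pi * h" "\<bar>la\<bar> \<le> 24 * pi * h"
    unfolding lb_def la_def
    using near[of b 0] near[of b "- h"] near[of 0 h] near[of 0 "- h"] near[of "- a" 0] near[of "- a" h] pos le
    unfolding abs_le_iff by (simp; linarith)+
  have "\<bar>b * lb + a * la\<bar> \<le> \<bar>b * lb\<bar> + \<bar>a * la\<bar>" by (rule abs_triangle_ineq)
  also have "\<dots> \<le> h * (24 * pi * h) + h * (24 * pi * h)"
    unfolding abs_mult using lab pos le by (intro add_mono mult_mono) auto
  finally have "7 * h / 216 * \<bar>b * lb + a * la\<bar> \<le> 7 * h / 216 * (48 * pi * h\<^sup>2)"
    using pos by (intro mult_left_mono) (auto simp: power2_eq_square)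
  also have "\<dots> \<le> 2 * pi * h ^ 3"
    using pos by (simp add: power2_eq_square power3_eq_cube)
  finally have LSb: "\<bar>LS - (a + b) * h / 2 * z\<bar> \<le> 2 * pi * h ^ 3"
    unfolding LS using pos by (simp add: abs_mult)
  define dx where "dx = (sin (pi * x) - sin (pi * x + pi * b)) / (pi * b) + (sin (pi * x) - sin (pi * x - pi * a)) / (pi * a)
      - (pi * b + pi * a) / 2 * sin (pi * x)"
  define dy where "dy = (sin (pi * y) - sin (pi * y + pi * h)) / (pi * h) + (sin (pi * y) - sin (pi * y - pi * h)) / (pi * h)
      - (pi * h + pi * h) / 2 * sin (pi * y)"
  have dx: "\<bar>dx\<bar> \<le> 2 * pi\<^sup>2 * h\<^sup>2"
  proof -
    have "\<bar>dx\<bar> \<le> (pi * b)\<^sup>2 + (pi * a)\<^sup>2"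
      unfolding dx_def by (rule second_difference) (use pos in auto)
    also have "\<dots> \<le> (pi * h)\<^sup>2 + (pi * h)\<^sup>2"
      using pos le by (intro add_mono power_mono mult_left_mono) auto
    finally show ?thesis by (simp add: power_mult_distrib)
  qed
  have dy: "\<bar>dy\<bar> \<le> 2 * pi\<^sup>2 * h\<^sup>2"
  proof -
    have "\<bar>dy\<bar> \<le> (pi * h)\<^sup>2 + (pi * h)\<^sup>2"
      unfolding dy_def by (rule second_difference) (use pos in auto)
    then show ?thesis by (simp add: power_mult_distrib)
  qed
  have GS: "GS - 2 * pi\<^sup>2 * ((a + b) * h / 2 * z) = 2 * pi * h * sin (pi * y) * dx + pi * (a + b) * sin (pi * x) * dy"
  proof -
    have "2 * pi * h * sin (pi * y) * dx = h / b * (z - P b 0) + h / a * (z - P (- a) 0) - pi\<^sup>2 * ((a + b) * h / 2 * z)"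
      unfolding dx_def z_def P_def phi1_eq using pos
      by (simp add: field_simps power2_eq_square)
    moreover have "pi * (a + b) * sin (pi * x) * dy = (a + b) / (2 * h) * (2 * z - P 0 h - P 0 (- h)) - pi\<^sup>2 * ((a + b) * h / 2 * z)"
      unfolding dy_def z_def P_def phi1_eq using pos
      by (simp add: field_simps power2_eq_square)
    ultimately show ?thesis
      unfolding GS_def grad_stencil v a_def[symmetric] b_def[symmetric] h_def[symmetric] by simp
  qed
  have "\<bar>2 * pi * h * sin (pi * y) * dx + pi * (a + b) * sin (pi * x) * dy\<bar>
     \<le> \<bar>2 * pi * h * sin (pi * y) * dx\<bar> + \<bar>pi * (a + b) * sin (pi * x) * dy\<bar>" by (rule abs_triangle_ineq)
  also have "\<dots> = 2 * pi * h * \<bar>sin (pi * y)\<bar> * \<bar>dx\<bar> + pi * (a + b) * \<bar>sin (pi * x)\<bar> * \<bar>dy\<bar>"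
    using pos by (simp add: abs_mult)
  also have "\<dots> \<le> 2 * pi * h * 1 * (2 * pi\<^sup>2 * h\<^sup>2) + pi * (h + h) * 1 * (2 * pi\<^sup>2 * h\<^sup>2)"
    using pos le dx dy by (intro add_mono mult_mono) auto
  also have "\<dots> = 8 * pi ^ 3 * h ^ 3" by (simp add: power2_eq_square power3_eq_cube)
  finally have GSb: "\<bar>GS - 2 * pi\<^sup>2 * ((a + b) * h / 2 * z)\<bar> \<le> 8 * pi ^ 3 * h ^ 3" unfolding GS .
  have "2 * pi\<^sup>2 * \<bar>LS - (a + b) * h / 2 * z\<bar> \<le> 2 * pi\<^sup>2 * (2 * pi * h ^ 3)"
    by (intro mult_left_mono LSb) auto
  then have "\<bar>2 * pi\<^sup>2 * (LS - (a + b) * h / 2 * z)\<bar> \<le> 4 * pi ^ 3 * h ^ 3"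
    by (simp add: abs_mult power2_eq_square power3_eq_cube)
  moreover have "2 * pi\<^sup>2 * LS - GS = 2 * pi\<^sup>2 * (LS - (a + b) * h / 2 * z) - (GS - 2 * pi\<^sup>2 * ((a + b) * h / 2 * z))"
    by (simp add: algebra_simps)
  ultimately have "\<bar>2 * pi\<^sup>2 * LS - GS\<bar> \<le> 12 * pi ^ 3 * h ^ 3" using GSb by linarith
  then show ?thesis unfolding LS_def GS_def h_def .
qed

text \<open>The source of the lower bound. Let \<open>X\<close> and \<open>Y\<close> be the partial derivatives of the eigenfunction at a node on the interface.
  The first-order part of the defect from the three triangles on the left is \<open>h^3/108 (4X - 2Y)\<close>, and from the
  three on the right \<open>h^3/216 (-2X + 2Y)\<close>. The sum is \<open>h^3/108 (3X - Y)\<close>; with equal cells on both sides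
  the corresponding terms cancel.\<close>

lemma defect_stencil_ge:
  assumes m: "0 < m" "m < 4 * J" and g: "grad phi1 (1/4, mesh_y J m) \<bullet> (3, -1) \<ge> 1"
  shows "stencil (\<lambda>k i. double_area J k * defect_coef (corner_val J chi k) i) J m \<ge> mesh_size J ^ 3 / 108 * (1 - 54 * pi\<^sup>2 * mesh_size J)"
proof -
  obtain j where j: "J = Suc j" using J_pos by (cases J) auto
  obtain m' where m': "m = Suc m'" using m by (cases m) auto
  define h where "h = mesh_size J"
  have pos: "h > 0" unfolding h_def by (rule h_pos)
  have jJ: "j < J" "\<not> Suc j < J" using j by auto
  have a: "cell_width J j = h" and b: "cell_width J (Suc j) = h / 2"
    using jJ by (auto simp: cell_width h_def)
  define x y where "x = mesh_x J (Suc j)" and "y = mesh_y J (Suc m')"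
  have x: "x = 1/4" using real_J_pos by (simp add: x_def j[symmetric] mesh_x_def mesh_size_def)
  have X: "mesh_x J (Suc (Suc j)) = x + h / 2" "mesh_x J j = x - h"
    using a b by (simp_all add: x_def cell_width_def)
  have Y: "mesh_y J (Suc (Suc m')) = y + h" "mesh_y J m' = y - h"
    by (simp_all add: y_def h_def mesh_y_def algebra_simps)
  define P where "P = (\<lambda>p q. phi1 (x + p, y + q))"
  define z where "z = phi1 (x, y)"
  have jm: "Suc (Suc j) \<le> 7 * J" "Suc (Suc m') \<le> 4 * J" using m m' j by auto
  have v: "node_val J chi (Suc j, Suc m') = z" "node_val J chi (Suc (Suc j), Suc m') = P (h / 2) 0" "node_val J chi (j, Suc m') = P (- h) 0"
    "node_val J chi (Suc j, Suc (Suc m')) = P 0 h" "node_val J chi (Suc j, m') = P 0 (- h)"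
    "node_val J chi (Suc (Suc j), m') = P (h / 2) (- h)" "node_val J chi (j, Suc (Suc m')) = P (- h) h"
    using jm by (simp_all add: node_val_chi X Y P_def z_def x_def[symmetric] y_def[symmetric])
  obtain gx gy where G: "grad phi1 (x, y) = (gx, gy)" by (cases "grad phi1 (x, y)")
  define R where "R = (\<lambda>p q. P p q - z - (p * gx + q * gy))"
  define K where "K = 6 * pi\<^sup>2 * h\<^sup>2"
  have R: "\<bar>R p q\<bar> \<le> K" if "\<bar>p\<bar> \<le> h" "\<bar>q\<bar> \<le> h" for p q
    using phi1_taylor[OF that, of x y] by (simp add: R_def P_def z_def K_def G inner_prod_def)
  have P: "P p q = z + p * gx + q * gy + R p q" for p q by (simp add: R_def)
  define eb where "eb = 2 * R (h / 2) 0 + 2 * R (h / 2) (- h) + R 0 h + R 0 (- h)"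
  define ea where "ea = 2 * R (- h) 0 + 2 * R (- h) h + R 0 h + R 0 (- h)"
  have S: "stencil (\<lambda>k i. double_area J k * defect_coef (corner_val J chi k) i) (Suc j) (Suc m')
     = h / 108 * (h\<^sup>2 * (3 * gx - gy) - (h / 2 * eb + h * ea))"
    unfolding defect_stencil_eq v a b h_def[symmetric] P eb_def ea_def
    by (simp add: field_simps power2_eq_square)
  have e: "\<bar>eb\<bar> \<le> 6 * K" "\<bar>ea\<bar> \<le> 6 * K"
    unfolding eb_def ea_def
    using R[of "h / 2" 0] R[of "h / 2" "- h"] R[of 0 h] R[of 0 "- h"] R[of "- h" 0] R[of "- h" h] pos
    unfolding abs_le_iff by (simp; linarith)+
  have "h / 2 * eb + h * ea \<le> h / 2 * (6 * K) + h * (6 * K)"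
    using e pos by (intro add_mono mult_left_mono) auto
  also have "\<dots> = 54 * pi\<^sup>2 * h ^ 3" by (simp add: K_def power2_eq_square power3_eq_cube)
  finally have E: "h / 2 * eb + h * ea \<le> 54 * pi\<^sup>2 * h ^ 3" .
  have "3 * gx - gy \<ge> 1" using g G by (simp add: x[symmetric] y_def m' inner_prod_def mult.commute)
  then have "h\<^sup>2 * 1 \<le> h\<^sup>2 * (3 * gx - gy)" by (intro mult_left_mono) auto
  then have "h\<^sup>2 - 54 * pi\<^sup>2 * h ^ 3 \<le> h\<^sup>2 * (3 * gx - gy) - (h / 2 * eb + h * ea)" using E by linarith
  then have "h / 108 * (h\<^sup>2 - 54 * pi\<^sup>2 * h ^ 3) \<le> h / 108 * (h\<^sup>2 * (3 * gx - gy) - (h / 2 * eb + h * ea))"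
    using pos by (intro mult_left_mono) auto
  moreover have "h / 108 * (h\<^sup>2 - 54 * pi\<^sup>2 * h ^ 3) = h ^ 3 / 108 * (1 - 54 * pi\<^sup>2 * h)"
    by (simp add: power2_eq_square power3_eq_cube algebra_simps)
  ultimately show ?thesis
    unfolding S[symmetric] h_def[symmetric] j[symmetric] m'[symmetric] by simp
qed

lemma J_mesh_size: "real J * mesh_size J = 1 / 4" using real_J_pos by (simp add: mesh_size_def)

lemma mesh_x_J: "mesh_x J J = 1 / 4" using real_J_pos by (simp add: mesh_x_def mesh_size_def)

lemma chi_energy: "lumped_inner J chi chi \<le> 7"
proof -
  have c: "\<bar>node_val J chi q\<bar> \<le> 2" if "fst q \<le> 7 * J" "snd q \<le> 4 * J" for q
  proof -
    have "\<bar>sin (pi * mesh_x J (fst q))\<bar> * \<bar>sin (pi * mesh_y J (snd q))\<bar> \<le> 1 * 1" by (intro mult_mono) auto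
    then show ?thesis using node_val_chi[OF that] by (simp add: phi1_eq abs_mult)
  qed
  have l: "double_area J k * lump_loc (corner_val J chi k) (corner_val J chi k) \<le> (mesh_size J)\<^sup>2 * 2" if k: "k \<in> triangles J" for k
  proof -
    have "(corner_val J chi k i)\<^sup>2 \<le> 2\<^sup>2" for i
      unfolding corner_val_def using c[OF corner_index_range[OF k]] by (simp only: abs_le_square_iff[symmetric]) simp
    then have "1 / 6 * ((corner_val J chi k 0)\<^sup>2 + (corner_val J chi k 1)\<^sup>2 + (corner_val J chi k 2)\<^sup>2) \<le> 1 / 6 * (2\<^sup>2 + 2\<^sup>2 + 2\<^sup>2)"
      by (intro mult_left_mono add_mono) auto
    then have "lump_loc (corner_val J chi k) (corner_val J chi k) \<le> 2" using lump_loc_upper[of "corner_val J chi k"] by simp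
    then show ?thesis
      using double_area_le[of k] double_area_pos[of k]
      by (intro mult_mono) (auto intro: order.trans[OF _ lump_loc_lower])
  qed
  have "lumped_inner J chi chi \<le> (\<Sum>k\<in>triangles J. (mesh_size J)\<^sup>2 * 2)"
    unfolding lumped_formula[OF chi_mem chi_mem] by (intro sum_mono l)
  also have "\<dots> = 112 * (real J * mesh_size J)\<^sup>2"
    by (simp add: triangles_def card_cartesian_product power2_eq_square)
  also have "\<dots> = 7" unfolding J_mesh_size by (simp add: power2_eq_square)
  finally show ?thesis .
qed

text \<open>Duality. The factor \<open>5/3\<close> compares the lumped form with the \<open>L2\<close> product on each triangle, and \<open>\<nu>/7\<close> is the weight in
  Young's inequality that leaves half of \<open>\<nu>\<close> on the left, given \<open>chi_energy\<close>.\<close>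

lemma norm_lower_bound:
  assumes u: "u \<in> S_space J" and \<nu>: "\<nu> > 0" "\<bar>lumped_inner J u chi\<bar> \<ge> \<nu>"
  shows "l2_norm u \<ge> \<nu> / 4"
proof -
  let ?N = "l2_inner u u"
  have N: "lumped_inner J u u \<le> 5 / 3 * ?N"
    unfolding lumped_formula[OF u u] l2_formula[OF u u] sum_distrib_left
  proof (rule sum_mono)
    fix k show "double_area J k * lump_loc (corner_val J u k) (corner_val J u k) \<le> 5 / 3 * (double_area J k * mass_loc (corner_val J u k) (corner_val J u k))"
      using mult_left_mono[OF lump_loc_le_mass[of "corner_val J u k"] less_imp_le[OF double_area_pos[of k]]] by simp
  qed
  have "\<bar>lumped_inner J u chi\<bar> \<le> (\<nu> / 7) / 2 * lumped_inner J chi chi + lumped_inner J u u / (2 * (\<nu> / 7))"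
    by (rule FS.semi_inner_weighted[OF GF.semi_inner_m u chi_mem]) (use \<nu> in simp)
  also have "\<dots> \<le> (\<nu> / 7) / 2 * 7 + (5 / 3 * ?N) / (2 * (\<nu> / 7))"
    using N chi_energy \<nu> by (intro add_mono mult_left_mono divide_right_mono) auto
  finally have "\<nu> \<le> (\<nu> / 7) / 2 * 7 + (5 / 3 * ?N) / (2 * (\<nu> / 7))" using \<nu>(2) by linarith
  also have "\<dots> = \<nu> / 2 + 35 / 6 * ?N / \<nu>" by simp
  finally have "\<nu> / 2 \<le> 35 / 6 * ?N / \<nu>" by simp
  then have "\<nu> / 2 * \<nu> \<le> 35 / 6 * ?N / \<nu> * \<nu>" using \<nu> by (intro mult_right_mono) auto
  then have "\<nu>\<^sup>2 \<le> 35 / 3 * ?N" using \<nu> by (simp add: power2_eq_square)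
  then have "\<nu>\<^sup>2 / 16 \<le> ?N" using zero_le_power2[of \<nu>] by linarith
  then have "(\<nu> / 4)\<^sup>2 \<le> ?N" by (simp add: power_divide)
  then show ?thesis unfolding l2_norm_def by (rule real_le_rsqrt)
qed

text \<open>The function \<open>\<rho>\<close> represents the residual functional of \<open>chi\<close>, whose coefficient at each node is \<open>O(h^3)\<close>. As \<open>m\<close> dominates
  \<open>h^2\<close> times the sum of the squared nodal values, its norm squared is bounded by \<open>h^(-2)\<close> times the sum
  of \<open>h^6\<close> over the \<open>O(h^(-2))\<close> nodes.\<close>

lemma residual_energy:
  assumes \<rho>: "\<rho> \<in> S_space J"
    and res: "lumped_inner J \<rho> \<rho> = - grad_inner chi \<rho> + 2 * pi\<^sup>2 * lumped_inner J chi \<rho>"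
  shows "lumped_inner J \<rho> \<rho> \<le> 7560 * pi ^ 6 * (mesh_size J)\<^sup>2"
proof -
  define h where "h = mesh_size J"
  have h: "h > 0" unfolding h_def by (rule h_pos)
  define e where "e = (\<lambda>j m. node_val J \<rho> (j, m))"
  define r where "r = (\<lambda>j m. 2 * pi\<^sup>2 * stencil (\<lambda>k i. double_area J k * lump_coef (corner_val J chi k) i) j m
     - stencil (\<lambda>k i. double_area J k * grad_coef J k (corner_val J chi k) i) j m)"
  define R where "R = 12 * pi ^ 3 * h ^ 3"
  \<comment> \<open>slightly below \<open>h^2/2 * 15/216\<close>, the product of the bounds in \<open>double_area_ge\<close> and \<open>lump_loc_lower\<close>\<close>
  define \<kappa> where "\<kappa> = h\<^sup>2 / 30"
  have \<kappa>: "\<kappa> > 0" using h by (simp add: \<kappa>_def)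
  have m: "lumped_inner J \<rho> \<rho> = (\<Sum>j<7*J. \<Sum>m<4*J. e j m * r j m)"
  proof -
    have g: "grad_inner chi \<rho> = (\<Sum>j<7*J. \<Sum>m<4*J. e j m * stencil (\<lambda>k i. double_area J k * grad_coef J k (corner_val J chi k) i) j m)"
      unfolding grad_formula[OF chi_mem \<rho>] grad_loc_coef e_def
      by (subst assembly[OF \<rho>, symmetric]) (simp add: algebra_simps)
    have l: "lumped_inner J chi \<rho> = (\<Sum>j<7*J. \<Sum>m<4*J. e j m * stencil (\<lambda>k i. double_area J k * lump_coef (corner_val J chi k) i) j m)"
      unfolding lumped_formula[OF chi_mem \<rho>] lump_loc_coef e_def
      by (subst assembly[OF \<rho>, symmetric]) (simp add: algebra_simps)
    show ?thesis unfolding res g l r_def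
      by (simp add: sum_distrib_left sum_subtractf[symmetric] algebra_simps)
  qed
  have node: "e j m * r j m \<le> \<kappa> / 2 * (e j m)\<^sup>2 + R\<^sup>2 / (2 * \<kappa>)" if jm: "j < 7 * J" "m < 4 * J" for j m
  proof (cases "j = 0 \<or> m = 0")
    case True
    then have "e j m = 0" using node_val_boundary[OF \<rho>, of "(j, m)"] by (auto simp: e_def)
    then show ?thesis using \<kappa> by simp
  next
    case False
    then obtain j' m' where j': "j = Suc j'" "m = Suc m'" by (metis not0_implies_Suc)
    have "\<bar>r j m\<bar> \<le> R" using residual_bound[of j' m'] jm by (simp add: r_def R_def j' h_def)
    then have "(r j m)\<^sup>2 \<le> R\<^sup>2" using abs_le_square_iff[of "r j m" R] by simp
    then have "(r j m)\<^sup>2 / (2 * \<kappa>) \<le> R\<^sup>2 / (2 * \<kappa>)" using \<kappa> by (intro divide_right_mono) auto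
    moreover have "e j m * r j m \<le> \<kappa> / 2 * (e j m)\<^sup>2 + (r j m)\<^sup>2 / (2 * \<kappa>)"
    proof -
      have "0 \<le> (\<kappa> * e j m - r j m)\<^sup>2 / (2 * \<kappa>)" using \<kappa> by simp
      also have "\<dots> = \<kappa> / 2 * (e j m)\<^sup>2 + (r j m)\<^sup>2 / (2 * \<kappa>) - e j m * r j m"
        using \<kappa> by (simp add: power2_eq_square field_simps)
      finally show ?thesis by simp
    qed
    ultimately show ?thesis by linarith
  qed
  have coer: "\<kappa> * (\<Sum>j<7*J. \<Sum>m<4*J. (e j m)\<^sup>2) \<le> lumped_inner J \<rho> \<rho>"
    unfolding lumped_formula[OF \<rho> \<rho>] sum_triangles sum_distrib_left
  proof (intro sum_mono)
    fix j m
    have "15 / 216 * (e j m)\<^sup>2 \<le> 15 / 216 * ((corner_val J \<rho> (j, m, False) 0)\<^sup>2 + (corner_val J \<rho> (j, m, False) 1)\<^sup>2 + (corner_val J \<rho> (j, m, False) 2)\<^sup>2)"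
      by (intro mult_left_mono) (auto simp: corner_val_def e_def)
    also note lump_loc_lower
    finally have "h\<^sup>2 / 2 * (15 / 216 * (e j m)\<^sup>2) \<le> double_area J (j, m, False) * lump_loc (corner_val J \<rho> (j, m, False)) (corner_val J \<rho> (j, m, False))"
      using double_area_ge[of "(j, m, False)"] double_area_pos by (intro mult_mono) (auto simp: h_def less_imp_le)
    moreover have "\<kappa> * (e j m)\<^sup>2 \<le> h\<^sup>2 / 2 * (15 / 216 * (e j m)\<^sup>2)"
      using mult_nonneg_nonneg[OF zero_le_power2[of h] zero_le_power2[of "e j m"]] by (simp add: \<kappa>_def)
    moreover have "0 \<le> double_area J (j, m, True) * lump_loc (corner_val J \<rho> (j, m, True)) (corner_val J \<rho> (j, m, True))"
      using double_area_pos by (intro mult_nonneg_nonneg) (auto intro: less_imp_le order.trans[OF _ lump_loc_lower])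
    ultimately show "\<kappa> * (e j m)\<^sup>2 \<le> double_area J (j, m, False) * lump_loc (corner_val J \<rho> (j, m, False)) (corner_val J \<rho> (j, m, False)) +
       double_area J (j, m, True) * lump_loc (corner_val J \<rho> (j, m, True)) (corner_val J \<rho> (j, m, True))" by linarith
  qed
  have "lumped_inner J \<rho> \<rho> \<le> (\<Sum>j<7*J. \<Sum>m<4*J. \<kappa> / 2 * (e j m)\<^sup>2 + R\<^sup>2 / (2 * \<kappa>))"
    unfolding m by (intro sum_mono node) auto
  also have "\<dots> = \<kappa> * (\<Sum>j<7*J. \<Sum>m<4*J. (e j m)\<^sup>2) / 2 + 28 * (real J)\<^sup>2 * (R\<^sup>2 / (2 * \<kappa>))"
    by (simp add: sum.distrib sum_distrib_left sum_divide_distrib power2_eq_square)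
  also have "28 * (real J)\<^sup>2 * (R\<^sup>2 / (2 * \<kappa>)) = 3780 * pi ^ 6 * h\<^sup>2"
  proof -
    have Jh: "real J = 1 / (4 * h)" using real_J_pos by (simp add: h_def mesh_size_def)
    show ?thesis unfolding Jh R_def \<kappa>_def using h
      by (simp add: power_mult_distrib power_divide field_simps eval_nat_numeral)
  qed
  finally show ?thesis using coer unfolding h_def by linarith
qed

text \<open>The two columns of cells next to the interface have \<open>2 * 4J * 2\<close> triangles; every element quantity that involves \<open>v\<close>
  is supported there.\<close>

lemma column_sum:
  assumes "\<And>k. k \<in> triangles J \<Longrightarrow> F k \<le> (if fst k \<in> {J - 1, J} then C else 0)" "0 \<le> C"
  shows "(\<Sum>k\<in>triangles J. F k) \<le> 16 * real J * C"
proof -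
  let ?K = "{J - 1, J} \<times> {..<4 * J} \<times> (UNIV :: bool set)"
  have "(\<Sum>k\<in>triangles J. F k) \<le> (\<Sum>k\<in>triangles J. if fst k \<in> {J - 1, J} then C else 0)"
    by (intro sum_mono assms)
  also have "\<dots> = (\<Sum>k\<in>triangles J \<inter> {k. fst k \<in> {J - 1, J}}. C)"
    unfolding sum.inter_restrict[OF finite_triangles] by simp
  also have "\<dots> \<le> (\<Sum>k\<in>?K. C)"
    using assms(2) by (intro sum_mono2) (auto simp: triangles_def)
  also have "\<dots> = 16 * real J * C"
    using J_pos by (simp add: card_cartesian_product)
  finally show ?thesis .
qed

end

section \<open>The layer of nodal functions on the interface\<close>

locale mesh_square = mesh +
  fixes d :: real
  assumes d: "0 < d" "d < 1/4"
begin

definition v :: "real \<times> real \<Rightarrow> real" where "v = v_fun J d"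

lemma P_vertices_iff: "mesh_pt J j m \<in> P_vertices J d \<longleftrightarrow> j = J \<and> \<bar>mesh_y J m - 1/4\<bar> \<le> d"
proof -
  have "m \<le> 4 * J" if "\<bar>mesh_y J m - 1/4\<bar> \<le> d"
  proof -
    have "mesh_y J m < 1" using that d by linarith
    then have "mesh_size J * real m < mesh_size J * real (4 * J)"
      using J_mesh_size by (simp add: mesh_y_def mult.commute)
    then show ?thesis using h_pos by simp
  qed
  moreover have "mesh_pt J J m \<in> square d \<longleftrightarrow> \<bar>mesh_y J m - 1/4\<bar> \<le> d"
    using d by (auto simp: square_def mesh_pt_def mesh_x_J)
  ultimately show ?thesis unfolding P_vertices_def by (auto simp: mesh_pt_inj)
qed

lemma P_vertices_range:
  assumes "\<bar>mesh_y J m - 1/4\<bar> \<le> d" shows "0 < m" "m < 4 * J"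
proof -
  have y: "0 < mesh_y J m" "mesh_y J m < 1" using assms d by linarith+
  then show "0 < m" by (cases m) (auto simp: mesh_y_def)
  have "mesh_size J * real m < mesh_size J * real (4 * J)"
    using y J_mesh_size by (simp add: mesh_y_def mult.commute)
  then show "m < 4 * J" using h_pos by simp
qed

lemma P_vertices_interior: "P_vertices J d \<subseteq> interior_vertices J"
proof
  fix z assume z: "z \<in> P_vertices J d"
  then obtain m where m: "z = mesh_pt J J m" by (auto simp: P_vertices_def)
  then have "0 < m" "m < 4 * J" using z P_vertices_iff P_vertices_range by auto
  then show "z \<in> interior_vertices J" unfolding interior_vertices_eq using J_pos by (force simp: m)
qed

lemma v_eq: "v = (\<lambda>p. \<Sum>z\<in>P_vertices J d. 1 * nodal_basis J z p)"
  by (simp add: v_def v_fun_def)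

lemma finite_P: "finite (P_vertices J d)"
  by (rule finite_subset[OF P_vertices_interior finite_interior_vertices])

lemma v_mem: "v \<in> S_space J"
  unfolding v_eq by (rule S_comb[OF finite_P P_vertices_interior])

lemma node_val_v: "node_val J v (j, m) = of_bool (j = J \<and> \<bar>mesh_y J m - 1/4\<bar> \<le> d)"
proof (cases "0 < j \<and> j < 7 * J \<and> 0 < m \<and> m < 4 * J")
  case True
  then have "mesh_pt J j m \<in> interior_vertices J" unfolding interior_vertices_eq by force
  then show ?thesis
    unfolding v_eq node_val_def fst_conv snd_conv by (subst S_comb_node[OF finite_P P_vertices_interior]) (auto simp: P_vertices_iff)
next
  case False
  then show ?thesis using node_val_boundary[OF v_mem, of "(j, m)"] P_vertices_range[of m] J_pos by auto
qed

lemma corner_val_v: "corner_val J v k i \<in> {0, 1}" "fst k \<notin> {J - 1, J} \<Longrightarrow> corner_val J v k i = 0"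
proof -
  show "corner_val J v k i \<in> {0, 1}" unfolding corner_val_def by (cases "corner_index i k") (simp add: node_val_v)
  obtain j m u where k: "k = (j, m, u)" by (cases k)
  assume "fst k \<notin> {J - 1, J}"
  then have "fst (corner_index i k) \<noteq> J" using J_pos by (auto simp: k)
  then show "corner_val J v k i = 0" unfolding corner_val_def by (cases "corner_index i k") (simp add: node_val_v)
qed

lemma v_norm: "l2_norm v \<le> sqrt (2 * mesh_size J)"
proof -
  have "l2_inner v v \<le> 16 * real J * ((mesh_size J)\<^sup>2 * (1 / 2))"
    unfolding l2_formula[OF v_mem v_mem]
  proof (rule column_sum)
    fix k
    show "double_area J k * mass_loc (corner_val J v k) (corner_val J v k) \<le> (if fst k \<in> {J - 1, J} then (mesh_size J)\<^sup>2 * (1 / 2) else 0)"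
    proof (cases "fst k \<in> {J - 1, J}")
      case True
      have "mass_loc (corner_val J v k) (corner_val J v k) \<le> 1 / 2" "0 \<le> mass_loc (corner_val J v k) (corner_val J v k)"
        using corner_val_v(1)[of k 0] corner_val_v(1)[of k 1] corner_val_v(1)[of k 2] by (auto simp: mass_loc_def)
      then have "double_area J k * mass_loc (corner_val J v k) (corner_val J v k) \<le> (mesh_size J)\<^sup>2 * (1 / 2)"
        using double_area_le[of k] by (intro mult_mono) auto
      then show ?thesis by (simp only: True if_True)
    next
      case False
      then show ?thesis using corner_val_v(2)[OF False] by (simp add: mass_loc_def)
    qed
  qed simp
  also have "\<dots> = 2 * mesh_size J" using J_mesh_size by (simp add: power2_eq_square algebra_simps)
  finally show ?thesis unfolding l2_norm_def by (rule real_sqrt_le_mono)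
qed

text \<open>The energy of \<open>Q v\<close> is its defect against \<open>v\<close>. On each triangle near the interface half of the energy absorbs the
  gradient of \<open>q\<close>, and what is left is of order \<open>h^4\<close>, on \<open>O(1/h)\<close> triangles.\<close>

lemma Q_energy:
  assumes q: "q \<in> S_space J" and eq: "grad_inner q q = l2_inner v (J_op J q) - l2_inner v q"
  shows "grad_inner q q \<le> mesh_size J ^ 3"
proof -
  define h where "h = mesh_size J"
  have h: "h > 0" unfolding h_def by (rule h_pos)
  \<comment> \<open>Young's inequality, with the constants that leave half of the energy below\<close>
  have pq: "\<bar>x\<bar> / 54 \<le> x\<^sup>2 / (4 * h\<^sup>2) + h\<^sup>2 / 2916" for x
  proof -
    have "0 \<le> (\<bar>x\<bar> / (2 * h) - h / 54)\<^sup>2" by simp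
    also have "\<dots> = x\<^sup>2 / (4 * h\<^sup>2) + h\<^sup>2 / 2916 - \<bar>x\<bar> / 54"
      using h by (simp add: power2_eq_square field_simps)
    finally show ?thesis by simp
  qed
  have "(\<Sum>k\<in>triangles J. double_area J k * defect_loc (corner_val J v k) (corner_val J q k) - double_area J k * grad_loc J k (corner_val J q k) (corner_val J q k) / 2)
    \<le> 16 * real J * (h\<^sup>2 * (h\<^sup>2 / 1458))"
  proof (rule column_sum)
    fix k
    let ?c = "corner_val J v k" and ?d = "corner_val J q k"
    show "double_area J k * defect_loc ?c ?d - double_area J k * grad_loc J k ?d ?d / 2
      \<le> (if fst k \<in> {J - 1, J} then h\<^sup>2 * (h\<^sup>2 / 1458) else 0)"
    proof (cases "fst k \<in> {J - 1, J}")
      case True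
      define x y where "x = ?d 1 - ?d 0" and "y = ?d 2 - ?d 0"
      have "defect_loc ?c ?d = ((?c 1 - ?c 0) * x + (?c 2 - ?c 0) * y + (?c 1 - ?c 2) * (x - y)) / 108"
        by (simp add: defect_loc_def x_def y_def algebra_simps)
      also have "\<dots> \<le> (2 * \<bar>x\<bar> + 2 * \<bar>y\<bar>) / 108"
        using corner_val_v(1)[of k 0] corner_val_v(1)[of k 1] corner_val_v(1)[of k 2] by auto
      also have "\<dots> \<le> x\<^sup>2 / (4 * h\<^sup>2) + y\<^sup>2 / (4 * h\<^sup>2) + h\<^sup>2 / 1458"
        using pq[of x] pq[of y] by simp
      also have "x\<^sup>2 / (4 * h\<^sup>2) + y\<^sup>2 / (4 * h\<^sup>2) \<le> grad_loc J k ?d ?d / 2"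
      proof -
        have lx: "(leg_x J k)\<^sup>2 \<le> h\<^sup>2" "(leg_x J k)\<^sup>2 > 0" and ly: "(leg_y J k)\<^sup>2 = h\<^sup>2"
          using h_pos by (cases k; auto simp: cell_width h_def power_divide)+
        have "x\<^sup>2 / h\<^sup>2 \<le> x\<^sup>2 / (leg_x J k)\<^sup>2" using lx h by (intro divide_left_mono mult_pos_pos[OF _ lx(2)]) auto
        then show ?thesis unfolding grad_loc_def x_def[symmetric] y_def[symmetric] ly by (simp add: power2_eq_square)
      qed
      finally have "defect_loc ?c ?d - grad_loc J k ?d ?d / 2 \<le> h\<^sup>2 / 1458" by simp
      then have "double_area J k * (defect_loc ?c ?d - grad_loc J k ?d ?d / 2) \<le> double_area J k * (h\<^sup>2 / 1458)"
        using double_area_pos[of k] by (intro mult_left_mono) auto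
      also have "\<dots> \<le> h\<^sup>2 * (h\<^sup>2 / 1458)" using double_area_le[of k] by (intro mult_right_mono) (auto simp: h_def)
      finally show ?thesis using True by (simp add: algebra_simps)
    next
      case False
      then show ?thesis
        using corner_val_v(2)[OF False] grad_loc_nonneg[of J k ?d] double_area_pos[of k] by (simp add: defect_loc_def)
    qed
  qed simp
  also have "\<dots> = 16 / 1458 * (real J * h) * h ^ 3" by (simp add: power2_eq_square power3_eq_cube)
  also have "\<dots> = 4 / 1458 * h ^ 3" unfolding h_def J_mesh_size by simp
  also have "(\<Sum>k\<in>triangles J. double_area J k * defect_loc (corner_val J v k) (corner_val J q k) - double_area J k * grad_loc J k (corner_val J q k) (corner_val J q k) / 2)
     = grad_inner q q - grad_inner q q / 2"
    unfolding sum_subtractf sum_divide_distrib[symmetric] defect_formula[OF v_mem q, symmetric] grad_formula[OF q q, symmetric]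
    by (simp add: eq)
  finally have "grad_inner q q / 2 \<le> 4 / 1458 * h ^ 3" by simp
  then show ?thesis unfolding h_def[symmetric] using zero_less_power[OF h, of 3] by linarith
qed

text \<open>Every node of \<open>P_vertices\<close> contributes at least \<open>h^3/216\<close>, and the nodes with indices from \<open>J\<close> to \<open>J + N\<close>, those on
  the upper half of the segment, are already at least \<open>4Jd = d/h\<close> in number.\<close>

lemma defect_lower_bound:
  assumes g: "\<And>z. z \<in> square d \<Longrightarrow> grad phi1 z \<bullet> (3, -1) \<ge> 1" and h: "54 * pi\<^sup>2 * mesh_size J \<le> 1 / 2"
  shows "l2_inner v (J_op J chi) - l2_inner v chi \<ge> d * (mesh_size J)\<^sup>2 / 216"
proof -
  define s where "s = stencil (\<lambda>k i. double_area J k * defect_coef (corner_val J chi k) i)"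
  define N where "N = nat \<lfloor>4 * real J * d\<rfloor>"
  have h0: "mesh_size J > 0" by (rule h_pos)
  have s: "s J m \<ge> mesh_size J ^ 3 / 216" if m: "\<bar>mesh_y J m - 1/4\<bar> \<le> d" for m
  proof -
    have "(1/4, mesh_y J m) \<in> square d" using m d by (auto simp: square_def)
    then have "s J m \<ge> mesh_size J ^ 3 / 108 * (1 - 54 * pi\<^sup>2 * mesh_size J)"
      unfolding s_def using P_vertices_range[OF m] g by (intro defect_stencil_ge) auto
    moreover have "mesh_size J ^ 3 / 108 * (1 - 54 * pi\<^sup>2 * mesh_size J) \<ge> mesh_size J ^ 3 / 108 * (1 / 2)"
      using h h0 by (intro mult_left_mono) auto
    ultimately show ?thesis by simp
  qed
  have "l2_inner v (J_op J chi) - l2_inner v chi = (\<Sum>j<7*J. \<Sum>m<4*J. node_val J v (j, m) * s j m)"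
  proof -
    have "l2_inner v (J_op J chi) - l2_inner v chi = (\<Sum>k\<in>triangles J. double_area J k * defect_loc (corner_val J chi k) (corner_val J v k))"
      unfolding defect_formula[OF v_mem chi_mem] by (simp add: defect_loc_def mult.commute)
    then show ?thesis
      unfolding defect_loc_coef s_def by (subst assembly[OF v_mem, symmetric]) (simp add: algebra_simps)
  qed
  also have "\<dots> = (\<Sum>j\<in>{J}. \<Sum>m<4*J. node_val J v (j, m) * s j m)"
    using J_pos by (intro sum.mono_neutral_right) (auto simp: node_val_v)
  also have "\<dots> = (\<Sum>m<4*J. node_val J v (J, m) * s J m)" by simp
  also have "\<dots> \<ge> (\<Sum>m\<in>{J..J + N}. node_val J v (J, m) * s J m)"
  proof (rule sum_mono2)
    have "4 * real J * d < real J" using d real_J_pos by simp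
    then have "N < J" unfolding N_def using d real_J_pos by linarith
    then show "{J..J + N} \<subseteq> {..<4 * J}" by auto
    show "0 \<le> node_val J v (J, m) * s J m" for m
    proof (cases "\<bar>mesh_y J m - 1/4\<bar> \<le> d")
      case True
      have "0 \<le> mesh_size J ^ 3 / 216" using h0 by simp
      also note s[OF True]
      finally show ?thesis by (simp add: node_val_v)
    qed (simp add: node_val_v)
  qed simp
  moreover have "(\<Sum>m\<in>{J..J + N}. node_val J v (J, m) * s J m) \<ge> (\<Sum>m\<in>{J..J + N}. mesh_size J ^ 3 / 216)"
  proof (rule sum_mono)
    fix m assume m: "m \<in> {J..J + N}"
    have "real N \<le> 4 * real J * d" unfolding N_def using d real_J_pos by simp
    then have "real m - real J \<le> 4 * real J * d" "0 \<le> real m - real J" using m by auto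
    then have "(real m - real J) * mesh_size J \<le> 4 * real J * d * mesh_size J" "0 \<le> (real m - real J) * mesh_size J"
      using h0 by (auto intro: mult_right_mono)
    moreover have "4 * real J * d * mesh_size J = d" using real_J_pos by (simp add: mesh_size_def)
    moreover have "(real m - real J) * mesh_size J = mesh_y J m - 1/4"
      using J_mesh_size by (simp add: mesh_y_def left_diff_distrib)
    ultimately have "\<bar>mesh_y J m - 1/4\<bar> \<le> d" by simp
    then show "node_val J v (J, m) * s J m \<ge> mesh_size J ^ 3 / 216" using s by (simp add: node_val_v)
  qed
  moreover have "(\<Sum>m\<in>{J..J + N}. mesh_size J ^ 3 / 216) \<ge> d * (mesh_size J)\<^sup>2 / 216"
  proof -
    have "4 * real J * d \<le> real (Suc N)" unfolding N_def using d real_J_pos by linarith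
    then have "4 * real J * d * mesh_size J ^ 3 \<le> real (Suc N) * mesh_size J ^ 3"
      using h0 by (intro mult_right_mono) auto
    moreover have "4 * real J * d * mesh_size J ^ 3 = d * (mesh_size J)\<^sup>2"
      using real_J_pos by (simp add: mesh_size_def power2_eq_square power3_eq_cube)
    ultimately show ?thesis by simp
  qed
  ultimately show ?thesis by linarith
qed

end

section \<open>The lower bound\<close>

theorem proposition5p2:
  fixes d :: real
  assumes "0 < d" and "d < 1/4"
    and "\<forall>z\<in>square d. grad phi1 z \<bullet> (3, -1) \<ge> 1"
  shows "\<forall>t>0. \<exists>c>0. \<exists>h0>0. \<forall>J::nat. J > 0 \<longrightarrow> mesh_size J \<le> h0 \<longrightarrow>
           l2_norm (E_op J t (Delta_op J (Q_op J (v_fun J d))))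
             \<ge> c * mesh_size J powr (3/2) * l2_norm (v_fun J d)"
proof (intro allI impI)
  fix t :: real assume t: "t > 0"
  define X where "X = exp (2 * pi\<^sup>2 * t)"
  have X: "X > 0" by (simp add: X_def)
  \<comment> \<open>With this weight the residual term is exactly a quarter of the lower bound \<open>d h^2 / 216\<close> for the defect; the bound \<open>h0\<close> makes the energy term at most another quarter.\<close>
  define \<alpha> where "\<alpha> = 864 * X * t * (3780 * pi ^ 6) / d"
  have \<alpha>: "\<alpha> > 0" using X t assms by (simp add: \<alpha>_def)
  define h0 where "h0 = min (1 / (108 * pi\<^sup>2)) (d / (216 * X * \<alpha>))"
  have h0: "h0 > 0" using X \<alpha> assms by (simp add: h0_def)
  define c where "c = d / (X * 432 * 8)"
  have c: "c > 0" using X assms by (simp add: c_def)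
  show "\<exists>c>0. \<exists>h0>0. \<forall>J::nat. J > 0 \<longrightarrow> mesh_size J \<le> h0 \<longrightarrow>
           l2_norm (E_op J t (Delta_op J (Q_op J (v_fun J d))))
             \<ge> c * mesh_size J powr (3/2) * l2_norm (v_fun J d)"
  proof (rule exI[of _ c], intro conjI c exI[of _ h0] h0 allI impI)
    fix J :: nat assume J: "J > 0" and hJ: "mesh_size J \<le> h0"
    interpret mesh_square J d by unfold_locales (use J assms in auto)
    define h where "h = mesh_size J"
    have h: "h > 0" unfolding h_def by (rule h_pos)
    have "h \<le> 1 / (108 * pi\<^sup>2)" "h \<le> d / (216 * X * \<alpha>)" using hJ by (auto simp: h0_def h_def)
    then have h1: "54 * pi\<^sup>2 * h \<le> 1 / 2" and h2: "X * (\<alpha> / 4 * h) \<le> d / 864"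
      using X \<alpha> by (simp_all add: field_simps)
    define q where "q = Q_op J v"
    have q: "q \<in> S_space J" and Q: "\<And>\<eta>. \<eta> \<in> S_space J \<Longrightarrow> grad_inner q \<eta> = l2_inner v (J_op J \<eta>) - l2_inner v \<eta>"
      using Q_op[OF v_mem] by (auto simp: q_def)
    define \<rho> where "\<rho> = (\<lambda>p. Delta_op J chi p + 2 * pi\<^sup>2 * chi p)"
    have \<rho>: "\<rho> \<in> S_space J" unfolding \<rho>_def by (intro S_lin GF.A_mem chi_mem)
    have res: "lumped_inner J \<rho> \<eta> = - grad_inner chi \<eta> + 2 * pi\<^sup>2 * lumped_inner J chi \<eta>" if \<eta>: "\<eta> \<in> S_space J" for \<eta>
      using FS.linear_formD[OF FS.semi_innerD(1)[OF GF.semi_inner_m \<eta>] GF.A_mem[OF chi_mem] chi_mem, of "2 * pi\<^sup>2"]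
        GF.A_weak[OF chi_mem \<eta>] by (simp add: \<rho>_def)
    let ?w = "Delta_op J q" and ?u = "op_exp (Delta_op J) t (Delta_op J q)"
    have u: "?u \<in> S_space J" by (intro GF.exp_mem GF.A_mem q)
    have "\<bar>X * lumped_inner J ?u chi - lumped_inner J ?w chi\<bar>
      \<le> X * (\<alpha> / 4 * grad_inner q q + t / (2 * \<alpha>) * lumped_inner J \<rho> \<rho>)"
      unfolding X_def by (rule GF.perturbed_eigenfunction[OF q chi_mem \<rho> res \<alpha>]) (use t in auto)
    also have "\<dots> \<le> X * (\<alpha> / 4 * h ^ 3 + t / (2 * \<alpha>) * (7560 * pi ^ 6 * h\<^sup>2))"
      using Q_energy[OF q Q[OF q]] residual_energy[OF \<rho> res[OF \<rho>]] X \<alpha> t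
      by (intro mult_left_mono add_mono) (auto simp: h_def)
    also have "\<dots> = (X * (\<alpha> / 4 * h)) * h\<^sup>2 + d / 864 * h\<^sup>2"
      using X t assms by (simp add: \<alpha>_def power3_eq_cube power2_eq_square field_simps)
    also have "\<dots> \<le> d / 864 * h\<^sup>2 + d / 864 * h\<^sup>2"
      using h2 by (intro add_mono mult_right_mono) auto
    finally have close: "\<bar>X * lumped_inner J ?u chi - lumped_inner J ?w chi\<bar> \<le> d * h\<^sup>2 / 432" by simp
    have "lumped_inner J ?w chi = - (l2_inner v (J_op J chi) - l2_inner v chi)"
      using GF.A_weak[OF q chi_mem] Q[OF chi_mem] by simp
    moreover have "l2_inner v (J_op J chi) - l2_inner v chi \<ge> d * h\<^sup>2 / 216"
      unfolding h_def by (rule defect_lower_bound) (use assms h1 in \<open>auto simp: h_def\<close>)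
    ultimately have "d * h\<^sup>2 / 432 \<le> \<bar>X * lumped_inner J ?u chi\<bar>" using close by linarith
    then have "d * h\<^sup>2 / 432 / X \<le> \<bar>lumped_inner J ?u chi\<bar>"
      using X by (simp add: abs_mult field_simps)
    then have low: "d * h\<^sup>2 / 432 / X / 4 \<le> l2_norm ?u"
      using X h assms by (intro norm_lower_bound[OF u]) auto
    have "c * h powr (3/2) * l2_norm v \<le> c * h powr (3/2) * sqrt (2 * h)"
      using v_norm c by (intro mult_left_mono) (auto simp: h_def)
    also have "\<dots> = c * (h\<^sup>2 * sqrt 2)"
    proof -
      have "h powr (3/2) = h * sqrt h"
        using powr_add[of h 1 "1/2"] h by (simp add: powr_half_sqrt)
      then show ?thesis using h by (simp add: real_sqrt_mult power2_eq_square)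
    qed
    also have "\<dots> \<le> c * (h\<^sup>2 * 2)"
      using c by (intro mult_left_mono) (auto intro: real_le_lsqrt)
    also have "\<dots> = d * h\<^sup>2 / 432 / X / 4" by (simp add: c_def)
    also note low
    finally show "l2_norm (E_op J t (Delta_op J (Q_op J (v_fun J d))))
        \<ge> c * mesh_size J powr (3/2) * l2_norm (v_fun J d)"
      by (simp add: E_op_def q_def v_def h_def)
  qed
qed

end
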